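(* Let $(A,\mathfrak m)$ be a one-dimensional Cohen-Macaulay local ring with infinite residue field and reduction number $r$, and let $xA$ be a minimal reduction of $\mathfrak m$. Let $\alpha_i$, $\beta_i$, $\gamma_i$ be the invariants of the tangent cone, the micro-invariants of $A$, and the Apery invariants of $A$ with respect to $x$, respectively. Assume that the tangent cone $G(\mathfrak m)$ is Cohen-Macaulay. Then for $1\le i\le r$, $$0<\alpha_i=\beta_i=\gamma_i=\mu(\mathfrak m^i)-\mu(\mathfrak m^{i-1}).$$
   Context: $\lambda$ denotes length of $A$-modules, $\mu$ the minimal number of generators, and $\mathfrak m^0=A$. $K=A/\mathfrak m$. The tangent cone is $G(\mathfrak m)=\bigoplus_{n\ge 0}\mathfrak m^n/\mathfrak m^{n+1}$. An ideal $xA$ with $x\in\mathfrak m$ is a minimal reduction of $\mathfrak m$ if $\mathfrak m^{n+1}=x\mathfrak m^n$ for some $n$; the reduction number $r$ is the least integer $r\ge 0$ with $\mathfrak m^{r+1}=x\mathfrak m^r$ (independent of the choice of $x$). Invariants of the tangent cone: let $F(x)=\bigoplus_{n\ge 0}x^nA/x^n\mathfrak m\hookrightarrow G(\mathfrak m)$, a polynomial ring $K[x^*]$ in the initial form $x^*\in\mathfrak m/\mathfrak m^2$. As a graded $F(x)$-module, $$G(\mathfrak m)\cong\bigoplus_{i=0}^{r}\left(F(x)(-i)\right)^{\alpha_i}\oplus\bigoplus_{i=1}^{r-1}\bigoplus_{j=1}^{r-i}\left(\frac{F(x)}{(x^* )^jF(x)}(-i)\right)^{\alpha_{i,j}}$$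 for uniquely determined non-negative integers $\alpha_i,\alpha_{i,j}$ (with $\alpha_0=1$). Micro-invariants: let $A'=A[\mathfrak m/x]$ be the first neighborhood ring of $A$, i.e. the subring of the total ring of fractions of $A$ generated over $A$ by the elements $b/x$, $b\in\mathfrak m$. Then $\beta_0=1$ and, for $1\le i\le r$, $$\beta_i=\lambda\left(\frac{A+\mathfrak m^{i-1}A'}{A+\mathfrak m^iA'}\right)-\lambda\left(\frac{A+\mathfrak m^{i}A'}{A+\mathfrak m^{i+1}A'}\right).$$ Apery invariants with respect to $x$: $\gamma_i=\lambda\left(\dfrac{\mathfrak m^i+xA}{\mathfrak m^{i+1}+xA}\right)$. *)

theory Defs
  imports "HOL-Algebra.Ring_Divisibility" "HOL-Algebra.Ideal_Product"
    "HOL-Algebra.Generated_Rings" "HOL-Library.Extended_Real"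
begin

section \<open>Noetherian and Cohen-Macaulay rings\<close>

definition krull_dim :: "('a, 'm) ring_scheme \<Rightarrow> enat" where
  "krull_dim R = Sup {enat n | n. \<exists>P :: nat \<Rightarrow> 'a set.
     (\<forall>i\<le>n. primeideal (P i) R) \<and> (\<forall>i<n. P i \<subset> P (Suc i))}"

definition regular_elements :: "('a, 'm) ring_scheme \<Rightarrow> 'a set" where
  "regular_elements R =
     {s \<in> carrier R. \<forall>a\<in>carrier R. s \<otimes>\<^bsub>R\<^esub> a = \<zero>\<^bsub>R\<^esub> \<longrightarrow> a = \<zero>\<^bsub>R\<^esub>}"

definition regular_sequence :: "('a, 'm) ring_scheme \<Rightarrow> 'a list \<Rightarrow> bool" where
  "regular_sequence R xs \<longleftrightarrow>
     set xs \<subseteq> carrier R \<and>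
     (\<forall>i<length xs. Idl\<^bsub>R\<^esub> (set (take i xs)) +>\<^bsub>R\<^esub> (xs ! i)
        \<in> regular_elements (R Quot (Idl\<^bsub>R\<^esub> (set (take i xs))))) \<and>
     Idl\<^bsub>R\<^esub> (set xs) \<noteq> carrier R"

definition depth :: "('a, 'm) ring_scheme \<Rightarrow> 'a set \<Rightarrow> enat" where
  "depth R I = Sup {enat (length xs) | xs. set xs \<subseteq> I \<and> regular_sequence R xs}"

locale local_ring = cring R + maximalideal \<mm> R for R (structure) and \<mm> +
  assumes maximal_unique: "maximalideal \<nn> R \<Longrightarrow> \<nn> = \<mm>"

locale cohen_macaulay_local_ring = local_ring R \<mm> + noetherian_ring R
  for R (structure) and \<mm> +
  assumes depth_eq_dim: "depth R \<mm> = krull_dim R"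

text \<open>The class of \<open>r / s\<close> in the localization of \<open>R\<close> at the multiplicative set \<open>S\<close>.\<close>

definition frac_class :: "('a, 'm) ring_scheme \<Rightarrow> 'a set \<Rightarrow> 'a \<Rightarrow> 'a \<Rightarrow> ('a \<times> 'a) set" where
  "frac_class R S r s =
     {(r', s'). r' \<in> carrier R \<and> s' \<in> S \<and>
        (\<exists>t\<in>S. t \<otimes>\<^bsub>R\<^esub> (s' \<otimes>\<^bsub>R\<^esub> r) = t \<otimes>\<^bsub>R\<^esub> (s \<otimes>\<^bsub>R\<^esub> r'))}"

definition localization :: "('a, 'm) ring_scheme \<Rightarrow> 'a set \<Rightarrow> ('a \<times> 'a) set ring" where
  "localization R S =
     \<lparr>carrier = {frac_class R S r s | r s. r \<in> carrier R \<and> s \<in> S},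
      mult = (\<lambda>U V. \<Union>(r, s)\<in>U. \<Union>(r', s')\<in>V.
                frac_class R S (r \<otimes>\<^bsub>R\<^esub> r') (s \<otimes>\<^bsub>R\<^esub> s')),
      one = frac_class R S \<one>\<^bsub>R\<^esub> \<one>\<^bsub>R\<^esub>,
      zero = frac_class R S \<zero>\<^bsub>R\<^esub> \<one>\<^bsub>R\<^esub>,
      add = (\<lambda>U V. \<Union>(r, s)\<in>U. \<Union>(r', s')\<in>V.
               frac_class R S ((r \<otimes>\<^bsub>R\<^esub> s') \<oplus>\<^bsub>R\<^esub> (r' \<otimes>\<^bsub>R\<^esub> s)) (s \<otimes>\<^bsub>R\<^esub> s'))\<rparr>"

text \<open>For a ring that need not be local: all localizations at maximal ideals are Cohen-Macaulay.
  The \<open>\<nn>\<close> below is the maximal ideal of the localization.\<close>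

definition cohen_macaulay_ring :: "('a, 'm) ring_scheme \<Rightarrow> bool" where
  "cohen_macaulay_ring R \<longleftrightarrow> cring R \<and> noetherian_ring R \<and>
     (\<forall>P. maximalideal P R \<longrightarrow>
        (\<exists>\<nn>. cohen_macaulay_local_ring (localization R (carrier R - P)) \<nn>))"


section \<open>Length and number of generators\<close>

definition module_length :: "('a, 'm) ring_scheme \<Rightarrow> ('a, 'b, 'n) module_scheme \<Rightarrow> enat" where
  "module_length R M = Sup {enat n | n. \<exists>N :: nat \<Rightarrow> 'b set.
     (\<forall>i\<le>n. submodule (N i) R M) \<and> (\<forall>i<n. N i \<subset> N (Suc i))}"

text \<open>Here and below the fields \<open>mult\<close> and \<open>one\<close> of a module record carry no meaning.\<close>

definition quot_module :: "('a, 'b, 'n) module_scheme \<Rightarrow> 'b set \<Rightarrow> ('a, 'b set) module" where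
  "quot_module M L =
     \<lparr>carrier = a_rcosets\<^bsub>M\<^esub> L, mult = undefined, one = undefined,
      zero = L, add = set_add M,
      smult = (\<lambda>a C. \<Union>v\<in>C. L +>\<^bsub>M\<^esub> (a \<odot>\<^bsub>M\<^esub> v))\<rparr>"

text \<open>The ring \<open>S\<close> as a module over the domain of a ring homomorphism \<open>h\<close> into \<open>S\<close>.\<close>

definition module_via :: "('a \<Rightarrow> 'b) \<Rightarrow> ('b, 'n) ring_scheme \<Rightarrow> ('a, 'b) module" where
  "module_via h S =
     \<lparr>carrier = carrier S, mult = mult S, one = \<one>\<^bsub>S\<^esub>, zero = \<zero>\<^bsub>S\<^esub>, add = add S,
      smult = (\<lambda>a v. h a \<otimes>\<^bsub>S\<^esub> v)\<rparr>"

text \<open>The length of \<open>N / L\<close> for submodules \<open>L \<subseteq> N\<close> of \<open>M\<close>.\<close>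

definition quot_length ::
    "('a, 'm) ring_scheme \<Rightarrow> ('a, 'b) module \<Rightarrow> 'b set \<Rightarrow> 'b set \<Rightarrow> enat" where
  "quot_length R M N L = module_length R (quot_module (M\<lparr>carrier := N\<rparr>) L)"

definition min_gens :: "('a, 'm) ring_scheme \<Rightarrow> 'a set \<Rightarrow> enat" where
  "min_gens R I = Inf {enat (card S) | S. S \<subseteq> carrier R \<and> finite S \<and> I = Idl\<^bsub>R\<^esub> S}"


section \<open>Reductions\<close>

abbreviation ideal_pow :: "('a, 'm) ring_scheme \<Rightarrow> 'a set \<Rightarrow> nat \<Rightarrow> 'a set" where
  "ideal_pow R I n \<equiv> I [^]\<^bsub>ideals_set R\<^esub> n"

definition minimal_reduction :: "('a, 'm) ring_scheme \<Rightarrow> 'a set \<Rightarrow> 'a \<Rightarrow> bool" where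
  "minimal_reduction A \<mm> x \<longleftrightarrow>
     x \<in> \<mm> \<and> (\<exists>n. ideal_pow A \<mm> (n + 1) = x <#\<^bsub>A\<^esub> ideal_pow A \<mm> n)"

definition reduction_number :: "('a, 'm) ring_scheme \<Rightarrow> 'a set \<Rightarrow> 'a \<Rightarrow> nat" where
  "reduction_number A \<mm> x =
     (LEAST n. ideal_pow A \<mm> (n + 1) = x <#\<^bsub>A\<^esub> ideal_pow A \<mm> n)"


section \<open>The tangent cone and the subring \<open>F(x)\<close>\<close>

text \<open>
  The graded ring with degree \<open>n\<close> part \<open>N n / L n\<close>, for ideals \<open>L n \<subseteq> N n\<close> of \<open>A\<close> with
  \<open>N i * N j \<subseteq> N (i + j)\<close> and \<open>N i * L j \<subseteq> L (i + j)\<close>. An element is the family of its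
  homogeneous components, each of them a coset of \<open>L n\<close>, that is, an element of \<open>A Quot L n\<close>.
\<close>

definition graded_quot_ring ::
    "('a, 'm) ring_scheme \<Rightarrow> (nat \<Rightarrow> 'a set) \<Rightarrow> (nat \<Rightarrow> 'a set) \<Rightarrow> (nat \<Rightarrow> 'a set) ring" where
  "graded_quot_ring A N L =
     \<lparr>carrier = {g. (\<forall>n. \<exists>a\<in>N n. g n = L n +>\<^bsub>A\<^esub> a) \<and> finite {n. g n \<noteq> L n}},
      mult = (\<lambda>g h n. \<Oplus>\<^bsub>A Quot L n\<^esub>i\<in>{..n}. rcoset_mult A (L n) (g i) (h (n - i))),
      one = (\<lambda>n. if n = 0 then L 0 +>\<^bsub>A\<^esub> \<one>\<^bsub>A\<^esub> else L n),
      zero = L,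
      add = (\<lambda>g h n. g n \<oplus>\<^bsub>A Quot L n\<^esub> h n)\<rparr>"

definition graded_part :: "('b \<Rightarrow> 'c, 'm) ring_scheme \<Rightarrow> 'b \<Rightarrow> ('b \<Rightarrow> 'c) set" where
  "graded_part G n = {g \<in> carrier G. \<forall>k. k \<noteq> n \<longrightarrow> g k = \<zero>\<^bsub>G\<^esub> k}"

definition tangent_cone :: "('a, 'm) ring_scheme \<Rightarrow> 'a set \<Rightarrow> (nat \<Rightarrow> 'a set) ring" where
  "tangent_cone A \<mm> =
     graded_quot_ring A (\<lambda>n. ideal_pow A \<mm> n) (\<lambda>n. ideal_pow A \<mm> (n + 1))"

definition F_ring :: "('a, 'm) ring_scheme \<Rightarrow> 'a set \<Rightarrow> 'a \<Rightarrow> (nat \<Rightarrow> 'a set) ring" where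
  "F_ring A \<mm> x =
     graded_quot_ring A (\<lambda>n. PIdl\<^bsub>A\<^esub> (x [^]\<^bsub>A\<^esub> n)) (\<lambda>n. (x [^]\<^bsub>A\<^esub> n) <#\<^bsub>A\<^esub> \<mm>)"

definition initial_form ::
    "('a, 'm) ring_scheme \<Rightarrow> 'a set \<Rightarrow> 'a \<Rightarrow> nat \<Rightarrow> 'a set" where
  "initial_form A \<mm> x = (\<zero>\<^bsub>F_ring A \<mm> x\<^esub>)(1 := (x <#\<^bsub>A\<^esub> \<mm>) +>\<^bsub>A\<^esub> x)"

text \<open>The inclusion of \<open>F(x)\<close> into the tangent cone sends the coset \<open>a + x^n \<mm>\<close> to
  the coset \<open>a + \<mm>^(n+1)\<close>.\<close>

definition F_incl ::
    "('a, 'm) ring_scheme \<Rightarrow> 'a set \<Rightarrow> (nat \<Rightarrow> 'a set) \<Rightarrow> nat \<Rightarrow> 'a set" where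
  "F_incl A \<mm> f = (\<lambda>n. ideal_pow A \<mm> (n + 1) <+>\<^bsub>A\<^esub> f n)"


section \<open>Graded modules\<close>

record ('a, 'b) graded_module = "('a, 'b) module" +
  homog :: "nat \<Rightarrow> 'b set"

definition with_grading ::
    "('a, 'b) module \<Rightarrow> (nat \<Rightarrow> 'b set) \<Rightarrow> ('a, 'b) graded_module" where
  "with_grading M H = module.extend M \<lparr>homog = H\<rparr>"

text \<open>The shifted module \<open>M(-i)\<close>.\<close>

definition graded_shift :: "nat \<Rightarrow> ('a, 'b) graded_module \<Rightarrow> ('a, 'b) graded_module" where
  "graded_shift i M = M\<lparr>homog := (\<lambda>n. if i \<le> n then homog M (n - i) else {\<zero>\<^bsub>M\<^esub>})\<rparr>"

definition graded_quot ::
    "('a, 'b) graded_module \<Rightarrow> 'b set \<Rightarrow> ('a, 'b set) graded_module" where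
  "graded_quot M L = with_grading (quot_module M L) (\<lambda>n. (\<lambda>v. L +>\<^bsub>M\<^esub> v) ` homog M n)"

text \<open>The direct sum over a finite index set \<open>I\<close>, as a set of extensional functions.\<close>

definition graded_dsum ::
    "'i set \<Rightarrow> ('i \<Rightarrow> ('a, 'b) graded_module) \<Rightarrow> ('a, 'i \<Rightarrow> 'b) graded_module" where
  "graded_dsum I M =
     \<lparr>carrier = (\<Pi>\<^sub>E i\<in>I. carrier (M i)), mult = undefined, one = undefined,
      zero = (\<lambda>i\<in>I. \<zero>\<^bsub>M i\<^esub>),
      add = (\<lambda>u v. \<lambda>i\<in>I. u i \<oplus>\<^bsub>M i\<^esub> v i),
      smult = (\<lambda>a v. \<lambda>i\<in>I. a \<odot>\<^bsub>M i\<^esub> v i),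
      homog = (\<lambda>n. \<Pi>\<^sub>E i\<in>I. homog (M i) n)\<rparr>"

definition graded_dsum2 ::
    "('a, 'b) graded_module \<Rightarrow> ('a, 'c) graded_module \<Rightarrow> ('a, 'b \<times> 'c) graded_module" where
  "graded_dsum2 M N =
     \<lparr>carrier = carrier M \<times> carrier N, mult = undefined, one = undefined,
      zero = (\<zero>\<^bsub>M\<^esub>, \<zero>\<^bsub>N\<^esub>),
      add = (\<lambda>(u, v) (u', v'). (u \<oplus>\<^bsub>M\<^esub> u', v \<oplus>\<^bsub>N\<^esub> v')),
      smult = (\<lambda>a (u, v). (a \<odot>\<^bsub>M\<^esub> u, a \<odot>\<^bsub>N\<^esub> v)),
      homog = (\<lambda>n. homog M n \<times> homog N n)\<rparr>"

definition graded_module_iso ::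
    "('a, 'm) ring_scheme \<Rightarrow> ('a, 'b) graded_module \<Rightarrow> ('a, 'c) graded_module \<Rightarrow> ('b \<Rightarrow> 'c) set"
  where
  "graded_module_iso R M N = {h. bij_betw h (carrier M) (carrier N) \<and>
     (\<forall>u\<in>carrier M. \<forall>v\<in>carrier M. h (u \<oplus>\<^bsub>M\<^esub> v) = h u \<oplus>\<^bsub>N\<^esub> h v) \<and>
     (\<forall>a\<in>carrier R. \<forall>v\<in>carrier M. h (a \<odot>\<^bsub>M\<^esub> v) = a \<odot>\<^bsub>N\<^esub> h v) \<and>
     (\<forall>n. h ` homog M n = homog N n)}"


section \<open>The three families of invariants\<close>

definition tangent_cone_module ::
    "('a, 'm) ring_scheme \<Rightarrow> 'a set \<Rightarrow> (nat \<Rightarrow> 'a set, nat \<Rightarrow> 'a set) graded_module" where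
  "tangent_cone_module A \<mm> =
     with_grading (module_via (F_incl A \<mm>) (tangent_cone A \<mm>)) (graded_part (tangent_cone A \<mm>))"

definition F_module ::
    "('a, 'm) ring_scheme \<Rightarrow> 'a set \<Rightarrow> 'a \<Rightarrow> (nat \<Rightarrow> 'a set, nat \<Rightarrow> 'a set) graded_module" where
  "F_module A \<mm> x =
     with_grading (module_via id (F_ring A \<mm> x)) (graded_part (F_ring A \<mm> x))"

text \<open>In both index sets below the last component numbers the copies of a summand.\<close>

definition tangent_cone_invariants ::
    "('a, 'm) ring_scheme \<Rightarrow> 'a set \<Rightarrow> 'a \<Rightarrow> (nat \<Rightarrow> nat) \<Rightarrow> (nat \<Rightarrow> nat \<Rightarrow> nat) \<Rightarrow> bool" where
  "tangent_cone_invariants A \<mm> x \<alpha> \<alpha>t \<longleftrightarrow>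
     (let r = reduction_number A \<mm> x;
          F = F_ring A \<mm> x;
          Free = graded_dsum {(i, k). i \<le> r \<and> k < \<alpha> i}
            (\<lambda>(i, k). graded_shift i (F_module A \<mm> x));
          Torsion = graded_dsum
            {(i, j, k). i \<in> {1..r - 1} \<and> j \<in> {1..r - i} \<and> k < \<alpha>t i j}
            (\<lambda>(i, j, k). graded_shift i
               (graded_quot (F_module A \<mm> x) (PIdl\<^bsub>F\<^esub> (initial_form A \<mm> x [^]\<^bsub>F\<^esub> j))))
      in graded_module_iso F (tangent_cone_module A \<mm>) (graded_dsum2 Free Torsion) \<noteq> {})"

definition total_fractions :: "('a, 'm) ring_scheme \<Rightarrow> ('a \<times> 'a) set ring" where
  "total_fractions A = localization A (regular_elements A)"

definition fraction :: "('a, 'm) ring_scheme \<Rightarrow> 'a \<Rightarrow> 'a \<Rightarrow> ('a \<times> 'a) set" where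
  "fraction A a s = frac_class A (regular_elements A) a s"

abbreviation to_fractions :: "('a, 'm) ring_scheme \<Rightarrow> 'a \<Rightarrow> ('a \<times> 'a) set" where
  "to_fractions A a \<equiv> fraction A a \<one>\<^bsub>A\<^esub>"

definition neighborhood_ring ::
    "('a, 'm) ring_scheme \<Rightarrow> 'a set \<Rightarrow> 'a \<Rightarrow> ('a \<times> 'a) set set" where
  "neighborhood_ring A \<mm> x = generate_ring (total_fractions A)
     (to_fractions A ` carrier A \<union> (\<lambda>b. fraction A b x) ` \<mm>)"

text \<open>The submodule \<open>A + \<mm>^i A'\<close> of the total ring of fractions.\<close>

definition micro_submodule ::
    "('a, 'm) ring_scheme \<Rightarrow> 'a set \<Rightarrow> 'a \<Rightarrow> nat \<Rightarrow> ('a \<times> 'a) set set" where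
  "micro_submodule A \<mm> x i =
     to_fractions A ` carrier A <+>\<^bsub>total_fractions A\<^esub>
     ideal_prod (total_fractions A) (to_fractions A ` ideal_pow A \<mm> i) (neighborhood_ring A \<mm> x)"

text \<open>Extended reals leave the difference of two lengths free of truncation, and it is finite
  only if both lengths are.\<close>

definition micro_invariant ::
    "('a, 'm) ring_scheme \<Rightarrow> 'a set \<Rightarrow> 'a \<Rightarrow> nat \<Rightarrow> ereal" where
  "micro_invariant A \<mm> x i = (if i = 0 then 1 else
     (let M = module_via (to_fractions A) (total_fractions A);
          V = micro_submodule A \<mm> x
      in ereal_of_enat (quot_length A M (V (i - 1)) (V i))
         - ereal_of_enat (quot_length A M (V i) (V (i + 1)))))"

definition apery_invariant :: "('a, 'm) ring_scheme \<Rightarrow> 'a set \<Rightarrow> 'a \<Rightarrow> nat \<Rightarrow> enat" where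
  "apery_invariant A \<mm> x i =
     quot_length A (module_via id A)
       (ideal_pow A \<mm> i <+>\<^bsub>A\<^esub> PIdl\<^bsub>A\<^esub> x)
       (ideal_pow A \<mm> (i + 1) <+>\<^bsub>A\<^esub> PIdl\<^bsub>A\<^esub> x)"

end

theory Submission
  imports Defs
begin

text \<open>Why the theorem holds. Let \<open>d n\<close> be the length of \<open>\<mm>\<^sup>n / \<mm>\<^sup>n\<^sup>+\<^sup>1\<close>. By Nakayama's lemma \<open>d n\<close> is the minimal
number of generators of \<open>\<mm>\<^sup>n\<close> (\<open>min_gens_eq_ideal_length\<close>), so the claim is that the three invariants
of degree \<open>i\<close> are all equal to \<open>d i - d (i - 1)\<close>, and that this number is positive.

The hypothesis on the tangent cone \<open>G\<close> enters only through one consequence: the initial form \<open>x*\<close>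
is not a zero divisor of \<open>G\<close> (\<open>initial_form_regular\<close>). Some power of the irrelevant ideal \<open>G\<^sub>+\<close>
lies in \<open>x* G\<close>, because \<open>\<mm>\<^sup>k\<^sup>+\<^sup>1 = x \<mm>\<^sup>k\<close> for large \<open>k\<close>; hence an element killed by \<open>x*\<close> is killed by
a power of each element of \<open>G\<^sub>+\<close>. The localization of \<open>G\<close> at \<open>G\<^sub>+\<close> has positive dimension, since \<open>x*\<close>
is not nilpotent there, so being Cohen-Macaulay it has positive depth, and one of the elements of
its maximal ideal is regular. A homogeneous element killed by \<open>x*\<close> therefore vanishes in the
localization, and then in \<open>G\<close>, because an element outside \<open>G\<^sub>+\<close> has a unit in degree \<open>0\<close>. In terms
of the ideals of \<open>A\<close>, regularity of \<open>x*\<close> says that \<open>x a \<in> \<mm>\<^sup>n\<^sup>+\<^sup>1\<close> implies \<open>a \<in> \<mm>\<^sup>n\<close> (\<open>colon\<close>).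

Apery invariants and micro-invariants are two instances of one computation (\<open>length_shifted\<close>): the
length of \<open>(x\<^sup>k A + \<mm>\<^sup>k\<^sup>+\<^sup>j) / (x\<^sup>k A + \<mm>\<^sup>k\<^sup>+\<^sup>j\<^sup>+\<^sup>1)\<close> is \<open>d (k + j) - d j\<close>. Indeed this quotient is \<open>\<mm>\<^sup>k\<^sup>+\<^sup>j\<close> modulo
\<open>x\<^sup>k \<mm>\<^sup>j + \<mm>\<^sup>k\<^sup>+\<^sup>j\<^sup>+\<^sup>1\<close>, and multiplication by \<open>x\<^sup>k\<close> embeds \<open>\<mm>\<^sup>j / \<mm>\<^sup>j\<^sup>+\<^sup>1\<close> into \<open>\<mm>\<^sup>k\<^sup>+\<^sup>j / \<mm>\<^sup>k\<^sup>+\<^sup>j\<^sup>+\<^sup>1\<close>. For \<open>k = 1\<close>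
this is the Apery invariant of degree \<open>j + 1\<close>. For \<open>k = r\<close>, the first neighborhood ring \<open>A'\<close> is
\<open>x\<^sup>-\<^sup>r \<mm>\<^sup>r\<close>, so multiplication by \<open>x\<^sup>r\<close> carries \<open>A + \<mm>\<^sup>j A'\<close> onto \<open>x\<^sup>r A + \<mm>\<^sup>r\<^sup>+\<^sup>j\<close>; as \<open>d (r + j) = d r\<close>, two
consecutive lengths differ by \<open>d (j + 1) - d j\<close>, which is the micro-invariant.

In a decomposition of \<open>G\<close> over \<open>F(x)\<close> a torsion summand would contain a nonzero element killed by a
power of \<open>x*\<close>, so there is none (\<open>no_torsion\<close>). Each free summand \<open>F(x)(-i)\<close> contributes length \<open>1\<close>
in every degree \<open>n \<ge> i\<close>, so \<open>d n\<close> is the sum of the \<open>\<alpha> i\<close> with \<open>i \<le> n\<close> (\<open>hilb_eq_card\<close>).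

If the Apery invariant of degree \<open>i\<close> were zero, \<open>\<mm>\<^sup>i\<close> would be contained in \<open>x \<mm>\<^sup>i\<^sup>-\<^sup>1 + \<mm>\<^sup>i\<^sup>+\<^sup>1\<close>, hence
equal to \<open>x \<mm>\<^sup>i\<^sup>-\<^sup>1\<close> by Nakayama's lemma, and the reduction number would be smaller than \<open>i\<close>.\<close>

section \<open>Chains of submodules\<close>

text \<open>Every length in this development is the length of an interval \<open>[L, N]\<close> in the lattice of submodules
of a fixed module. Working with intervals instead of quotient modules keeps all computations
inside one module; \<open>quot_length_eq\<close> below translates back.\<close>

definition submodule_chain ::
    "('a, 'm) ring_scheme \<Rightarrow> ('a, 'b, 'n) module_scheme \<Rightarrow> 'b set \<Rightarrow> 'b set \<Rightarrow> (nat \<Rightarrow> 'b set) \<Rightarrow> nat \<Rightarrow> bool"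
  where "submodule_chain R M L N C n \<longleftrightarrow>
    (\<forall>i\<le>n. submodule (C i) R M \<and> L \<subseteq> C i \<and> C i \<subseteq> N) \<and> (\<forall>i<n. C i \<subset> C (Suc i))"

definition interval_length ::
    "('a, 'm) ring_scheme \<Rightarrow> ('a, 'b, 'n) module_scheme \<Rightarrow> 'b set \<Rightarrow> 'b set \<Rightarrow> enat"
  where "interval_length R M L N = Sup {enat n | n. \<exists>C. submodule_chain R M L N C n}"

lemma interval_length_ge: "submodule_chain R M L N C n \<Longrightarrow> enat n \<le> interval_length R M L N"
  unfolding interval_length_def by (rule Sup_upper) blast

lemma interval_length_leI:
  "(\<And>C n. submodule_chain R M L N C n \<Longrightarrow> enat n \<le> b) \<Longrightarrow> interval_length R M L N \<le> b"
  unfolding interval_length_def by (rule Sup_least) blast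

lemma submodule_chain_mono:
  "submodule_chain R M L N C n \<Longrightarrow> L' \<subseteq> L \<Longrightarrow> N \<subseteq> N' \<Longrightarrow> submodule_chain R M L' N' C n"
  unfolding submodule_chain_def by blast

lemma interval_length_mono:
  "L' \<subseteq> L \<Longrightarrow> N \<subseteq> N' \<Longrightarrow> interval_length R M L N \<le> interval_length R M L' N'"
  by (rule interval_length_leI) (meson interval_length_ge submodule_chain_mono)

text \<open>How isomorphism theorems are used here: a strictly increasing map between two intervals of
submodules, possibly of different modules, carries chains to chains.\<close>

lemma interval_length_le_map:
  assumes map: "\<And>X. submodule X R M \<Longrightarrow> L \<subseteq> X \<Longrightarrow> X \<subseteq> N \<Longrightarrow>
      submodule (f X) R M' \<and> L' \<subseteq> f X \<and> f X \<subseteq> N'"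
    and strict: "\<And>X Y. submodule X R M \<Longrightarrow> submodule Y R M \<Longrightarrow> L \<subseteq> X \<Longrightarrow> Y \<subseteq> N \<Longrightarrow>
      X \<subset> Y \<Longrightarrow> f X \<subset> f Y"
  shows "interval_length R M L N \<le> interval_length R M' L' N'"
proof (rule interval_length_leI)
  fix C n assume "submodule_chain R M L N C n"
  then have C: "\<And>i. i \<le> n \<Longrightarrow> submodule (C i) R M \<and> L \<subseteq> C i \<and> C i \<subseteq> N"
    and S: "\<And>i. i < n \<Longrightarrow> C i \<subset> C (Suc i)" unfolding submodule_chain_def by blast+
  have "submodule_chain R M' L' N' (\<lambda>i. f (C i)) n"
    unfolding submodule_chain_def
  proof (intro conjI[OF allI allI] impI)
    show "submodule (f (C i)) R M' \<and> L' \<subseteq> f (C i) \<and> f (C i) \<subseteq> N'" if "i \<le> n" for i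
      using map C[OF that] by blast
    show "f (C i) \<subset> f (C (Suc i))" if "i < n" for i
      using strict[of "C i" "C (Suc i)"] C[of i] C[of "Suc i"] S that by simp
  qed
  then show "enat n \<le> interval_length R M' L' N'" by (rule interval_length_ge)
qed

lemma submodule_chain_append:
  assumes "submodule_chain R M L X C n" "X \<subset> Y" "submodule Y R M" "L \<subseteq> Y"
  shows "submodule_chain R M L Y (\<lambda>i. if i \<le> n then C i else Y) (Suc n)"
proof -
  have "C n \<subseteq> X" using assms(1) unfolding submodule_chain_def by blast
  then have "C n \<subset> Y" using assms(2) by blast
  with assms show ?thesis unfolding submodule_chain_def
    by (simp add: less_Suc_eq) blast
qed

lemma interval_length_self: "interval_length R M L L = 0"
proof -
  have "interval_length R M L L \<le> 0"
  proof (rule interval_length_leI)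
    fix C n assume "submodule_chain R M L L C n"
    then have C: "\<And>i. i \<le> n \<Longrightarrow> C i = L" and S: "\<And>i. i < n \<Longrightarrow> C i \<subset> C (Suc i)"
      unfolding submodule_chain_def by blast+
    have "n = 0"
    proof (rule ccontr)
      assume "n \<noteq> 0"
      then show False using C[of 0] C[of 1] S[of 0] by simp
    qed
    then show "enat n \<le> 0" by (simp add: zero_enat_def)
  qed
  then show ?thesis by simp
qed

lemma interval_length_step:
  assumes "X \<subset> Y" "submodule X R M" "submodule Y R M" "L \<subseteq> X"
  shows "interval_length R M L X + 1 \<le> interval_length R M L Y"
proof (cases "interval_length R M L Y")
  case (enat m)
  have *: "Suc n \<le> m" if "submodule_chain R M L X C n" for C n
  proof -
    have "L \<subseteq> Y" using assms(1,4) by blast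
    from interval_length_ge[OF submodule_chain_append[OF that assms(1,3) this]] enat
    show ?thesis by simp
  qed
  have "submodule_chain R M L X (\<lambda>i. X) 0"
    using assms unfolding submodule_chain_def by auto
  then have "m \<noteq> 0" using * by fastforce
  have "interval_length R M L X \<le> enat (m - 1)"
    by (rule interval_length_leI) (use * in fastforce)
  then have "interval_length R M L X + 1 \<le> enat (m - 1) + 1"
    by (rule add_right_mono)
  then show ?thesis using \<open>m \<noteq> 0\<close> enat by (simp add: one_enat_def)
qed simp

context module
begin

lemma submodule_of_closed:
  assumes sub: "X \<subseteq> carrier M" "X \<noteq> {}"
    and add: "\<And>u v. u \<in> X \<Longrightarrow> v \<in> X \<Longrightarrow> u \<oplus>\<^bsub>M\<^esub> v \<in> X"
    and smult: "\<And>a v. a \<in> carrier R \<Longrightarrow> v \<in> X \<Longrightarrow> a \<odot>\<^bsub>M\<^esub> v \<in> X"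
  shows "submodule X R M"
proof (rule submoduleI[OF sub(1)])
  obtain v where v: "v \<in> X" using sub(2) by blast
  then have "v \<in> carrier M" using sub(1) by blast
  then show "\<zero>\<^bsub>M\<^esub> \<in> X" using smult[OF R.zero_closed v] by simp
  show "\<ominus>\<^bsub>M\<^esub> u \<in> X" if "u \<in> X" for u
  proof -
    have "u \<in> carrier M" using that sub(1) by blast
    then show ?thesis using smult[of "\<ominus> \<one>" u] that by (simp add: smult_l_minus)
  qed
qed (rule add smult; assumption)+

lemma submodule_zero: "submodule X R M \<Longrightarrow> \<zero>\<^bsub>M\<^esub> \<in> X"
  using subgroup.one_closed[OF submodule.axioms(1)] by fastforce

lemma submodule_Int:
  assumes "submodule X R M" "submodule Y R M"
  shows "submodule (X \<inter> Y) R M"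
  using submoduleE[OF assms(1)] submoduleE[OF assms(2)]
    submodule_zero[OF assms(1)] submodule_zero[OF assms(2)]
  by (intro submodule_of_closed) auto

lemma mem_set_add: "v \<in> X <+>\<^bsub>M\<^esub> Y \<longleftrightarrow> (\<exists>a\<in>X. \<exists>b\<in>Y. v = a \<oplus>\<^bsub>M\<^esub> b)"
  by (auto simp: set_add_def' )

lemma set_add_mono: "X \<subseteq> X' \<Longrightarrow> X <+>\<^bsub>M\<^esub> Y \<subseteq> X' <+>\<^bsub>M\<^esub> Y"
  unfolding subset_iff mem_set_add by blast

lemma submodule_add:
  assumes X: "submodule X R M" and Y: "submodule Y R M"
  shows "submodule (X <+>\<^bsub>M\<^esub> Y) R M"
proof (rule submodule_of_closed)
  note X' = submoduleE[OF X] and Y' = submoduleE[OF Y]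
  have c: "a \<in> carrier M" if "a \<in> X \<or> a \<in> Y" for a using that X'(1) Y'(1) by blast
  show "X <+>\<^bsub>M\<^esub> Y \<subseteq> carrier M" by (auto simp: mem_set_add c)
  have "\<zero>\<^bsub>M\<^esub> \<in> X <+>\<^bsub>M\<^esub> Y"
    unfolding mem_set_add using submodule_zero[OF X] submodule_zero[OF Y] by force
  then show "X <+>\<^bsub>M\<^esub> Y \<noteq> {}" by blast
  show "u \<oplus>\<^bsub>M\<^esub> v \<in> X <+>\<^bsub>M\<^esub> Y" if u: "u \<in> X <+>\<^bsub>M\<^esub> Y" and v: "v \<in> X <+>\<^bsub>M\<^esub> Y" for u v
  proof -
    obtain a b where ab: "a \<in> X" "b \<in> Y" "u = a \<oplus>\<^bsub>M\<^esub> b" using u unfolding mem_set_add by blast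
    obtain a' b' where ab': "a' \<in> X" "b' \<in> Y" "v = a' \<oplus>\<^bsub>M\<^esub> b'" using v unfolding mem_set_add by blast
    have "u \<oplus>\<^bsub>M\<^esub> v = (a \<oplus>\<^bsub>M\<^esub> a') \<oplus>\<^bsub>M\<^esub> (b \<oplus>\<^bsub>M\<^esub> b')"
      using ab ab' by (simp add: c M.a_ac)
    then show ?thesis unfolding mem_set_add using X'(5)[OF ab(1) ab'(1)] Y'(5)[OF ab(2) ab'(2)] by blast
  qed
  show "r \<odot>\<^bsub>M\<^esub> v \<in> X <+>\<^bsub>M\<^esub> Y" if r: "r \<in> carrier R" and "v \<in> X <+>\<^bsub>M\<^esub> Y" for r v
  proof -
    from that obtain a b where ab: "a \<in> X" "b \<in> Y" "v = a \<oplus>\<^bsub>M\<^esub> b" unfolding mem_set_add by blast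
    then have "r \<odot>\<^bsub>M\<^esub> v = r \<odot>\<^bsub>M\<^esub> a \<oplus>\<^bsub>M\<^esub> r \<odot>\<^bsub>M\<^esub> b" using c r by (simp add: smult_r_distr)
    then show ?thesis unfolding mem_set_add using X'(4)[OF r] Y'(4)[OF r] ab by blast
  qed
qed

lemma set_add_upper1: "submodule X R M \<Longrightarrow> submodule Y R M \<Longrightarrow> X \<subseteq> X <+>\<^bsub>M\<^esub> Y"
proof
  fix a assume "submodule X R M" "submodule Y R M" "a \<in> X"
  then have "a = a \<oplus>\<^bsub>M\<^esub> \<zero>\<^bsub>M\<^esub>" using submoduleE(1) by (metis M.add.r_one subsetD)
  then show "a \<in> X <+>\<^bsub>M\<^esub> Y" unfolding mem_set_add using \<open>a \<in> X\<close> submodule_zero[OF \<open>submodule Y R M\<close>] by blast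
qed

lemma set_add_upper2: "submodule X R M \<Longrightarrow> submodule Y R M \<Longrightarrow> Y \<subseteq> X <+>\<^bsub>M\<^esub> Y"
proof
  fix a assume "submodule X R M" "submodule Y R M" "a \<in> Y"
  then have "a = \<zero>\<^bsub>M\<^esub> \<oplus>\<^bsub>M\<^esub> a" using submoduleE(1) by (metis M.add.l_one subsetD)
  then show "a \<in> X <+>\<^bsub>M\<^esub> Y" unfolding mem_set_add using \<open>a \<in> Y\<close> submodule_zero[OF \<open>submodule X R M\<close>] by blast
qed

lemma set_add_least: "submodule Z R M \<Longrightarrow> X \<subseteq> Z \<Longrightarrow> Y \<subseteq> Z \<Longrightarrow> X <+>\<^bsub>M\<^esub> Y \<subseteq> Z"
  using submoduleE(5) unfolding subset_iff mem_set_add by metis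

text \<open>A consequence of the modular law: whenever a member of a chain of submodules grows, so does its
intersection with \<open>P\<close> or its sum with \<open>P\<close>.\<close>

lemma submodule_modular_eq:
  assumes "submodule X R M" "submodule Y R M" "submodule P R M" "X \<subseteq> Y"
    and "X \<inter> P = Y \<inter> P" "X <+>\<^bsub>M\<^esub> P = Y <+>\<^bsub>M\<^esub> P"
  shows "X = Y"
proof
  show "Y \<subseteq> X"
  proof
    fix y assume y: "y \<in> Y"
    then have "y \<in> X <+>\<^bsub>M\<^esub> P" using set_add_upper1[OF assms(2,3)] assms(6) by blast
    then obtain a p where ap: "a \<in> X" "p \<in> P" "y = a \<oplus>\<^bsub>M\<^esub> p" unfolding mem_set_add by blast
    have c: "a \<in> carrier M" "p \<in> carrier M" "y \<in> carrier M"
      using submoduleE(1)[OF assms(1)] submoduleE(1)[OF assms(2)] submoduleE(1)[OF assms(3)] ap y by blast+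
    have "p = \<ominus>\<^bsub>M\<^esub> a \<oplus>\<^bsub>M\<^esub> y" using c ap(3) by (simp add: M.r_neg1)
    then have "p \<in> Y" using y ap(1) assms(4) submoduleE(3,5)[OF assms(2)] by auto
    then have "p \<in> X" using ap(2) assms(5) by blast
    then show "y \<in> X" using ap submoduleE(5)[OF assms(1)] by blast
  qed
qed (rule assms(4))

text \<open>Additivity of length comes in two halves. Here chains of \<open>[P, N]\<close> are put on top of chains of
\<open>[L, P]\<close>: by induction along a chain of \<open>[P, N]\<close>, its \<open>n\<close>-th member has length at least \<open>n\<close> more than \<open>P\<close>.\<close>

lemma interval_length_add_ge:
  assumes "submodule P R M" "L \<subseteq> P" "P \<subseteq> N"
  shows "interval_length R M L P + interval_length R M P N \<le> interval_length R M L N"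
proof -
  have chain: "interval_length R M L P + enat n \<le> interval_length R M L (C n)"
    if "submodule_chain R M P N C n" for C n
    using that
  proof (induction n)
    case 0
    then show ?case using interval_length_mono[of L L P "C 0"]
      by (simp add: submodule_chain_def zero_enat_def[symmetric])
  next
    case (Suc n)
    then have "submodule_chain R M P N C n" unfolding submodule_chain_def by simp
    from Suc.IH[OF this] have 1: "interval_length R M L P + enat n + 1 \<le> interval_length R M L (C n) + 1"
      by (rule add_right_mono)
    have "C n \<subset> C (Suc n)" "submodule (C n) R M" "submodule (C (Suc n)) R M" "L \<subseteq> C n"
      using Suc.prems assms(2) unfolding submodule_chain_def by (simp_all add: subset_trans[of L P])
    from interval_length_step[OF this] 1 show ?case
      by (simp add: add.assoc one_enat_def)
  qed
  have bound: "interval_length R M L P + enat n \<le> interval_length R M L N"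
    if "submodule_chain R M P N C n" for C n
    using chain[OF that] interval_length_mono[of L L "C n" N] that
    unfolding submodule_chain_def by (meson order.trans order_refl)
  show ?thesis
  proof (cases "interval_length R M L N")
    case (enat m)
    then obtain p where p: "interval_length R M L P = enat p"
      using interval_length_mono[of L L P N R M] assms(3) by (cases "interval_length R M L P") auto
    have "p \<le> m" using interval_length_mono[of L L P N R M] assms(3) p enat by simp
    have "interval_length R M P N \<le> enat (m - p)"
    proof (rule interval_length_leI)
      fix C n assume "submodule_chain R M P N C n"
      from bound[OF this] p enat show "enat n \<le> enat (m - p)" by simp
    qed
    then have "enat p + interval_length R M P N \<le> enat p + enat (m - p)" by (rule add_left_mono)
    then show ?thesis using p enat \<open>p \<le> m\<close> by simp
  qed simp
qed

text \<open>Conversely, a chain \<open>C\<close> of \<open>[L, N]\<close> gives the two chains \<open>C n \<inter> P\<close> and \<open>C n + P\<close>. By the modular law at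
least one of them grows whenever \<open>C\<close> does.\<close>

lemma interval_length_add_le:
  assumes "submodule P R M" "submodule L R M" "submodule N R M" "L \<subseteq> P" "P \<subseteq> N"
  shows "interval_length R M L N \<le> interval_length R M L P + interval_length R M P N"
proof (rule interval_length_leI)
  fix C n assume "submodule_chain R M L N C n"
  then have "enat n \<le> interval_length R M L (C n \<inter> P) + interval_length R M P (C n <+>\<^bsub>M\<^esub> P)
    \<and> C n <+>\<^bsub>M\<^esub> P \<subseteq> N"
  proof (induction n)
    case 0
    then show ?case unfolding submodule_chain_def
      using set_add_least[OF assms(3), of "C 0" P] assms(5) by (simp add: zero_enat_def[symmetric])
  next
    case (Suc n)
    let ?l = "interval_length R M"
    let ?X = "C n" and ?Y = "C (Suc n)"
    have "submodule_chain R M L N C n" using Suc.prems unfolding submodule_chain_def by simp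
    note IH = Suc.IH[OF this, THEN conjunct1]
    have X: "submodule ?X R M" "L \<subseteq> ?X" and Y: "submodule ?Y R M" "?Y \<subseteq> N" "L \<subseteq> ?Y" and XY: "?X \<subset> ?Y"
      using Suc.prems unfolding submodule_chain_def by (auto simp: less_imp_le)
    have sub: "?X \<inter> P \<subseteq> ?Y \<inter> P" "?X <+>\<^bsub>M\<^esub> P \<subseteq> ?Y <+>\<^bsub>M\<^esub> P"
      using XY set_add_mono[of ?X ?Y P] by auto
    have m: "?l L (?X \<inter> P) \<le> ?l L (?Y \<inter> P)" "?l P (?X <+>\<^bsub>M\<^esub> P) \<le> ?l P (?Y <+>\<^bsub>M\<^esub> P)"
      using sub by (auto intro: interval_length_mono)
    have "?X \<inter> P \<subset> ?Y \<inter> P \<or> ?X <+>\<^bsub>M\<^esub> P \<subset> ?Y <+>\<^bsub>M\<^esub> P"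
      using submodule_modular_eq[OF X(1) Y(1) assms(1)] XY sub by blast
    then have "?l L (?X \<inter> P) + ?l P (?X <+>\<^bsub>M\<^esub> P) + 1 \<le> ?l L (?Y \<inter> P) + ?l P (?Y <+>\<^bsub>M\<^esub> P)"
    proof
      assume *: "?X \<inter> P \<subset> ?Y \<inter> P"
      have "?l L (?X \<inter> P) + 1 \<le> ?l L (?Y \<inter> P)"
        using interval_length_step[OF * submodule_Int[OF X(1) assms(1)] submodule_Int[OF Y(1) assms(1)]]
          X(2) assms(4) by blast
      from add_mono[OF this m(2)] show ?thesis by (simp add: ac_simps)
    next
      assume *: "?X <+>\<^bsub>M\<^esub> P \<subset> ?Y <+>\<^bsub>M\<^esub> P"
      have "?l P (?X <+>\<^bsub>M\<^esub> P) + 1 \<le> ?l P (?Y <+>\<^bsub>M\<^esub> P)"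
        using interval_length_step[OF * submodule_add[OF X(1) assms(1)] submodule_add[OF Y(1) assms(1)]]
          set_add_upper2[OF X(1) assms(1)] by blast
      from add_mono[OF m(1) this] show ?thesis by (simp add: ac_simps)
    qed
    moreover have "enat n + 1 \<le> ?l L (?X \<inter> P) + ?l P (?X <+>\<^bsub>M\<^esub> P) + 1"
      using IH by (rule add_right_mono)
    ultimately have "enat n + 1 \<le> ?l L (?Y \<inter> P) + ?l P (?Y <+>\<^bsub>M\<^esub> P)" by (rule order.trans[rotated])
    then show ?case using set_add_least[OF assms(3) Y(2) assms(5)] by (simp add: one_enat_def)
  qed
  then have 1: "enat n \<le> interval_length R M L (C n \<inter> P) + interval_length R M P (C n <+>\<^bsub>M\<^esub> P)"
    and 2: "C n <+>\<^bsub>M\<^esub> P \<subseteq> N" by auto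
  show "enat n \<le> interval_length R M L P + interval_length R M P N"
    by (rule order.trans[OF 1 add_mono]) (use 2 in \<open>auto intro: interval_length_mono\<close>)
qed

lemma interval_length_add:
  assumes "submodule L R M" "submodule P R M" "submodule N R M" "L \<subseteq> P" "P \<subseteq> N"
  shows "interval_length R M L N = interval_length R M L P + interval_length R M P N"
  using interval_length_add_le[OF assms(2,1,3,4,5)] interval_length_add_ge[OF assms(2,4,5)]
  by (rule order.antisym)

lemma interval_length_eq_0:
  assumes "submodule L R M" "submodule N R M" "L \<subseteq> N" "interval_length R M L N = 0"
  shows "L = N"
proof (rule ccontr)
  assume "L \<noteq> N"
  then have "interval_length R M L L + 1 \<le> interval_length R M L N"
    using assms by (intro interval_length_step) auto
  then show False using assms(4) by simp
qed

text \<open>The second isomorphism theorem, as an isomorphism of the two intervals of submodules.\<close>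

lemma interval_length_diamond:
  assumes X: "submodule X R M" and Y: "submodule Y R M"
  shows "interval_length R M (X \<inter> Y) X = interval_length R M Y (X <+>\<^bsub>M\<^esub> Y)"
proof (rule order.antisym)
  show "interval_length R M (X \<inter> Y) X \<le> interval_length R M Y (X <+>\<^bsub>M\<^esub> Y)"
  proof (rule interval_length_le_map[where f = "\<lambda>Z. Z <+>\<^bsub>M\<^esub> Y"])
    show "submodule (Z <+>\<^bsub>M\<^esub> Y) R M \<and> Y \<subseteq> Z <+>\<^bsub>M\<^esub> Y \<and> Z <+>\<^bsub>M\<^esub> Y \<subseteq> X <+>\<^bsub>M\<^esub> Y"
      if "submodule Z R M" "Z \<subseteq> X" for Z
      using submodule_add[OF that(1) Y] set_add_upper2[OF that(1) Y] set_add_mono[OF that(2)] by blast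
    fix Z W assume ZW: "submodule Z R M" "submodule W R M" "X \<inter> Y \<subseteq> Z" "W \<subseteq> X" "Z \<subset> W"
    then have "Z <+>\<^bsub>M\<^esub> Y \<noteq> W <+>\<^bsub>M\<^esub> Y" using submodule_modular_eq[OF ZW(1,2) Y] by blast
    then show "Z <+>\<^bsub>M\<^esub> Y \<subset> W <+>\<^bsub>M\<^esub> Y" using set_add_mono[of Z W Y] ZW(5) by blast
  qed
  show "interval_length R M Y (X <+>\<^bsub>M\<^esub> Y) \<le> interval_length R M (X \<inter> Y) X"
  proof (rule interval_length_le_map[where f = "\<lambda>Z. Z \<inter> X"])
    show "submodule (Z \<inter> X) R M \<and> X \<inter> Y \<subseteq> Z \<inter> X \<and> Z \<inter> X \<subseteq> X" if "submodule Z R M" "Y \<subseteq> Z" for Z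
      using submodule_Int[OF that(1) X] that(2) by blast
    have full: "Z <+>\<^bsub>M\<^esub> X = X <+>\<^bsub>M\<^esub> Y" if Z: "submodule Z R M" "Y \<subseteq> Z" "Z \<subseteq> X <+>\<^bsub>M\<^esub> Y" for Z
    proof
      show "Z <+>\<^bsub>M\<^esub> X \<subseteq> X <+>\<^bsub>M\<^esub> Y"
        using set_add_least[OF submodule_add[OF X Y] Z(3) set_add_upper1[OF X Y]] .
      show "X <+>\<^bsub>M\<^esub> Y \<subseteq> Z <+>\<^bsub>M\<^esub> X"
        by (rule set_add_least[OF submodule_add[OF Z(1) X] set_add_upper2[OF Z(1) X]])
          (use set_add_upper1[OF Z(1) X] Z(2) in blast)
    qed
    fix Z W assume ZW: "submodule Z R M" "submodule W R M" "Y \<subseteq> Z" "W \<subseteq> X <+>\<^bsub>M\<^esub> Y" "Z \<subset> W"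
    have "Z <+>\<^bsub>M\<^esub> X = W <+>\<^bsub>M\<^esub> X" using full[OF ZW(1)] full[OF ZW(2)] ZW(3-5) by blast
    then have "Z \<inter> X \<noteq> W \<inter> X" using submodule_modular_eq[OF ZW(1,2) X] ZW(5) by blast
    then show "Z \<inter> X \<subset> W \<inter> X" using ZW(5) by blast
  qed
qed

end

section \<open>Linear maps and quotient modules\<close>

lemma submodule_image:
  assumes M: "module R M" and M': "module R M'"
    and f: "f ` carrier M \<subseteq> carrier M'"
    and add: "\<And>u v. u \<in> carrier M \<Longrightarrow> v \<in> carrier M \<Longrightarrow> f (u \<oplus>\<^bsub>M\<^esub> v) = f u \<oplus>\<^bsub>M'\<^esub> f v"
    and smult: "\<And>a v. a \<in> carrier R \<Longrightarrow> v \<in> carrier M \<Longrightarrow> f (a \<odot>\<^bsub>M\<^esub> v) = a \<odot>\<^bsub>M'\<^esub> f v"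
    and X: "submodule X R M"
  shows "submodule (f ` X) R M'"
proof -
  interpret M: module R M by (rule M)
  interpret M': module R M' by (rule M')
  note X' = M.submoduleE[OF X]
  have sub: "u \<in> carrier M" if "u \<in> X" for u using X'(1) that by blast
  have fc: "f u \<in> carrier M'" if "u \<in> X" for u using sub[OF that] f by blast
  have sm: "a \<odot>\<^bsub>M'\<^esub> f u \<in> f ` X" if "a \<in> carrier R" "u \<in> X" for a u
    using smult[OF that(1) sub[OF that(2)]] X'(4)[OF that] by (metis imageI)
  show ?thesis
  proof (rule M'.submodule_of_closed)
    show "f ` X \<subseteq> carrier M'" using fc by blast
    show "f ` X \<noteq> {}" using X'(2) by blast
    show "v \<oplus>\<^bsub>M'\<^esub> w \<in> f ` X" if v: "v \<in> f ` X" and w: "w \<in> f ` X" for v w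
    proof -
      obtain u where u: "u \<in> X" "v = f u" using v by blast
      obtain u' where u': "u' \<in> X" "w = f u'" using w by blast
      show ?thesis using add[OF sub[OF u(1)] sub[OF u'(1)]] X'(5)[OF u(1) u'(1)] u(2) u'(2) by (metis imageI)
    qed
    show "a \<odot>\<^bsub>M'\<^esub> v \<in> f ` X" if "a \<in> carrier R" "v \<in> f ` X" for a v
      using that sm by blast
  qed
qed

lemma submodule_preimage:
  assumes M: "module R M" and M': "module R M'"
    and f: "f ` carrier M \<subseteq> carrier M'"
    and add: "\<And>u v. u \<in> carrier M \<Longrightarrow> v \<in> carrier M \<Longrightarrow> f (u \<oplus>\<^bsub>M\<^esub> v) = f u \<oplus>\<^bsub>M'\<^esub> f v"
    and smult: "\<And>a v. a \<in> carrier R \<Longrightarrow> v \<in> carrier M \<Longrightarrow> f (a \<odot>\<^bsub>M\<^esub> v) = a \<odot>\<^bsub>M'\<^esub> f v"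
    and Y: "submodule Y R M'" and N: "submodule N R M"
  shows "submodule {v \<in> N. f v \<in> Y} R M"
proof -
  interpret M: module R M by (rule M)
  interpret M': module R M' by (rule M')
  note Y' = M'.submoduleE[OF Y] and N' = M.submoduleE[OF N]
  have sub: "u \<in> carrier M" if "u \<in> N" for u using N'(1) that by blast
  have fc: "f u \<in> carrier M'" if "u \<in> N" for u using sub[OF that] f by blast
  show ?thesis
  proof (rule M.submodule_of_closed)
    show "{v \<in> N. f v \<in> Y} \<subseteq> carrier M" using sub by blast
    have "f \<zero>\<^bsub>M\<^esub> = \<zero>\<^bsub>R\<^esub> \<odot>\<^bsub>M'\<^esub> f \<zero>\<^bsub>M\<^esub>"
      using smult[of "\<zero>\<^bsub>R\<^esub>" "\<zero>\<^bsub>M\<^esub>"] by simp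
    also have "\<dots> = \<zero>\<^bsub>M'\<^esub>" using f by (intro M'.smult_l_null) auto
    finally show "{v \<in> N. f v \<in> Y} \<noteq> {}"
      using M.submodule_zero[OF N] M'.submodule_zero[OF Y] by force
    show "u \<oplus>\<^bsub>M\<^esub> v \<in> {v \<in> N. f v \<in> Y}" if "u \<in> {v \<in> N. f v \<in> Y}" "v \<in> {v \<in> N. f v \<in> Y}" for u v
      using that add[of u v] sub N'(5) Y'(5) by simp
    show "a \<odot>\<^bsub>M\<^esub> v \<in> {v \<in> N. f v \<in> Y}" if "a \<in> carrier R" "v \<in> {v \<in> N. f v \<in> Y}" for a v
      using that smult[of a v] sub N'(4) Y'(4) by simp
  qed
qed

text \<open>The last hypothesis asks that the submodules of the interval be unions of fibres of the map. In this
form the lemma covers injective maps as well as the projection onto the quotient by \<open>L\<close>.\<close>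

lemma interval_length_linear_image:
  assumes M: "module R M" and M': "module R M'"
    and f: "f ` carrier M \<subseteq> carrier M'"
    and add: "\<And>u v. u \<in> carrier M \<Longrightarrow> v \<in> carrier M \<Longrightarrow> f (u \<oplus>\<^bsub>M\<^esub> v) = f u \<oplus>\<^bsub>M'\<^esub> f v"
    and smult: "\<And>a v. a \<in> carrier R \<Longrightarrow> v \<in> carrier M \<Longrightarrow> f (a \<odot>\<^bsub>M\<^esub> v) = a \<odot>\<^bsub>M'\<^esub> f v"
    and N: "submodule N R M" and LN: "L \<subseteq> N"
    and fibre: "\<And>X u v. submodule X R M \<Longrightarrow> L \<subseteq> X \<Longrightarrow> X \<subseteq> N \<Longrightarrow>
      u \<in> X \<Longrightarrow> v \<in> N \<Longrightarrow> f u = f v \<Longrightarrow> v \<in> X"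
  shows "interval_length R M' (f ` L) (f ` N) = interval_length R M L N"
proof (rule order.antisym)
  show "interval_length R M L N \<le> interval_length R M' (f ` L) (f ` N)"
  proof (rule interval_length_le_map[where f = "(`) f"])
    show "submodule (f ` X) R M' \<and> f ` L \<subseteq> f ` X \<and> f ` X \<subseteq> f ` N"
      if "submodule X R M" "L \<subseteq> X" "X \<subseteq> N" for X
      using submodule_image[OF M M' f add smult that(1)] that(2,3) by blast
    fix X Y assume X: "submodule X R M" "L \<subseteq> X" "Y \<subseteq> N" "X \<subset> Y"
    then obtain w where w: "w \<in> Y" "w \<notin> X" by blast
    have "f w \<notin> f ` X"
    proof
      assume "f w \<in> f ` X"
      then obtain u where "u \<in> X" "f u = f w" by (metis imageE)
      with fibre[OF X(1,2), of u w] w X(3,4) show False by blast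
    qed
    then show "f ` X \<subset> f ` Y" using w(1) X(4) by blast
  qed
  show "interval_length R M' (f ` L) (f ` N) \<le> interval_length R M L N"
  proof (rule interval_length_le_map[where f = "\<lambda>Y. {v \<in> N. f v \<in> Y}"])
    show "submodule {v \<in> N. f v \<in> Y} R M \<and> L \<subseteq> {v \<in> N. f v \<in> Y} \<and> {v \<in> N. f v \<in> Y} \<subseteq> N"
      if "submodule Y R M'" "f ` L \<subseteq> Y" for Y
      using submodule_preimage[OF M M' f add smult that(1) N] that(2) LN by blast
    show "{v \<in> N. f v \<in> X} \<subset> {v \<in> N. f v \<in> Y}" if "Y \<subseteq> f ` N" "X \<subset> Y" for X Y
      using that by blast
  qed
qed

context module
begin

lemma submodule_carrier_update_iff:
  assumes N: "submodule N R M"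
  shows "submodule X R (M\<lparr>carrier := N\<rparr>) \<longleftrightarrow> submodule X R M \<and> X \<subseteq> N"
proof -
  interpret MN: module R "M\<lparr>carrier := N\<rparr>"
    by (rule submodule.submodule_is_module[OF N]) (rule module_axioms)
  note N' = submoduleE[OF N]
  show ?thesis
  proof (intro iffI conjI)
    assume X: "submodule X R (M\<lparr>carrier := N\<rparr>)"
    note X' = MN.submoduleE[OF X]
    show XN: "X \<subseteq> N" using X'(1) by simp
    show "submodule X R M"
      by (rule submodule_of_closed) (use X'(2,4,5) XN N'(1) in auto)
  next
    assume "submodule X R M \<and> X \<subseteq> N"
    then have X: "submodule X R M" and XN: "X \<subseteq> N" by auto
    show "submodule X R (M\<lparr>carrier := N\<rparr>)"
      by (rule MN.submodule_of_closed) (use submoduleE[OF X] XN in auto)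
  qed
qed

lemma abelian_subgroup_submodule:
  assumes "submodule L R M" shows "abelian_subgroup L M"
proof (rule abelian_subgroupI3)
  show "additive_subgroup L M" using submodule.axioms(1)[OF assms] by (rule additive_subgroup.intro)
qed (rule M.abelian_group_axioms)

lemma quot_module_smult:
  assumes L: "submodule L R M" and a: "a \<in> carrier R" and v: "v \<in> carrier M"
  shows "a \<odot>\<^bsub>quot_module M L\<^esub> (L +>\<^bsub>M\<^esub> v) = L +>\<^bsub>M\<^esub> (a \<odot>\<^bsub>M\<^esub> v)"
proof -
  interpret L: abelian_subgroup L M by (rule abelian_subgroup_submodule[OF L])
  have "L +>\<^bsub>M\<^esub> (a \<odot>\<^bsub>M\<^esub> w) = L +>\<^bsub>M\<^esub> (a \<odot>\<^bsub>M\<^esub> v)" if w: "w \<in> L +>\<^bsub>M\<^esub> v" for w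
  proof -
    obtain l where l: "l \<in> L" "w = l \<oplus>\<^bsub>M\<^esub> v" using w unfolding a_r_coset_def' by blast
    have "l \<in> carrier M" using l(1) by simp
    then have "a \<odot>\<^bsub>M\<^esub> w = a \<odot>\<^bsub>M\<^esub> l \<oplus>\<^bsub>M\<^esub> a \<odot>\<^bsub>M\<^esub> v" using a v l(2) by (simp add: smult_r_distr)
    moreover have "a \<odot>\<^bsub>M\<^esub> l \<in> L" using submoduleE(4)[OF L a l(1)] .
    ultimately have "a \<odot>\<^bsub>M\<^esub> w \<in> L +>\<^bsub>M\<^esub> (a \<odot>\<^bsub>M\<^esub> v)" unfolding a_r_coset_def' by blast
    then show ?thesis using a v by (intro L.a_repr_independence'[symmetric]) auto
  qed
  moreover have "v \<in> L +>\<^bsub>M\<^esub> v" using v by (rule L.a_rcos_self)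
  ultimately have "(\<Union>w\<in>L +>\<^bsub>M\<^esub> v. L +>\<^bsub>M\<^esub> (a \<odot>\<^bsub>M\<^esub> w)) = L +>\<^bsub>M\<^esub> (a \<odot>\<^bsub>M\<^esub> v)" by blast
  then show ?thesis by (simp add: quot_module_def)
qed

lemma quot_module_add:
  assumes L: "submodule L R M" and u: "u \<in> carrier M" and v: "v \<in> carrier M"
  shows "(L +>\<^bsub>M\<^esub> u) \<oplus>\<^bsub>quot_module M L\<^esub> (L +>\<^bsub>M\<^esub> v) = L +>\<^bsub>M\<^esub> (u \<oplus>\<^bsub>M\<^esub> v)"
proof -
  interpret L: abelian_subgroup L M by (rule abelian_subgroup_submodule[OF L])
  show ?thesis using L.a_rcos_sum[OF u v] by (simp add: quot_module_def)
qed

lemma quot_module_carrier: "carrier (quot_module M L) = (\<lambda>v. L +>\<^bsub>M\<^esub> v) ` carrier M"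
  unfolding quot_module_def by (auto simp: A_RCOSETS_def' a_r_coset_def')

lemma quot_module_is_module:
  assumes L: "submodule L R M"
  shows "module R (quot_module M L)"
proof (rule moduleI)
  interpret L: abelian_subgroup L M by (rule abelian_subgroup_submodule[OF L])
  let ?Q = "quot_module M L"
  have Q: "(\<And>v. v \<in> carrier M \<Longrightarrow> P (L +>\<^bsub>M\<^esub> v)) \<Longrightarrow> C \<in> carrier ?Q \<Longrightarrow> P C" for P C
    unfolding quot_module_carrier by blast
  have c: "L +>\<^bsub>M\<^esub> v \<in> carrier ?Q" if "v \<in> carrier M" for v
    unfolding quot_module_carrier using that by blast
  note simps = quot_module_smult[OF L] quot_module_add[OF L]
  show "cring R" by (rule is_cring)
  have zero: "\<zero>\<^bsub>?Q\<^esub> = L +>\<^bsub>M\<^esub> \<zero>\<^bsub>M\<^esub>"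
    using L.a_subset by (simp add: quot_module_def)
  show "abelian_group ?Q"
  proof (rule abelian_groupI)
    show "\<zero>\<^bsub>?Q\<^esub> \<in> carrier ?Q" unfolding zero by (rule c) simp
    show "\<zero>\<^bsub>?Q\<^esub> \<oplus>\<^bsub>?Q\<^esub> C = C" if "C \<in> carrier ?Q" for C
      using that by (rule Q[rotated]) (simp add: zero simps)
    show "\<exists>D\<in>carrier ?Q. D \<oplus>\<^bsub>?Q\<^esub> C = \<zero>\<^bsub>?Q\<^esub>" if "C \<in> carrier ?Q" for C
      using that
    proof (rule Q[rotated])
      fix v assume v: "v \<in> carrier M"
      show "\<exists>D\<in>carrier ?Q. D \<oplus>\<^bsub>?Q\<^esub> (L +>\<^bsub>M\<^esub> v) = \<zero>\<^bsub>?Q\<^esub>"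
        by (rule bexI[OF _ c[of "\<ominus>\<^bsub>M\<^esub> v"]]) (use v in \<open>simp_all add: zero simps M.l_neg\<close>)
    qed
  next
    fix C D assume C: "C \<in> carrier ?Q" and D: "D \<in> carrier ?Q"
    obtain u v where uv: "u \<in> carrier M" "v \<in> carrier M" "C = L +>\<^bsub>M\<^esub> u" "D = L +>\<^bsub>M\<^esub> v"
      using C D unfolding quot_module_carrier by blast
    show "C \<oplus>\<^bsub>?Q\<^esub> D \<in> carrier ?Q" using uv c by (simp add: simps)
    show "C \<oplus>\<^bsub>?Q\<^esub> D = D \<oplus>\<^bsub>?Q\<^esub> C" using uv by (simp add: simps M.a_comm)
    fix E assume E: "E \<in> carrier ?Q"
    then obtain w where "w \<in> carrier M" "E = L +>\<^bsub>M\<^esub> w"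
      unfolding quot_module_carrier by blast
    then show "C \<oplus>\<^bsub>?Q\<^esub> D \<oplus>\<^bsub>?Q\<^esub> E = C \<oplus>\<^bsub>?Q\<^esub> (D \<oplus>\<^bsub>?Q\<^esub> E)" using uv by (simp add: simps M.a_assoc)
  qed
  show "a \<odot>\<^bsub>?Q\<^esub> C \<in> carrier ?Q" if "a \<in> carrier R" "C \<in> carrier ?Q" for a C
    using that(2) by (rule Q[rotated]) (use that(1) c in \<open>simp add: simps\<close>)
  show "(a \<oplus> b) \<odot>\<^bsub>?Q\<^esub> C = a \<odot>\<^bsub>?Q\<^esub> C \<oplus>\<^bsub>?Q\<^esub> b \<odot>\<^bsub>?Q\<^esub> C"
    if "a \<in> carrier R" "b \<in> carrier R" "C \<in> carrier ?Q" for a b C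
    using that(3) by (rule Q[rotated]) (use that(1,2) in \<open>simp add: simps smult_l_distr\<close>)
  show "(a \<otimes> b) \<odot>\<^bsub>?Q\<^esub> C = a \<odot>\<^bsub>?Q\<^esub> (b \<odot>\<^bsub>?Q\<^esub> C)"
    if "a \<in> carrier R" "b \<in> carrier R" "C \<in> carrier ?Q" for a b C
    using that(3) by (rule Q[rotated]) (use that(1,2) in \<open>simp add: simps smult_assoc1\<close>)
  show "\<one> \<odot>\<^bsub>?Q\<^esub> C = C" if "C \<in> carrier ?Q" for C
    using that by (rule Q[rotated]) (simp add: simps)
  show "a \<odot>\<^bsub>?Q\<^esub> (C \<oplus>\<^bsub>?Q\<^esub> D) = a \<odot>\<^bsub>?Q\<^esub> C \<oplus>\<^bsub>?Q\<^esub> a \<odot>\<^bsub>?Q\<^esub> D"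
    if a: "a \<in> carrier R" and C: "C \<in> carrier ?Q" and D: "D \<in> carrier ?Q" for a C D
  proof -
    obtain u v where "u \<in> carrier M" "v \<in> carrier M" "C = L +>\<^bsub>M\<^esub> u" "D = L +>\<^bsub>M\<^esub> v"
      using C D unfolding quot_module_carrier by blast
    then show ?thesis using a by (simp add: simps smult_r_distr)
  qed
qed

end

lemma module_length_eq:
  assumes "module R M"
  shows "module_length R M = interval_length R M {\<zero>\<^bsub>M\<^esub>} (carrier M)"
proof -
  have "submodule X R M \<longleftrightarrow> submodule X R M \<and> {\<zero>\<^bsub>M\<^esub>} \<subseteq> X \<and> X \<subseteq> carrier M" for X
    using module.submodule_zero[OF assms, of X] module.submoduleE(1)[OF assms, of X] by blast
  then show ?thesis
    unfolding module_length_def interval_length_def submodule_chain_def by simp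
qed

lemma (in module) module_length_quot_module:
  assumes L: "submodule L R M"
  shows "module_length R (quot_module M L) = interval_length R M L (carrier M)"
proof -
  let ?Q = "quot_module M L" let ?f = "\<lambda>v. L +>\<^bsub>M\<^esub> v"
  interpret L: abelian_subgroup L M by (rule abelian_subgroup_submodule[OF L])
  note Q = quot_module_is_module[OF L]
  have "interval_length R M L (carrier M) = interval_length R ?Q (?f ` L) (?f ` carrier M)"
  proof (rule interval_length_linear_image[symmetric, OF module_axioms Q])
    fix X u v assume X: "submodule X R M" "L \<subseteq> X" and u: "u \<in> X" and v: "v \<in> carrier M"
      and eq: "?f u = ?f v"
    have "v \<in> ?f u" using L.a_rcos_self[OF v] eq by simp
    then obtain l where "l \<in> L" "v = l \<oplus>\<^bsub>M\<^esub> u" unfolding a_r_coset_def' by blast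
    then show "v \<in> X" using X u submoduleE(5)[OF X(1)] by blast
  qed (simp_all add: L.a_subset quot_module_carrier quot_module_add[OF L] quot_module_smult[OF L] carrier_is_submodule)
  also have "?f ` L = {\<zero>\<^bsub>?Q\<^esub>}"
  proof -
    have "?f v = L" if "v \<in> L" for v using that by (rule L.a_rcos_const)
    moreover have "L \<noteq> {}" using submoduleE(2)[OF L] .
    ultimately show ?thesis by (auto simp: quot_module_def image_def)
  qed
  also have "?f ` carrier M = carrier ?Q" by (simp add: quot_module_carrier)
  finally show ?thesis by (simp add: module_length_eq[OF Q])
qed

lemma quot_length_eq:
  assumes M: "module R M" and L: "submodule L R M" and N: "submodule N R M" and "L \<subseteq> N"
  shows "quot_length R M N L = interval_length R M L N"
proof -
  interpret M: module R M by (rule M)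
  interpret MN: module R "M\<lparr>carrier := N\<rparr>"
    by (rule submodule.submodule_is_module[OF N M])
  note iff = M.submodule_carrier_update_iff[OF N]
  have "quot_length R M N L = interval_length R (M\<lparr>carrier := N\<rparr>) L N"
    unfolding quot_length_def using L \<open>L \<subseteq> N\<close>
    by (subst MN.module_length_quot_module) (simp_all add: iff)
  also have "\<dots> = interval_length R M L N"
  proof -
    have "submodule_chain R (M\<lparr>carrier := N\<rparr>) L N C n \<longleftrightarrow> submodule_chain R M L N C n" for C n
      unfolding submodule_chain_def iff by blast
    then show ?thesis unfolding interval_length_def by simp
  qed
  finally show ?thesis .
qed

section \<open>Ideals of a local ring\<close>

definition ideal_length :: "('a, 'm) ring_scheme \<Rightarrow> 'a set \<Rightarrow> 'a set \<Rightarrow> enat"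
  where "ideal_length R = interval_length R (module_via id R)"

lemma ideal_length_self: "ideal_length R L L = 0"
  by (simp only: ideal_length_def interval_length_self)

lemma module_via_simps:
  "carrier (module_via h S) = carrier S" "u \<oplus>\<^bsub>module_via h S\<^esub> v = u \<oplus>\<^bsub>S\<^esub> v"
  "\<zero>\<^bsub>module_via h S\<^esub> = \<zero>\<^bsub>S\<^esub>" "a \<odot>\<^bsub>module_via h S\<^esub> v = h a \<otimes>\<^bsub>S\<^esub> v"
  by (simp_all add: module_via_def)

text \<open>This covers both modules of interest: the ring itself, along the identity, and its total ring of
fractions, along the canonical map.\<close>

lemma module_via_hom:
  assumes "cring R" "cring S" and h: "h \<in> ring_hom R S"
  shows "module R (module_via h S)"
proof -
  interpret R: cring R by fact
  interpret S: cring S by fact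
  interpret h: ring_hom_cring R S h by unfold_locales (rule h)
  show ?thesis
  proof (rule moduleI)
    show "abelian_group (module_via h S)"
    proof (rule abelian_groupI)
      fix v assume "v \<in> carrier (module_via h S)"
      then show "\<exists>w\<in>carrier (module_via h S). w \<oplus>\<^bsub>module_via h S\<^esub> v = \<zero>\<^bsub>module_via h S\<^esub>"
        by (intro bexI[of _ "\<ominus>\<^bsub>S\<^esub> v"]) (simp_all add: module_via_simps S.l_neg)
    qed (simp_all add: module_via_simps S.a_ac)
  qed (simp_all add: module_via_simps R.is_cring S.l_distr S.r_distr S.m_assoc)
qed

context cring
begin

lemma module_via_id: "module R (module_via id R)"
  by (rule module_via_hom[OF is_cring is_cring]) (rule id_ring_hom)

lemma ideal_of_closed:
  assumes "S \<subseteq> carrier R" "S \<noteq> {}" "\<And>a b. a \<in> S \<Longrightarrow> b \<in> S \<Longrightarrow> a \<oplus> b \<in> S"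
    "\<And>c a. c \<in> carrier R \<Longrightarrow> a \<in> S \<Longrightarrow> c \<otimes> a \<in> S"
  shows "ideal S R"
proof (rule idealI)
  show "ring R" by (rule ring_axioms)
  show "subgroup S (add_monoid R)"
  proof (rule add.subgroupI, goal_cases)
    case (3 a)
    then have "(\<ominus> \<one>) \<otimes> a \<in> S" "a \<in> carrier R" using assms(1,4) by auto
    then have "\<ominus> a \<in> S" by (simp add: l_minus)
    then show ?case by (simp add: a_inv_def)
  qed (use assms in auto)
  show "c \<otimes> a \<in> S" if "a \<in> S" "c \<in> carrier R" for a c using assms(4) that by blast
  show "a \<otimes> c \<in> S" if "a \<in> S" "c \<in> carrier R" for a c
    using assms(4)[OF that(2,1)] m_comm[OF that(2), of a] that(1) assms(1) by auto
qed

lemma submodule_via_id_iff: "submodule X R (module_via id R) \<longleftrightarrow> ideal X R"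
proof
  interpret M: module R "module_via id R" by (rule module_via_id)
  assume X: "submodule X R (module_via id R)"
  note X' = M.submoduleE[OF X]
  have sub: "X \<subseteq> carrier R" using X'(1) by (simp add: module_via_def)
  have sm: "a \<otimes> b \<in> X" if "a \<in> carrier R" "b \<in> X" for a b
    using X'(4)[OF that] by (simp add: module_via_def)
  show "ideal X R"
    by (rule ideal_of_closed[OF sub X'(2)]) (use X'(5) sm in \<open>simp_all add: module_via_def\<close>)
next
  interpret M: module R "module_via id R" by (rule module_via_id)
  assume "ideal X R"
  then interpret X: ideal X R .
  show "submodule X R (module_via id R)"
  proof (rule M.submodule_of_closed)
    show "X \<noteq> {}" using X.zero_closed by blast
  qed (auto simp: module_via_def X.I_l_closed X.Icarr)
qed

lemma set_add_module_via_id: "X <+>\<^bsub>module_via id R\<^esub> Y = X <+> Y"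
  by (simp add: set_add_def' module_via_def)

lemma mem_set_add_iff: "v \<in> X <+> Y \<longleftrightarrow> (\<exists>a\<in>X. \<exists>b\<in>Y. v = a \<oplus> b)"
  by (auto simp: set_add_def')

lemma ideal_add_upper1: "ideal X R \<Longrightarrow> ideal Y R \<Longrightarrow> X \<subseteq> X <+> Y"
  using module.set_add_upper1[OF module_via_id] by (simp add: submodule_via_id_iff set_add_module_via_id)

lemma ideal_add_upper2: "ideal X R \<Longrightarrow> ideal Y R \<Longrightarrow> Y \<subseteq> X <+> Y"
  using module.set_add_upper2[OF module_via_id] by (simp add: submodule_via_id_iff set_add_module_via_id)

lemma ideal_add_least: "ideal Z R \<Longrightarrow> X \<subseteq> Z \<Longrightarrow> Y \<subseteq> Z \<Longrightarrow> X <+> Y \<subseteq> Z"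
  using module.set_add_least[OF module_via_id] by (simp add: submodule_via_id_iff set_add_module_via_id)

lemma ideal_length_add:
  assumes "ideal L R" "ideal P R" "ideal N R" "L \<subseteq> P" "P \<subseteq> N"
  shows "ideal_length R L N = ideal_length R L P + ideal_length R P N"
  unfolding ideal_length_def using assms by (intro module.interval_length_add[OF module_via_id]) (simp_all add: submodule_via_id_iff)

lemma ideal_length_diamond:
  assumes "ideal X R" "ideal Y R"
  shows "ideal_length R (X \<inter> Y) X = ideal_length R Y (X <+> Y)"
  unfolding ideal_length_def using module.interval_length_diamond[OF module_via_id] assms
  by (simp add: submodule_via_id_iff set_add_module_via_id)

lemma ideal_length_eq_0:
  assumes "ideal L R" "ideal N R" "L \<subseteq> N" "ideal_length R L N = 0"
  shows "L = N"
  using assms unfolding ideal_length_def submodule_via_id_iff[symmetric]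
  by (rule module.interval_length_eq_0[OF module_via_id])

lemma quot_length_ideals:
  assumes "ideal L R" "ideal N R" "L \<subseteq> N"
  shows "quot_length R (module_via id R) N L = ideal_length R L N"
  using assms unfolding ideal_length_def submodule_via_id_iff[symmetric]
  by (rule quot_length_eq[OF module_via_id])

lemma l_coset_eq_image: "c <# X = (\<lambda>a. c \<otimes> a) ` X"
  by (auto simp: l_coset_def)

lemma ideal_l_coset:
  assumes "c \<in> carrier R" "ideal X R"
  shows "ideal (c <# X) R"
proof -
  have "submodule X R (module_via id R)" using assms(2) by (simp add: submodule_via_id_iff)
  then have "submodule ((\<lambda>a. c \<otimes> a) ` X) R (module_via id R)"
    by (rule submodule_image[OF module_via_id module_via_id, rotated -1])
      (use assms in \<open>auto simp: module_via_def r_distr m_lcomm\<close>)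
  then show ?thesis by (simp add: submodule_via_id_iff l_coset_eq_image)
qed

text \<open>Multiplication by a non-zero-divisor is an injective linear map.\<close>

lemma ideal_length_l_coset:
  assumes c: "c \<in> regular_elements R" and N: "ideal N R" and LN: "L \<subseteq> N"
  shows "ideal_length R (c <# L) (c <# N) = ideal_length R L N"
  unfolding l_coset_eq_image ideal_length_def
proof (rule interval_length_linear_image[OF module_via_id module_via_id])
  have cc: "c \<in> carrier R" using c by (simp add: regular_elements_def)
  have Nc: "N \<subseteq> carrier R" using ideal.Icarr[OF N] by blast
  show "v \<in> X" if X: "X \<subseteq> N" "u \<in> X" and v: "v \<in> N" and eq: "c \<otimes> u = c \<otimes> v" for X u v
  proof -
    have uv: "u \<in> carrier R" "v \<in> carrier R" using X v Nc by auto
    have "c \<otimes> (u \<ominus> v) = \<zero>" using uv cc eq by (simp add: r_distr r_minus a_minus_def r_neg)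
    then have "u \<ominus> v = \<zero>" using c uv by (auto simp: regular_elements_def)
    then have "u = v" using uv by (simp add: r_right_minus_eq)
    then show ?thesis using X by simp
  qed
  show "submodule N R (module_via id R)" using N by (simp add: submodule_via_id_iff)
qed (use c LN in \<open>auto simp: regular_elements_def module_via_def r_distr m_lcomm\<close>)

lemma ideals_set_one: "\<one>\<^bsub>ideals_set R\<^esub> = carrier R"
  by (simp add: ideals_set_def)

lemma ideals_set_mult: "I \<otimes>\<^bsub>ideals_set R\<^esub> J = I \<cdot> J"
  by (simp add: ideals_set_def)

lemma ideal_pow_0: "ideal_pow R I 0 = carrier R"
  by (simp add: nat_pow_def ideals_set_one)

lemma ideal_pow_Suc: "ideal_pow R I (Suc n) = ideal_pow R I n \<cdot> I"
  by (simp add: nat_pow_def ideals_set_mult)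

lemma ideal_pow_ideal:
  assumes "ideal I R" shows "ideal (ideal_pow R I n) R"
proof (induction n)
  case 0
  show ?case unfolding ideal_pow_0 by (rule oneideal)
next
  case (Suc n)
  then show ?case unfolding ideal_pow_Suc using assms by (rule ideal_prod_is_ideal)
qed

lemma ideal_pow_1:
  assumes "ideal I R" shows "ideal_pow R I (Suc 0) = I"
  unfolding ideal_pow_Suc ideal_pow_0
  using ideal_prod_commute[OF oneideal assms] ideal_prod_one[OF assms] by simp

lemma ideal_pow_add:
  "ideal I R \<Longrightarrow> ideal_pow R I (i + j) = ideal_pow R I i \<cdot> ideal_pow R I j"
  using monoid.nat_pow_mult[OF comm_monoid.axioms(1)[OF ideals_set_is_comm_monoid], of I i j]
  by (simp add: ideals_set_def)

lemma ideal_pow_mult_closed: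
  "ideal I R \<Longrightarrow> a \<in> ideal_pow R I i \<Longrightarrow> b \<in> ideal_pow R I j \<Longrightarrow> a \<otimes> b \<in> ideal_pow R I (i + j)"
  by (simp add: ideal_pow_add ideal_prod.prod)

lemma ideal_pow_antimono:
  assumes "ideal I R" "i \<le> j" shows "ideal_pow R I j \<subseteq> ideal_pow R I i"
proof -
  have "ideal_pow R I j = ideal_pow R I i \<cdot> ideal_pow R I (j - i)"
    using ideal_pow_add[OF assms(1), of i "j - i"] assms(2) by simp
  then show ?thesis using ideal_prod_inter[OF ideal_pow_ideal[OF assms(1)] ideal_pow_ideal[OF assms(1)]] by blast
qed

lemma ideal_pow_pow_closed: "ideal I R \<Longrightarrow> a \<in> I \<Longrightarrow> a [^] n \<in> ideal_pow R I n"
proof (induction n)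
  case (Suc n)
  then show ?case using ideal_pow_mult_closed[of I "a [^] n" n a "Suc 0"]
    unfolding ideal_pow_1[OF Suc.prems(1)] by simp
next
  case 0
  then show ?case unfolding ideal_pow_0 by simp
qed

lemma ideal_prod_subset:
  assumes "ideal K R" "\<And>i j. i \<in> I \<Longrightarrow> j \<in> J \<Longrightarrow> i \<otimes> j \<in> K"
  shows "I \<cdot> J \<subseteq> K"
proof
  fix a assume "a \<in> I \<cdot> J"
  then show "a \<in> K"
    by (induction rule: ideal_prod.induct)
      (use assms additive_subgroup.a_closed[OF ideal.axioms(1)[OF assms(1)]] in auto)
qed

end

lemma (in noetherian_ring) exists_maximal_ideal_in:
  assumes "\<S> \<noteq> {}" "\<And>I. I \<in> \<S> \<Longrightarrow> ideal I R"
  shows "\<exists>P\<in>\<S>. \<forall>J\<in>\<S>. P \<subseteq> J \<longrightarrow> J = P"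
proof (rule subset_Zorn_nonempty[OF assms(1)])
  fix C assume C: "C \<noteq> {}" "subset.chain \<S> C"
  then have "subset.chain {I. ideal I R} C"
    using assms(2) unfolding subset.chain_def by (simp add: subset_iff)
  with C(1) have "\<Union>C \<in> C" by (rule ideal_chain_is_trivial)
  then show "\<Union>C \<in> \<S>" using C(2) unfolding subset.chain_def by blast
qed

lemma (in noetherian_ring) ideal_subset_maximalideal:
  assumes "ideal I R" "I \<noteq> carrier R"
  shows "\<exists>P. maximalideal P R \<and> I \<subseteq> P"
proof -
  let ?S = "{J. ideal J R \<and> I \<subseteq> J \<and> J \<noteq> carrier R}"
  have "\<exists>P\<in>?S. \<forall>J\<in>?S. P \<subseteq> J \<longrightarrow> J = P"
    by (rule exists_maximal_ideal_in) (use assms in auto)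
  then obtain P where P: "ideal P R" "I \<subseteq> P" "P \<noteq> carrier R"
    "\<And>J. ideal J R \<Longrightarrow> I \<subseteq> J \<Longrightarrow> J \<noteq> carrier R \<Longrightarrow> P \<subseteq> J \<Longrightarrow> J = P"
    by simp metis
  have "maximalideal P R"
  proof (rule maximalidealI)
    fix J assume "ideal J R" "P \<subseteq> J" "J \<subseteq> carrier R"
    then show "J = P \<or> J = carrier R" using P(2,4) by blast
  qed (use P in auto)
  then show ?thesis using P(2) by blast
qed

locale noetherian_local_ring = local_ring R \<mm> + noetherian_ring R for R (structure) and \<mm>
begin

lemma ideal_max: "ideal \<mm> R" ..

lemma one_notin_max: "\<one> \<notin> \<mm>"
  using one_imp_carrier I_notcarr by blast

lemma proper_ideal_subset_max: "ideal I R \<Longrightarrow> I \<noteq> carrier R \<Longrightarrow> I \<subseteq> \<mm>"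
  using ideal_subset_maximalideal maximal_unique by blast

lemma inverse_of_notin_max:
  assumes "a \<in> carrier R" "a \<notin> \<mm>"
  shows "\<exists>b\<in>carrier R. b \<otimes> a = \<one>"
proof -
  have "PIdl a = carrier R"
    using proper_ideal_subset_max[OF cgenideal_ideal[OF assms(1)]] cgenideal_self[OF assms(1)] assms(2) by blast
  then have "\<one> \<in> PIdl a" by simp
  then show ?thesis unfolding cgenideal_def by auto
qed

lemma mult_unit_mem:
  assumes "ideal I R" "a \<in> carrier R" "a \<notin> \<mm>" "b \<in> carrier R" "a \<otimes> b \<in> I"
  shows "b \<in> I"
proof -
  obtain c where c: "c \<in> carrier R" "c \<otimes> a = \<one>" using inverse_of_notin_max assms by blast
  have "c \<otimes> (a \<otimes> b) \<in> I" using ideal.I_l_closed[OF assms(1)] assms(5) c(1) by blast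
  then show ?thesis using c assms by (simp add: m_assoc[symmetric])
qed

text \<open>If \<open>L \<noteq> I\<close>, choose an ideal \<open>J\<close> maximal among those with \<open>L \<subseteq> J \<subset> I\<close>. For \<open>a \<in> I\<close> and \<open>m \<in> \<mm>\<close>, an element \<open>m a\<close>
outside \<open>J\<close> would generate \<open>I\<close> over \<open>J\<close>, so that \<open>a = j + s m a\<close>; then \<open>(1 - s m) a \<in> J\<close> with \<open>1 - s m\<close> a unit,
so \<open>a \<in> J\<close>, a contradiction. Hence \<open>\<mm> I \<subseteq> J\<close> and \<open>L + \<mm> I \<subseteq> J \<noteq> I\<close>.\<close>

lemma nakayama:
  assumes I: "ideal I R" and L: "ideal L R" "L \<subseteq> I" and le: "I \<subseteq> L <+> \<mm> \<cdot> I"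
  shows "L = I"
proof (rule ccontr)
  assume "L \<noteq> I"
  let ?S = "{J. ideal J R \<and> L \<subseteq> J \<and> J \<subset> I}"
  have "\<exists>J\<in>?S. \<forall>J'\<in>?S. J \<subseteq> J' \<longrightarrow> J' = J"
    by (rule exists_maximal_ideal_in) (use L \<open>L \<noteq> I\<close> in auto)
  then obtain J where J: "ideal J R" "L \<subseteq> J" "J \<subset> I"
    and max: "\<And>J'. ideal J' R \<Longrightarrow> L \<subseteq> J' \<Longrightarrow> J' \<subset> I \<Longrightarrow> J \<subseteq> J' \<Longrightarrow> J' = J"
    by simp metis
  have step: "m \<otimes> a \<in> J" if m: "m \<in> \<mm>" and a: "a \<in> I" for m a
  proof (rule ccontr)
    assume ma: "m \<otimes> a \<notin> J"
    have c: "m \<in> carrier R" "a \<in> carrier R" using ideal.Icarr[OF ideal_max m] ideal.Icarr[OF I a] by auto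
    let ?K = "J <+>\<^bsub>R\<^esub> PIdl (m \<otimes> a)"
    have P: "ideal (PIdl (m \<otimes> a)) R" using c by (intro cgenideal_ideal) simp
    have K: "ideal ?K R" using J(1) P by (rule add_ideals)
    have "m \<otimes> a \<in> ?K" using ideal_add_upper2[OF J(1) P] cgenideal_self[of "m \<otimes> a"] c by blast
    moreover have "?K \<subseteq> I"
      by (rule ideal_add_least[OF I]) (use J(3) cgenideal_minimal[OF I] ideal.I_l_closed[OF I a c(1)] in auto)
    ultimately have "?K = I"
      using max[OF K] ideal_add_upper1[OF J(1) P] J(2) ma by blast
    then obtain j d where jd: "j \<in> J" "d \<in> PIdl (m \<otimes> a)" "a = j \<oplus> d" using a unfolding mem_set_add_iff[symmetric] by (auto simp: mem_set_add_iff)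
    then obtain s where s: "s \<in> carrier R" "d = s \<otimes> (m \<otimes> a)" unfolding cgenideal_def by blast
    have jc: "j \<in> carrier R" using ideal.Icarr[OF J(1) jd(1)] .
    have sm: "s \<otimes> m \<in> \<mm>" using m s by (simp add: I_l_closed)
    have "\<one> \<ominus> s \<otimes> m \<notin> \<mm>"
    proof
      assume "\<one> \<ominus> s \<otimes> m \<in> \<mm>"
      then have "(\<one> \<ominus> s \<otimes> m) \<oplus> s \<otimes> m \<in> \<mm>" using sm by simp
      moreover have "(\<one> \<ominus> s \<otimes> m) \<oplus> s \<otimes> m = \<one>" using s c by (simp add: a_minus_def a_assoc l_neg)
      ultimately show False using one_notin_max by simp
    qed
    moreover have "(\<one> \<ominus> s \<otimes> m) \<otimes> a = j"
    proof -
      have "(\<one> \<ominus> s \<otimes> m) \<otimes> a = a \<ominus> s \<otimes> (m \<otimes> a)" using s c by (simp add: a_minus_def l_distr l_minus m_assoc)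
      also have "\<dots> = (j \<oplus> d) \<ominus> d" by (simp only: s(2)[symmetric] jd(3)[symmetric])
      also have "\<dots> = j"
      proof -
        have "d \<in> carrier R" using s c by simp
        then show ?thesis using jc by (simp add: a_minus_def a_assoc r_neg)
      qed
      finally show ?thesis .
    qed
    ultimately have "a \<in> J" using mult_unit_mem[OF J(1), of "\<one> \<ominus> s \<otimes> m" a] c s jd(1) by simp
    then have "m \<otimes> a \<in> J" using ideal.I_l_closed[OF J(1)] c by blast
    with ma show False ..
  qed
  have "\<mm> \<cdot> I \<subseteq> J" by (rule ideal_prod_subset[OF J(1) step])
  then have "L <+> \<mm> \<cdot> I \<subseteq> J" using J by (intro ideal_add_least) auto
  then show False using le J(3) by blast
qed

text \<open>\<open>N\<close> is generated over \<open>L\<close> by one element \<open>a\<close> with \<open>\<mm> a \<subseteq> L\<close>, so \<open>N / L\<close> is a quotient of the residue field: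
an ideal between them that is not \<open>L\<close> contains \<open>l + c a\<close> with \<open>c\<close> a unit, hence \<open>a\<close>.\<close>

lemma ideal_length_adjoin_le:
  assumes L: "ideal L R" and N: "ideal N R" "L \<subseteq> N"
    and a: "a \<in> carrier R" "\<And>m. m \<in> \<mm> \<Longrightarrow> m \<otimes> a \<in> L"
    and gen: "\<And>b. b \<in> N \<Longrightarrow> \<exists>l\<in>L. \<exists>c\<in>carrier R. b = l \<oplus> c \<otimes> a"
  shows "ideal_length R L N \<le> 1"
  unfolding ideal_length_def
proof (rule interval_length_leI)
  fix C n assume C: "submodule_chain R (module_via id R) L N C n"
  have two: "X = L \<or> X = N" if X: "ideal X R" "L \<subseteq> X" "X \<subseteq> N" for X
  proof (cases "X \<subseteq> L")
    case False
    then obtain b where b: "b \<in> X" "b \<notin> L" by blast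
    then obtain l c where lc: "l \<in> L" "c \<in> carrier R" "b = l \<oplus> c \<otimes> a" using gen X(3) by blast
    have "c \<notin> \<mm>"
    proof
      assume "c \<in> \<mm>"
      then have "b \<in> L" using lc a(2) additive_subgroup.a_closed[OF ideal.axioms(1)[OF L] lc(1)] by simp
      with b show False by blast
    qed
    have l: "l \<in> carrier R" using ideal.Icarr[OF L lc(1)] .
    have "c \<otimes> a = \<ominus> l \<oplus> b" using lc l a(1) by (simp add: r_neg1)
    moreover have "\<ominus> l \<in> X" "b \<in> X"
      using lc(1) X(2) additive_subgroup.a_inv_closed[OF ideal.axioms(1)[OF X(1)]] b by auto
    ultimately have "c \<otimes> a \<in> X" using additive_subgroup.a_closed[OF ideal.axioms(1)[OF X(1)]] by simp
    then have aX: "a \<in> X" using mult_unit_mem[OF X(1) lc(2) \<open>c \<notin> \<mm>\<close> a(1)] by simp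
    have "N \<subseteq> X"
    proof
      fix d assume "d \<in> N"
      then obtain l c where "l \<in> L" "c \<in> carrier R" "d = l \<oplus> c \<otimes> a" using gen by blast
      then show "d \<in> X" using aX X(2) ideal.I_l_closed[OF X(1)] additive_subgroup.a_closed[OF ideal.axioms(1)[OF X(1)]] by blast
    qed
    then show ?thesis using X(3) by blast
  qed (use X in blast)
  have I: "C i = L \<or> C i = N" if "i \<le> n" for i
    using C two that unfolding submodule_chain_def submodule_via_id_iff by blast
  have S: "C i \<subset> C (Suc i)" if "i < n" for i using C that unfolding submodule_chain_def by blast
  have "n \<le> 1"
  proof (rule ccontr)
    assume "\<not> n \<le> 1"
    then show False using I[of 0] I[of "Suc 0"] I[of "Suc (Suc 0)"] S[of 0] S[of "Suc 0"] N(2) by auto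
  qed
  then show "enat n \<le> 1" by (simp add: one_enat_def)
qed

lemma ideal_length_adjoin:
  assumes "ideal L R" "ideal N R" "L \<subseteq> N"
    and "a \<in> N" "a \<notin> L" "\<And>m. m \<in> \<mm> \<Longrightarrow> m \<otimes> a \<in> L"
    and "\<And>b. b \<in> N \<Longrightarrow> \<exists>l\<in>L. \<exists>c\<in>carrier R. b = l \<oplus> c \<otimes> a"
  shows "ideal_length R L N = 1"
proof (rule order.antisym)
  show "ideal_length R L N \<le> 1"
    by (rule ideal_length_adjoin_le[OF assms(1-3) ideal.Icarr[OF assms(2,4)] assms(6,7)])
  have "ideal_length R L N \<noteq> 0" using ideal_length_eq_0[OF assms(1-3)] assms(4,5) by blast
  then show "1 \<le> ideal_length R L N" by (simp add: one_eSuc ileI1 zero_less_iff_neq_zero)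
qed

text \<open>Adjoining \<open>n\<close> generators to \<open>\<mm> I\<close> one at a time increases the length by at most \<open>1\<close> each time.\<close>

lemma ideal_length_le_min_gens:
  assumes I: "ideal I R" shows "ideal_length R (\<mm> \<cdot> I) I \<le> min_gens R I"
  unfolding min_gens_def
proof (rule Inf_greatest)
  fix k assume "k \<in> {enat (card S) |S. S \<subseteq> carrier R \<and> finite S \<and> I = Idl S}"
  then obtain S where S: "S \<subseteq> carrier R" "finite S" "I = Idl S" and k: "k = enat (card S)" by blast
  have mI: "ideal (\<mm> \<cdot> I) R" by (rule ideal_prod_is_ideal[OF ideal_max I])
  have "S \<subseteq> I" using genideal_self[OF S(1)] S(3) by simp
  with S(2) have "\<exists>P. ideal P R \<and> \<mm> \<cdot> I \<subseteq> P \<and> P \<subseteq> I \<and> S \<subseteq> P \<and> ideal_length R (\<mm> \<cdot> I) P \<le> enat (card S)"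
  proof (induction S rule: finite_induct)
    case empty
    show ?case
      by (rule exI[of _ "\<mm> \<cdot> I"])
        (use mI ideal_prod_inter[OF ideal_max I] in \<open>auto simp: ideal_length_self\<close>)
  next
    case (insert s S)
    then obtain P where P: "ideal P R" "\<mm> \<cdot> I \<subseteq> P" "P \<subseteq> I" "S \<subseteq> P" "ideal_length R (\<mm> \<cdot> I) P \<le> enat (card S)"
      by blast
    have s: "s \<in> I" "s \<in> carrier R" using insert.prems ideal.Icarr[OF I] by auto
    let ?P = "P <+>\<^bsub>R\<^esub> PIdl s"
    have Ps: "ideal (PIdl s) R" by (rule cgenideal_ideal[OF s(2)])
    have P': "ideal ?P R" using P(1) Ps by (rule add_ideals)
    have le: "ideal_length R P ?P \<le> 1"
    proof (rule ideal_length_adjoin_le[OF P(1) P' ideal_add_upper1[OF P(1) Ps] s(2)])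
      show "m \<otimes> s \<in> P" if "m \<in> \<mm>" for m using ideal_prod.prod[OF that s(1), of R] P(2) by blast
      show "\<exists>l\<in>P. \<exists>c\<in>carrier R. b = l \<oplus> c \<otimes> s" if "b \<in> ?P" for b
        using that unfolding mem_set_add_iff cgenideal_def by blast
    qed
    have "ideal_length R (\<mm> \<cdot> I) ?P = ideal_length R (\<mm> \<cdot> I) P + ideal_length R P ?P"
      by (rule ideal_length_add[OF mI P(1) P' P(2) ideal_add_upper1[OF P(1) Ps]])
    also have "\<dots> \<le> enat (card S) + 1" using P(5) le by (rule add_mono)
    also have "\<dots> = enat (card (insert s S))" using insert.hyps by (simp add: one_enat_def)
    finally have len: "ideal_length R (\<mm> \<cdot> I) ?P \<le> enat (card (insert s S))" .
    have "?P \<subseteq> I" by (rule ideal_add_least[OF I P(3) cgenideal_minimal[OF I s(1)]])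
    moreover have "insert s S \<subseteq> ?P"
      using ideal_add_upper1[OF P(1) Ps] ideal_add_upper2[OF P(1) Ps] cgenideal_self[OF s(2)] P(4) by blast
    ultimately show ?case using P' len P(2) ideal_add_upper1[OF P(1) Ps] by (intro exI[of _ ?P]) auto
  qed
  then obtain P where P: "ideal P R" "P \<subseteq> I" "S \<subseteq> P" "ideal_length R (\<mm> \<cdot> I) P \<le> enat (card S)" by blast
  have "I \<subseteq> P" using genideal_minimal[OF P(1,3)] S(3) by simp
  then show "ideal_length R (\<mm> \<cdot> I) I \<le> k" using P k by simp
qed

text \<open>Each element of \<open>I\<close> outside \<open>L\<close> uses up at least one unit of the length when it is adjoined to \<open>L\<close>.
The conclusion says that \<open>L\<close> and \<open>S\<close> together generate \<open>I\<close>, in a form that is stable under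
enlarging \<open>L\<close>.\<close>

lemma generators_of_ideal_length:
  assumes I: "ideal I R"
  shows "ideal L R \<Longrightarrow> L \<subseteq> I \<Longrightarrow> ideal_length R L I \<le> enat n \<Longrightarrow>
    \<exists>S\<subseteq>I. finite S \<and> card S \<le> n \<and> (\<forall>J. ideal J R \<longrightarrow> L \<subseteq> J \<longrightarrow> S \<subseteq> J \<longrightarrow> I \<subseteq> J)"
proof (induction n arbitrary: L)
  case 0
  have "ideal_length R L I = 0" using 0(3) by (simp only: zero_enat_def[symmetric] ile0_eq)
  then have "L = I" by (rule ideal_length_eq_0[OF 0(1) I 0(2)])
  then show ?case by (intro exI[of _ "{}"]) auto
next
  case (Suc n)
  show ?case
  proof (cases "L = I")
    case True
    then show ?thesis by (intro exI[of _ "{}"]) auto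
  next
    case False
    then obtain a where a: "a \<in> I" "a \<notin> L" using Suc.prems by blast
    have ac: "a \<in> carrier R" using ideal.Icarr[OF I a(1)] .
    let ?P = "L <+>\<^bsub>R\<^esub> PIdl a"
    have Pa: "ideal (PIdl a) R" by (rule cgenideal_ideal[OF ac])
    have P: "ideal ?P R" using Suc.prems(1) Pa by (rule add_ideals)
    have PI: "?P \<subseteq> I" by (rule ideal_add_least[OF I Suc.prems(2) cgenideal_minimal[OF I a(1)]])
    have aP: "a \<in> ?P" "L \<subseteq> ?P"
      using ideal_add_upper1[OF Suc.prems(1) Pa] ideal_add_upper2[OF Suc.prems(1) Pa] cgenideal_self[OF ac] by blast+
    have "ideal_length R L ?P \<noteq> 0" using ideal_length_eq_0[OF Suc.prems(1) P aP(2)] aP(1) a(2) by blast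
    then have ge: "1 \<le> ideal_length R L ?P" by (simp add: one_eSuc ileI1 zero_less_iff_neq_zero)
    have sum: "ideal_length R L I = ideal_length R L ?P + ideal_length R ?P I"
      by (rule ideal_length_add[OF Suc.prems(1) P I aP(2) PI])
    have "1 + ideal_length R ?P I \<le> enat (Suc n)"
      using order.trans[OF add_right_mono[OF ge] Suc.prems(3)[unfolded sum]] .
    then have "ideal_length R ?P I \<le> enat n"
      by (cases "ideal_length R ?P I") (auto simp: one_enat_def)
    from Suc.IH[OF P PI this] obtain S where S: "S \<subseteq> I" "finite S" "card S \<le> n"
      "\<And>J. ideal J R \<Longrightarrow> ?P \<subseteq> J \<Longrightarrow> S \<subseteq> J \<Longrightarrow> I \<subseteq> J" by blast
    have "I \<subseteq> J" if J: "ideal J R" "L \<subseteq> J" "insert a S \<subseteq> J" for J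
    proof (rule S(4)[OF J(1)])
      show "?P \<subseteq> J" by (rule ideal_add_least[OF J(1,2) cgenideal_minimal[OF J(1)]]) (use J(3) in auto)
    qed (use J(3) in auto)
    moreover have "card (insert a S) \<le> Suc n" using S by (simp add: card_insert_if)
    ultimately show ?thesis using S a by (intro exI[of _ "insert a S"]) auto
  qed
qed

theorem min_gens_eq_ideal_length:
  assumes I: "ideal I R" shows "min_gens R I = ideal_length R (\<mm> \<cdot> I) I"
proof (rule order.antisym[OF _ ideal_length_le_min_gens[OF I]])
  have mI: "ideal (\<mm> \<cdot> I) R" "\<mm> \<cdot> I \<subseteq> I"
    using ideal_prod_is_ideal[OF ideal_max I] ideal_prod_inter[OF ideal_max I] by auto
  show "min_gens R I \<le> ideal_length R (\<mm> \<cdot> I) I"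
  proof (cases "ideal_length R (\<mm> \<cdot> I) I")
    case (enat n)
    then obtain S where S: "S \<subseteq> I" "finite S" "card S \<le> n"
      "\<And>J. ideal J R \<Longrightarrow> \<mm> \<cdot> I \<subseteq> J \<Longrightarrow> S \<subseteq> J \<Longrightarrow> I \<subseteq> J"
      using generators_of_ideal_length[OF I mI, of n] by auto
    have Sc: "S \<subseteq> carrier R" using S(1) ideal.Icarr[OF I] by blast
    have G: "ideal (Idl S) R" "Idl S \<subseteq> I" "S \<subseteq> Idl S"
      using genideal_ideal[OF Sc] genideal_minimal[OF I S(1)] genideal_self[OF Sc] by auto
    have "I \<subseteq> Idl S <+> \<mm> \<cdot> I"
      by (rule S(4)[OF add_ideals[OF G(1) mI(1)] ideal_add_upper2[OF G(1) mI(1)]])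
        (use ideal_add_upper1[OF G(1) mI(1)] G(3) in blast)
    from nakayama[OF I G(1,2) this] have "min_gens R I \<le> enat (card S)"
      unfolding min_gens_def using Sc S(2) by (intro Inf_lower) auto
    also have "\<dots> \<le> enat n" using S(3) by simp
    finally show ?thesis using enat by simp
  qed simp
qed

lemma min_gens_finite: "ideal I R \<Longrightarrow> min_gens R I \<noteq> \<infinity>"
proof
  assume "ideal I R" and inf: "min_gens R I = \<infinity>"
  then obtain S where "S \<subseteq> carrier R" "finite S" "I = Idl S" using finetely_gen by blast
  then have "min_gens R I \<le> enat (card S)" unfolding min_gens_def by (intro Inf_lower) auto
  with inf show False by simp
qed

end

section \<open>Localization\<close>

locale multiplicative_set = cring R for R (structure) +
  fixes S
  assumes S_carrier: "S \<subseteq> carrier R" and S_one: "\<one> \<in> S"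
    and S_mult: "s \<in> S \<Longrightarrow> t \<in> S \<Longrightarrow> s \<otimes> t \<in> S"
begin

lemma S_closed [simp]: "s \<in> S \<Longrightarrow> s \<in> carrier R"
  using S_carrier by blast

definition same_fraction :: "'a \<times> 'a \<Rightarrow> 'a \<times> 'a \<Rightarrow> bool"
  where "same_fraction p q \<longleftrightarrow> (\<exists>t\<in>S. t \<otimes> (snd q \<otimes> fst p) = t \<otimes> (snd p \<otimes> fst q))"

lemma frac_class_altdef:
  "frac_class R S r s = {q. fst q \<in> carrier R \<and> snd q \<in> S \<and> same_fraction (r, s) q}"
  unfolding frac_class_def same_fraction_def by auto

lemma mem_frac_class_iff:
  "(b, t) \<in> frac_class R S a s \<longleftrightarrow>
    b \<in> carrier R \<and> t \<in> S \<and> (\<exists>u\<in>S. u \<otimes> (t \<otimes> a) = u \<otimes> (s \<otimes> b))"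
  by (simp add: frac_class_def)

lemma same_fraction_refl: "same_fraction p p"
  unfolding same_fraction_def using S_one by blast

lemma same_fraction_sym: "same_fraction p q \<Longrightarrow> same_fraction q p"
  unfolding same_fraction_def by metis

lemma same_fraction_trans:
  assumes c: "a \<in> carrier R" "b \<in> carrier R" "c \<in> carrier R" "s \<in> S" "t \<in> S" "u \<in> S"
    and "same_fraction (a, s) (b, t)" "same_fraction (b, t) (c, u)"
  shows "same_fraction (a, s) (c, u)"
proof -
  obtain v w where v: "v \<in> S" "v \<otimes> (t \<otimes> a) = v \<otimes> (s \<otimes> b)"
    and w: "w \<in> S" "w \<otimes> (u \<otimes> b) = w \<otimes> (t \<otimes> c)"
    using assms(7,8) unfolding same_fraction_def by auto
  note c = c v(1) w(1) S_closed
  have "(v \<otimes> w \<otimes> t) \<otimes> (u \<otimes> a) = (w \<otimes> u) \<otimes> (v \<otimes> (t \<otimes> a))" using c by (simp add: m_ac)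
  also have "\<dots> = (v \<otimes> s) \<otimes> (w \<otimes> (u \<otimes> b))" unfolding v(2) using c by (simp add: m_ac)
  also have "\<dots> = (v \<otimes> w \<otimes> t) \<otimes> (s \<otimes> c)" unfolding w(2) using c by (simp add: m_ac)
  finally show ?thesis unfolding same_fraction_def using c S_mult by auto
qed

lemma frac_class_eqI:
  assumes c: "a \<in> carrier R" "b \<in> carrier R" "s \<in> S" "t \<in> S" and eq: "same_fraction (a, s) (b, t)"
  shows "frac_class R S a s = frac_class R S b t"
proof -
  have *: "same_fraction (a, s) q \<longleftrightarrow> same_fraction (b, t) q" if "fst q \<in> carrier R" "snd q \<in> S" for q
    using same_fraction_trans[OF c(1,2) that(1) c(3,4) that(2) eq]
      same_fraction_trans[OF c(2,1) that(1) c(4,3) that(2) same_fraction_sym[OF eq]] by auto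
  show ?thesis unfolding frac_class_altdef by (simp add: * cong: conj_cong)
qed

lemma frac_class_eq_iff:
  assumes c: "a \<in> carrier R" "b \<in> carrier R" "s \<in> S" "t \<in> S"
  shows "frac_class R S a s = frac_class R S b t \<longleftrightarrow> (\<exists>u\<in>S. u \<otimes> (t \<otimes> a) = u \<otimes> (s \<otimes> b))"
proof -
  have "same_fraction (a, s) (b, t)" if "frac_class R S a s = frac_class R S b t"
  proof -
    have "(b, t) \<in> frac_class R S b t" unfolding frac_class_altdef using c same_fraction_refl by simp
    then have "(b, t) \<in> frac_class R S a s" by (simp only: that)
    then show ?thesis by (simp add: frac_class_altdef)
  qed
  then have "frac_class R S a s = frac_class R S b t \<longleftrightarrow> same_fraction (a, s) (b, t)"
    using frac_class_eqI[OF c] by blast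
  then show ?thesis by (simp add: same_fraction_def)
qed

lemma frac_class_eq_cross:
  assumes "a \<in> carrier R" "b \<in> carrier R" "s \<in> S" "t \<in> S" "t \<otimes> a = s \<otimes> b"
  shows "frac_class R S a s = frac_class R S b t"
  using assms S_one by (subst frac_class_eq_iff) auto

lemma mem_frac_class_self: "a \<in> carrier R \<Longrightarrow> s \<in> S \<Longrightarrow> (a, s) \<in> frac_class R S a s"
  unfolding frac_class_altdef using same_fraction_refl by simp

text \<open>A fraction is represented by the set of all pairs defining it, and the operations are unions over all
pairs of representatives. The next two lemmas say that all members of these unions coincide.\<close>

lemma mult_frac_class:
  assumes c: "a \<in> carrier R" "b \<in> carrier R" "s \<in> S" "t \<in> S"
  shows "frac_class R S a s \<otimes>\<^bsub>localization R S\<^esub> frac_class R S b t = frac_class R S (a \<otimes> b) (s \<otimes> t)"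
proof -
  have "frac_class R S (a' \<otimes> b') (s' \<otimes> t') = frac_class R S (a \<otimes> b) (s \<otimes> t)"
    if p: "(a', s') \<in> frac_class R S a s" "(b', t') \<in> frac_class R S b t" for a' b' s' t'
  proof -
    obtain v w where v: "v \<in> S" "v \<otimes> (s' \<otimes> a) = v \<otimes> (s \<otimes> a')"
      and w: "w \<in> S" "w \<otimes> (t' \<otimes> b) = w \<otimes> (t \<otimes> b')" and d: "a' \<in> carrier R" "b' \<in> carrier R" "s' \<in> S" "t' \<in> S"
      using p unfolding mem_frac_class_iff by blast
    note c = c d v(1) w(1) S_closed
    have "(v \<otimes> w) \<otimes> ((s' \<otimes> t') \<otimes> (a \<otimes> b)) = (v \<otimes> (s' \<otimes> a)) \<otimes> (w \<otimes> (t' \<otimes> b))" using c by (simp add: m_ac)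
    also have "\<dots> = (v \<otimes> w) \<otimes> ((s \<otimes> t) \<otimes> (a' \<otimes> b'))" unfolding v(2) w(2) using c by (simp add: m_ac)
    finally show ?thesis using c S_mult by (subst frac_class_eq_iff) (auto intro!: bexI[of _ "v \<otimes> w"])
  qed
  moreover have "(a, s) \<in> frac_class R S a s" "(b, t) \<in> frac_class R S b t"
    using c mem_frac_class_self by auto
  ultimately have "(\<Union>(a', s')\<in>frac_class R S a s. \<Union>(b', t')\<in>frac_class R S b t.
      frac_class R S (a' \<otimes> b') (s' \<otimes> t')) = frac_class R S (a \<otimes> b) (s \<otimes> t)" by blast
  then show ?thesis by (simp add: localization_def)
qed

lemma add_frac_class:
  assumes c: "a \<in> carrier R" "b \<in> carrier R" "s \<in> S" "t \<in> S"
  shows "frac_class R S a s \<oplus>\<^bsub>localization R S\<^esub> frac_class R S b t = frac_class R S (a \<otimes> t \<oplus> b \<otimes> s) (s \<otimes> t)"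
proof -
  have "frac_class R S (a' \<otimes> t' \<oplus> b' \<otimes> s') (s' \<otimes> t') = frac_class R S (a \<otimes> t \<oplus> b \<otimes> s) (s \<otimes> t)"
    if p: "(a', s') \<in> frac_class R S a s" "(b', t') \<in> frac_class R S b t" for a' b' s' t'
  proof -
    obtain v w where v: "v \<in> S" "v \<otimes> (s' \<otimes> a) = v \<otimes> (s \<otimes> a')"
      and w: "w \<in> S" "w \<otimes> (t' \<otimes> b) = w \<otimes> (t \<otimes> b')" and d: "a' \<in> carrier R" "b' \<in> carrier R" "s' \<in> S" "t' \<in> S"
      using p unfolding mem_frac_class_iff by blast
    note c = c d v(1) w(1) S_closed
    have "(v \<otimes> w) \<otimes> ((s' \<otimes> t') \<otimes> (a \<otimes> t \<oplus> b \<otimes> s))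
        = (w \<otimes> t' \<otimes> t) \<otimes> (v \<otimes> (s' \<otimes> a)) \<oplus> (v \<otimes> s' \<otimes> s) \<otimes> (w \<otimes> (t' \<otimes> b))"
      using c by (simp add: m_ac r_distr)
    also have "\<dots> = (v \<otimes> w) \<otimes> ((s \<otimes> t) \<otimes> (a' \<otimes> t' \<oplus> b' \<otimes> s'))"
      unfolding v(2) w(2) using c by (simp add: m_ac r_distr)
    finally show ?thesis using c S_mult by (subst frac_class_eq_iff) (auto intro!: bexI[of _ "v \<otimes> w"])
  qed
  moreover have "(a, s) \<in> frac_class R S a s" "(b, t) \<in> frac_class R S b t"
    using c mem_frac_class_self by auto
  ultimately have "(\<Union>(a', s')\<in>frac_class R S a s. \<Union>(b', t')\<in>frac_class R S b t.
      frac_class R S (a' \<otimes> t' \<oplus> b' \<otimes> s') (s' \<otimes> t')) = frac_class R S (a \<otimes> t \<oplus> b \<otimes> s) (s \<otimes> t)" by blast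
  then show ?thesis by (simp add: localization_def)
qed

lemma add_frac_class_same_denominator:
  assumes c: "a \<in> carrier R" "b \<in> carrier R" "s \<in> S"
  shows "frac_class R S a s \<oplus>\<^bsub>localization R S\<^esub> frac_class R S b s = frac_class R S (a \<oplus> b) s"
  unfolding add_frac_class[OF c(1,2,3,3)]
  using c S_mult by (intro frac_class_eq_cross) (simp_all add: r_distr m_ac)

lemma localization_carrier:
  "carrier (localization R S) = {frac_class R S r s | r s. r \<in> carrier R \<and> s \<in> S}"
  by (simp add: localization_def)

lemma frac_class_in_carrier [simp]:
  "a \<in> carrier R \<Longrightarrow> s \<in> S \<Longrightarrow> frac_class R S a s \<in> carrier (localization R S)"
  unfolding localization_carrier by blast

lemma localization_one: "\<one>\<^bsub>localization R S\<^esub> = frac_class R S \<one> \<one>"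
  by (simp add: localization_def)

lemma localization_zero: "\<zero>\<^bsub>localization R S\<^esub> = frac_class R S \<zero> \<one>"
  by (simp add: localization_def)

lemma frac_class_zero: "s \<in> S \<Longrightarrow> frac_class R S \<zero> s = \<zero>\<^bsub>localization R S\<^esub>"
  unfolding localization_zero using S_one by (intro frac_class_eq_cross) auto

lemma localization_cring: "cring (localization R S)"
proof (rule cringI)
  let ?L = "localization R S"
  note simps = mult_frac_class add_frac_class localization_one localization_zero
  have L: "\<exists>a s. a \<in> carrier R \<and> s \<in> S \<and> f = frac_class R S a s" if "f \<in> carrier ?L" for f
    using that unfolding localization_carrier by blast
  show "abelian_group ?L"
  proof (rule abelian_groupI)
    show "\<zero>\<^bsub>?L\<^esub> \<in> carrier ?L" unfolding localization_zero using S_one by simp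
    fix f assume f: "f \<in> carrier ?L"
    then obtain a s where as: "a \<in> carrier R" "s \<in> S" "f = frac_class R S a s" using L by blast
    show "\<zero>\<^bsub>?L\<^esub> \<oplus>\<^bsub>?L\<^esub> f = f" using as S_one by (simp add: simps)
    have "frac_class R S (\<ominus> a) s \<oplus>\<^bsub>?L\<^esub> f = \<zero>\<^bsub>?L\<^esub>"
      using as by (simp add: add_frac_class_same_denominator l_neg frac_class_zero)
    then show "\<exists>g\<in>carrier ?L. g \<oplus>\<^bsub>?L\<^esub> f = \<zero>\<^bsub>?L\<^esub>" using as by (metis a_inv_closed frac_class_in_carrier)
    fix g assume "g \<in> carrier ?L"
    then obtain b t where bt: "b \<in> carrier R" "t \<in> S" "g = frac_class R S b t" using L by blast
    show "f \<oplus>\<^bsub>?L\<^esub> g \<in> carrier ?L" using as bt S_mult by (simp add: simps)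
    show "f \<oplus>\<^bsub>?L\<^esub> g = g \<oplus>\<^bsub>?L\<^esub> f" using as bt by (simp add: simps a_comm m_comm)
    fix h assume "h \<in> carrier ?L"
    then obtain c u where cu: "c \<in> carrier R" "u \<in> S" "h = frac_class R S c u" using L by blast
    show "f \<oplus>\<^bsub>?L\<^esub> g \<oplus>\<^bsub>?L\<^esub> h = f \<oplus>\<^bsub>?L\<^esub> (g \<oplus>\<^bsub>?L\<^esub> h)"
      using as bt cu S_mult by (simp add: simps l_distr r_distr m_ac a_ac)
  qed
  show "comm_monoid ?L"
  proof (rule comm_monoidI)
    show "\<one>\<^bsub>?L\<^esub> \<in> carrier ?L" unfolding localization_one using S_one by simp
    fix f assume f: "f \<in> carrier ?L"
    then obtain a s where as: "a \<in> carrier R" "s \<in> S" "f = frac_class R S a s" using L by blast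
    show "\<one>\<^bsub>?L\<^esub> \<otimes>\<^bsub>?L\<^esub> f = f" using as S_one by (simp add: simps)
    fix g assume "g \<in> carrier ?L"
    then obtain b t where bt: "b \<in> carrier R" "t \<in> S" "g = frac_class R S b t" using L by blast
    show "f \<otimes>\<^bsub>?L\<^esub> g \<in> carrier ?L" using as bt S_mult by (simp add: simps)
    show "f \<otimes>\<^bsub>?L\<^esub> g = g \<otimes>\<^bsub>?L\<^esub> f" using as bt by (simp add: simps m_comm)
    fix h assume "h \<in> carrier ?L"
    then obtain c u where cu: "c \<in> carrier R" "u \<in> S" "h = frac_class R S c u" using L by blast
    show "f \<otimes>\<^bsub>?L\<^esub> g \<otimes>\<^bsub>?L\<^esub> h = f \<otimes>\<^bsub>?L\<^esub> (g \<otimes>\<^bsub>?L\<^esub> h)"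
      using as bt cu S_mult by (simp add: simps m_ac)
  qed
  fix f g h assume "f \<in> carrier ?L" "g \<in> carrier ?L" "h \<in> carrier ?L"
  with L[of f] L[of g] L[of h] obtain a s b t c u where
    as: "a \<in> carrier R" "s \<in> S" "f = frac_class R S a s"
    "b \<in> carrier R" "t \<in> S" "g = frac_class R S b t" "c \<in> carrier R" "u \<in> S" "h = frac_class R S c u"
    by blast
  have "frac_class R S ((a \<otimes> t \<oplus> b \<otimes> s) \<otimes> c) ((s \<otimes> t) \<otimes> u)
      = frac_class R S ((a \<otimes> c) \<otimes> (t \<otimes> u) \<oplus> (b \<otimes> c) \<otimes> (s \<otimes> u)) ((s \<otimes> u) \<otimes> (t \<otimes> u))"
    using as S_mult by (intro frac_class_eq_cross) (simp_all add: l_distr r_distr m_ac)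
  then show "(f \<oplus>\<^bsub>?L\<^esub> g) \<otimes>\<^bsub>?L\<^esub> h = f \<otimes>\<^bsub>?L\<^esub> h \<oplus>\<^bsub>?L\<^esub> g \<otimes>\<^bsub>?L\<^esub> h"
    using as S_mult by (simp add: simps)
qed

lemma frac_class_pow:
  "a \<in> carrier R \<Longrightarrow> s \<in> S \<Longrightarrow>
    frac_class R S a s [^]\<^bsub>localization R S\<^esub> (n::nat) = frac_class R S (a [^] n) (s [^] n) \<and> s [^] n \<in> S"
  by (induction n) (auto simp: localization_one mult_frac_class S_one S_mult)

end

lemma (in cring) multiplicative_set_regular: "multiplicative_set R (regular_elements R)"
proof
  show "regular_elements R \<subseteq> carrier R" by (auto simp: regular_elements_def)
  show "\<one> \<in> regular_elements R" by (auto simp: regular_elements_def)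
  fix s t assume s: "s \<in> regular_elements R" and t: "t \<in> regular_elements R"
  then have c: "s \<in> carrier R" "t \<in> carrier R" by (auto simp: regular_elements_def)
  have "a = \<zero>" if "a \<in> carrier R" "s \<otimes> t \<otimes> a = \<zero>" for a
  proof -
    have "s \<otimes> (t \<otimes> a) = \<zero>" using that c by (simp add: m_assoc)
    then have "t \<otimes> a = \<zero>" using s c that(1) by (simp add: regular_elements_def)
    then show ?thesis using t that(1) by (simp add: regular_elements_def)
  qed
  then show "s \<otimes> t \<in> regular_elements R" using c by (simp add: regular_elements_def)
qed

lemma (in cring) multiplicative_set_prime:
  assumes "primeideal P R" shows "multiplicative_set R (carrier R - P)"
proof -
  interpret P: primeideal P R by (rule assms)
  show ?thesis
    by unfold_locales (use P.I_prime P.I_notcarr P.one_imp_carrier in auto)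
qed

lemma (in multiplicative_set) pow_mem: "s \<in> S \<Longrightarrow> s [^] (n::nat) \<in> S"
  by (induction n) (auto simp: S_one S_mult)

lemma (in multiplicative_set) frac_class_eq_zero_iff:
  assumes "a \<in> carrier R" "s \<in> S"
  shows "frac_class R S a s = \<zero>\<^bsub>localization R S\<^esub> \<longleftrightarrow> (\<exists>t\<in>S. t \<otimes> a = \<zero>)"
proof -
  have "u \<otimes> (\<one> \<otimes> a) = u \<otimes> (s \<otimes> \<zero>) \<longleftrightarrow> u \<otimes> a = \<zero>" if "u \<in> S" for u
    using assms that by simp
  then show ?thesis unfolding localization_zero using assms S_one by (subst frac_class_eq_iff) auto
qed

section \<open>Graded quotient rings\<close>

lemma (in ring) finsum_in_ideal:
  assumes I: "ideal I R" and fin: "finite T" and f: "\<And>i. i \<in> T \<Longrightarrow> f i \<in> I"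
  shows "finsum R f T \<in> I"
  using fin f
proof (induction T rule: finite_induct)
  case empty
  then show ?case by (simp add: additive_subgroup.zero_closed[OF ideal.axioms(1)[OF I]])
next
  case (insert i T)
  have "f \<in> T \<rightarrow> carrier R" "f i \<in> carrier R" using insert.prems ideal.Icarr[OF I] by auto
  then show ?case using insert additive_subgroup.a_closed[OF ideal.axioms(1)[OF I]] by simp
qed

text \<open>Ring axioms are inherited by a structure that embeds into a commutative ring. This is how \<open>F(x)\<close> is
seen to be a ring: directly, associativity would need a rearrangement of double sums.\<close>

lemma (in cring) cring_of_injective:
  assumes inj: "inj_on h (carrier S)" and h: "\<And>a. a \<in> carrier S \<Longrightarrow> h a \<in> carrier R"
    and zero: "\<zero>\<^bsub>S\<^esub> \<in> carrier S" "h \<zero>\<^bsub>S\<^esub> = \<zero>" and one: "\<one>\<^bsub>S\<^esub> \<in> carrier S" "h \<one>\<^bsub>S\<^esub> = \<one>"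
    and add: "\<And>a b. a \<in> carrier S \<Longrightarrow> b \<in> carrier S \<Longrightarrow> a \<oplus>\<^bsub>S\<^esub> b \<in> carrier S"
      "\<And>a b. a \<in> carrier S \<Longrightarrow> b \<in> carrier S \<Longrightarrow> h (a \<oplus>\<^bsub>S\<^esub> b) = h a \<oplus> h b"
    and mult: "\<And>a b. a \<in> carrier S \<Longrightarrow> b \<in> carrier S \<Longrightarrow> a \<otimes>\<^bsub>S\<^esub> b \<in> carrier S"
      "\<And>a b. a \<in> carrier S \<Longrightarrow> b \<in> carrier S \<Longrightarrow> h (a \<otimes>\<^bsub>S\<^esub> b) = h a \<otimes> h b"
    and neg: "\<And>a. a \<in> carrier S \<Longrightarrow> \<exists>b\<in>carrier S. b \<oplus>\<^bsub>S\<^esub> a = \<zero>\<^bsub>S\<^esub>"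
  shows "cring S"
proof -
  have eqI: "a = b" if "a \<in> carrier S" "b \<in> carrier S" "h a = h b" for a b
    using inj that by (auto dest: inj_onD)
  note simps = h zero one add mult
  show ?thesis
  proof (rule cringI)
    show "abelian_group S"
      by (rule abelian_groupI; (rule eqI)?) (simp_all add: simps a_ac neg)
    show "comm_monoid S"
      by (rule comm_monoidI; (rule eqI)?) (simp_all add: simps m_ac)
    show "(a \<oplus>\<^bsub>S\<^esub> b) \<otimes>\<^bsub>S\<^esub> c = a \<otimes>\<^bsub>S\<^esub> c \<oplus>\<^bsub>S\<^esub> b \<otimes>\<^bsub>S\<^esub> c"
      if "a \<in> carrier S" "b \<in> carrier S" "c \<in> carrier S" for a b c
      using that by (intro eqI) (simp_all add: simps l_distr)
  qed
qed

locale graded_quotient = cring A for A (structure) +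
  fixes N L :: "nat \<Rightarrow> 'a set"
  assumes N_ideal: "\<And>n. ideal (N n) A" and L_ideal: "\<And>n. ideal (L n) A"
    and L_subset_N: "\<And>n. L n \<subseteq> N n" and one_in_N: "\<one> \<in> N 0"
    and N_mult: "\<And>i j a b. a \<in> N i \<Longrightarrow> b \<in> N j \<Longrightarrow> a \<otimes> b \<in> N (i + j)"
    and L_mult: "\<And>i j a b. a \<in> N i \<Longrightarrow> b \<in> L j \<Longrightarrow> a \<otimes> b \<in> L (i + j)"
begin

abbreviation G where "G \<equiv> graded_quot_ring A N L"

text \<open>All computations in a graded quotient ring are made with families of representatives \<open>a n \<in> N n\<close>,
so that no cosets occur in them.\<close>

definition from_reps :: "(nat \<Rightarrow> 'a) \<Rightarrow> nat \<Rightarrow> 'a set"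
  where "from_reps a = (\<lambda>n. L n +> a n)"

definition single :: "nat \<Rightarrow> 'a \<Rightarrow> nat \<Rightarrow> 'a"
  where "single d a = (\<lambda>n. if n = d then a else \<zero>)"

definition homog_elem :: "nat \<Rightarrow> 'a \<Rightarrow> nat \<Rightarrow> 'a set"
  where "homog_elem d a = from_reps (single d a)"

lemma N_closed [simp]: "a \<in> N n \<Longrightarrow> a \<in> carrier A"
  by (rule ideal.Icarr[OF N_ideal])

lemma L_closed [simp]: "a \<in> L n \<Longrightarrow> a \<in> carrier A"
  by (rule ideal.Icarr[OF L_ideal])

lemma N_zero [simp]: "\<zero> \<in> N n"
  by (rule additive_subgroup.zero_closed[OF ideal.axioms(1)[OF N_ideal]])

lemma L_zero [simp]: "\<zero> \<in> L n"
  by (rule additive_subgroup.zero_closed[OF ideal.axioms(1)[OF L_ideal]])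

lemma N_add: "a \<in> N n \<Longrightarrow> b \<in> N n \<Longrightarrow> a \<oplus> b \<in> N n"
  by (rule additive_subgroup.a_closed[OF ideal.axioms(1)[OF N_ideal]])

lemma N_neg: "a \<in> N n \<Longrightarrow> \<ominus> a \<in> N n"
  by (rule additive_subgroup.a_inv_closed[OF ideal.axioms(1)[OF N_ideal]])

lemma coset_eq_iff: "a \<in> carrier A \<Longrightarrow> b \<in> carrier A \<Longrightarrow> L n +> a = L n +> b \<longleftrightarrow> a \<ominus> b \<in> L n"
  using quotient_eq_iff_same_a_r_cos[OF L_ideal] by blast

lemma coset_eq_L_iff: "a \<in> carrier A \<Longrightarrow> L n +> a = L n \<longleftrightarrow> a \<in> L n"
  using coset_eq_iff[of a \<zero> n] by (simp add: ideal.Icarr[OF L_ideal] a_minus_def subset_iff)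

lemma coset_zero: "L n +> \<zero> = L n"
  using coset_eq_L_iff[of \<zero> n] by simp

lemma G_carrier:
  "g \<in> carrier G \<longleftrightarrow> (\<exists>a. (\<forall>n. a n \<in> N n) \<and> finite {n. a n \<notin> L n} \<and> g = from_reps a)"
proof
  assume "g \<in> carrier G"
  then have "\<forall>n. \<exists>a. a \<in> N n \<and> g n = L n +> a" and fin: "finite {n. g n \<noteq> L n}"
    unfolding graded_quot_ring_def by auto
  then obtain a where a: "\<And>n. a n \<in> N n" "\<And>n. g n = L n +> a n" by metis
  have "g n \<noteq> L n \<longleftrightarrow> a n \<notin> L n" for n using a coset_eq_L_iff[OF N_closed[OF a(1)]] by simp
  then show "\<exists>a. (\<forall>n. a n \<in> N n) \<and> finite {n. a n \<notin> L n} \<and> g = from_reps a"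
    using a fin by (intro exI[of _ a]) (auto simp: from_reps_def)
next
  assume "\<exists>a. (\<forall>n. a n \<in> N n) \<and> finite {n. a n \<notin> L n} \<and> g = from_reps a"
  then obtain a where a: "\<And>n. a n \<in> N n" "finite {n. a n \<notin> L n}" "g = from_reps a" by blast
  have "g n \<noteq> L n \<longleftrightarrow> a n \<notin> L n" for n using a coset_eq_L_iff[OF N_closed[OF a(1)]] by (simp add: from_reps_def)
  then show "g \<in> carrier G" unfolding graded_quot_ring_def using a(1,2)
    by (auto simp: a(3) from_reps_def)
qed

lemma from_reps_carrier: "(\<And>n. a n \<in> N n) \<Longrightarrow> finite {n. a n \<notin> L n} \<Longrightarrow> from_reps a \<in> carrier G"
  unfolding G_carrier by blast

lemma from_reps_eq_iff:
  assumes "\<And>n. a n \<in> N n" "\<And>n. b n \<in> N n"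
  shows "from_reps a = from_reps b \<longleftrightarrow> (\<forall>n. a n \<ominus> b n \<in> L n)"
  using coset_eq_iff[OF N_closed[OF assms(1)] N_closed[OF assms(2)]]
  by (simp add: from_reps_def fun_eq_iff)

lemma G_zero: "\<zero>\<^bsub>G\<^esub> = L"
  by (simp add: graded_quot_ring_def)

lemma G_zero_reps: "\<zero>\<^bsub>G\<^esub> = from_reps (\<lambda>n. \<zero>)"
  by (simp add: graded_quot_ring_def from_reps_def coset_zero)

lemma single_in_N: "a \<in> N d \<Longrightarrow> single d a n \<in> N n"
  by (simp add: single_def)

lemma G_one_reps: "\<one>\<^bsub>G\<^esub> = from_reps (single 0 \<one>)"
  by (auto simp: graded_quot_ring_def from_reps_def single_def coset_zero fun_eq_iff)

lemma add_reps:
  assumes "\<And>n. a n \<in> N n" "\<And>n. b n \<in> N n"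
  shows "from_reps a \<oplus>\<^bsub>G\<^esub> from_reps b = from_reps (\<lambda>n. a n \<oplus> b n)"
  using abelian_subgroup.a_rcos_sum[OF ideal.axioms(1)[OF L_ideal, THEN abelian_subgroupI3, OF abelian_group_axioms]
    N_closed[OF assms(1)] N_closed[OF assms(2)]]
  by (simp add: graded_quot_ring_def from_reps_def FactRing_def)

lemma rcoset_mult_reps:
  assumes a: "a \<in> N i" and b: "b \<in> N j"
  shows "rcoset_mult A (L (i + j)) (L i +> a) (L j +> b) = L (i + j) +> (a \<otimes> b)"
proof -
  have "L (i + j) +> (u \<otimes> v) = L (i + j) +> (a \<otimes> b)" if u: "u \<in> L i +> a" and v: "v \<in> L j +> b" for u v
  proof -
    obtain l where l: "l \<in> L i" "u = l \<oplus> a" using u unfolding a_r_coset_def' by blast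
    obtain k where k: "k \<in> L j" "v = k \<oplus> b" using v unfolding a_r_coset_def' by blast
    have c: "l \<in> carrier A" "k \<in> carrier A" "a \<in> carrier A" "b \<in> carrier A" using l k a b by auto
    have "u \<otimes> v = (u \<otimes> k \<oplus> b \<otimes> l) \<oplus> a \<otimes> b" using c by (simp add: l k l_distr r_distr m_ac a_ac)
    moreover have "u \<otimes> k \<in> L (i + j)"
      using L_mult[of u i k j] N_add[of l i a] l k a L_subset_N by blast
    moreover have "b \<otimes> l \<in> L (i + j)" using L_mult[OF b l(1)] by (simp add: add.commute)
    ultimately have "u \<otimes> v \<in> L (i + j) +> (a \<otimes> b)"
      unfolding a_r_coset_def' using additive_subgroup.a_closed[OF ideal.axioms(1)[OF L_ideal]] by blast
    then show ?thesis using c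
      by (metis a_repr_independence ideal.axioms(1)[OF L_ideal] additive_subgroup.a_subgroup m_closed)
  qed
  moreover have "a \<in> L i +> a" "b \<in> L j +> b"
    unfolding a_r_coset_def' using a b by (auto intro!: bexI[of _ \<zero>])
  ultimately show ?thesis unfolding rcoset_mult_def by blast
qed

lemma mult_reps:
  assumes a: "\<And>n. a n \<in> N n" and b: "\<And>n. b n \<in> N n"
  shows "from_reps a \<otimes>\<^bsub>G\<^esub> from_reps b = from_reps (\<lambda>n. \<Oplus>i\<in>{..n}. a i \<otimes> b (n - i))"
proof
  fix n
  note c = N_closed[OF a] N_closed[OF b]
  interpret Q: ring_hom_cring A "A Quot L n" "(+>) (L n)"
    by (rule ideal.rcos_ring_hom_cring[OF L_ideal is_cring])
  have "(from_reps a \<otimes>\<^bsub>G\<^esub> from_reps b) n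
      = (\<Oplus>\<^bsub>A Quot L n\<^esub>i\<in>{..n}. rcoset_mult A (L n) (L i +> a i) (L (n - i) +> b (n - i)))"
    by (simp add: graded_quot_ring_def from_reps_def)
  also have "\<dots> = (\<Oplus>\<^bsub>A Quot L n\<^esub>i\<in>{..n}. L n +> (a i \<otimes> b (n - i)))"
  proof (rule Q.S.finsum_cong')
    show "rcoset_mult A (L n) (L i +> a i) (L (n - i) +> b (n - i)) = L n +> (a i \<otimes> b (n - i))" if "i \<in> {..n}" for i
      using rcoset_mult_reps[OF a[of i] b[of "n - i"]] that by simp
  qed (auto simp: c)
  also have "\<dots> = L n +> (\<Oplus>i\<in>{..n}. a i \<otimes> b (n - i))"
    by (subst Q.hom_finsum) (auto simp: o_def c)
  finally show "(from_reps a \<otimes>\<^bsub>G\<^esub> from_reps b) n = from_reps (\<lambda>n. \<Oplus>i\<in>{..n}. a i \<otimes> b (n - i)) n"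
    by (simp add: from_reps_def)
qed

lemma mult_reps_in_N:
  assumes a: "\<And>n. a n \<in> N n" and b: "\<And>n. b n \<in> N n"
  shows "(\<Oplus>i\<in>{..n}. a i \<otimes> b (n - i)) \<in> N n"
  using finsum_in_ideal[OF N_ideal, of "{..n}" "\<lambda>i. a i \<otimes> b (n - i)" n] N_mult[OF a b]
  by (metis atMost_iff finite_atMost le_add_diff_inverse)

text \<open>A product of elements with components in finitely many degrees \<open>i\<close> and \<open>j\<close> lives in the degrees \<open>i + j\<close>.\<close>

lemma mult_reps_finite:
  assumes a: "\<And>n. a n \<in> N n" and b: "\<And>n. b n \<in> N n" and fin: "finite {n. a n \<notin> L n}" "finite {n. b n \<notin> L n}"
  shows "finite {n. (\<Oplus>i\<in>{..n}. a i \<otimes> b (n - i)) \<notin> L n}"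
proof (rule finite_subset)
  show "{n. (\<Oplus>i\<in>{..n}. a i \<otimes> b (n - i)) \<notin> L n}
    \<subseteq> (\<lambda>(i, j). i + j) ` ({n. a n \<notin> L n} \<times> {n. b n \<notin> L n})"
  proof
    fix n assume n: "n \<in> {n. (\<Oplus>i\<in>{..n}. a i \<otimes> b (n - i)) \<notin> L n}"
    have "\<exists>i\<le>n. a i \<otimes> b (n - i) \<notin> L n"
      using finsum_in_ideal[OF L_ideal, of "{..n}" "\<lambda>i. a i \<otimes> b (n - i)" n] n by auto
    then obtain i where i: "i \<le> n" "a i \<otimes> b (n - i) \<notin> L n" by blast
    have "b (n - i) \<notin> L (n - i)" using L_mult[OF a, of "b (n - i)" "n - i" i] i by auto
    moreover have "a i \<notin> L i"
    proof
      assume "a i \<in> L i"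
      then have "b (n - i) \<otimes> a i \<in> L n" using L_mult[OF b, of "a i" i "n - i"] i(1) by simp
      then show False using i(2) m_comm[OF N_closed[OF a] N_closed[OF b], of i "n - i"] by simp
    qed
    ultimately show "n \<in> (\<lambda>(i, j). i + j) ` ({n. a n \<notin> L n} \<times> {n. b n \<notin> L n})"
      using i(1) by (intro image_eqI[of _ _ "(i, n - i)"]) auto
  qed
qed (use fin in auto)

lemma G_mult_closed: "g \<in> carrier G \<Longrightarrow> h \<in> carrier G \<Longrightarrow> g \<otimes>\<^bsub>G\<^esub> h \<in> carrier G"
  unfolding G_carrier
proof (elim exE conjE)
  fix a b assume a: "\<forall>n. a n \<in> N n" "finite {n. a n \<notin> L n}" and b: "\<forall>n. b n \<in> N n" "finite {n. b n \<notin> L n}"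
    and gh: "g = from_reps a" "h = from_reps b"
  then show "\<exists>c. (\<forall>n. c n \<in> N n) \<and> finite {n. c n \<notin> L n} \<and> g \<otimes>\<^bsub>G\<^esub> h = from_reps c"
    using mult_reps[of a b] mult_reps_finite[of a b] mult_reps_in_N[of a b]
    by (intro exI[of _ "\<lambda>n. \<Oplus>i\<in>{..n}. a i \<otimes> b (n - i)"]) simp
qed

lemma G_add_closed:
  assumes "g \<in> carrier G" "h \<in> carrier G" shows "g \<oplus>\<^bsub>G\<^esub> h \<in> carrier G"
proof -
  obtain a where a: "\<And>n. a n \<in> N n" "finite {n. a n \<notin> L n}" "g = from_reps a" using assms(1) G_carrier by blast
  obtain b where b: "\<And>n. b n \<in> N n" "finite {n. b n \<notin> L n}" "h = from_reps b" using assms(2) G_carrier by blast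
  have "finite {n. a n \<oplus> b n \<notin> L n}"
    by (rule finite_subset[OF _ finite_UnI[OF a(2) b(2)]])
      (use additive_subgroup.a_closed[OF ideal.axioms(1)[OF L_ideal]] in auto)
  then show ?thesis unfolding a(3) b(3) add_reps[OF a(1) b(1)]
    by (intro from_reps_carrier N_add a b)
qed

lemma single_carrier: "a \<in> N d \<Longrightarrow> homog_elem d a \<in> carrier G"
  unfolding homog_elem_def
  by (rule from_reps_carrier[OF single_in_N], assumption)
    (rule finite_subset[of _ "{d}"], auto simp: single_def)

lemma G_zero_carrier: "\<zero>\<^bsub>G\<^esub> \<in> carrier G"
  unfolding G_zero_reps by (rule from_reps_carrier) auto

lemma G_one_carrier: "\<one>\<^bsub>G\<^esub> \<in> carrier G"
  unfolding G_one_reps homog_elem_def[symmetric] by (rule single_carrier[OF one_in_N])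

lemma G_neg:
  assumes "g \<in> carrier G" shows "\<exists>h\<in>carrier G. h \<oplus>\<^bsub>G\<^esub> g = \<zero>\<^bsub>G\<^esub>"
proof -
  obtain a where a: "\<And>n. a n \<in> N n" "finite {n. a n \<notin> L n}" "g = from_reps a" using assms(1) G_carrier by blast
  have "finite {n. \<ominus> a n \<notin> L n}"
    by (rule finite_subset[OF _ a(2)])
      (use additive_subgroup.a_inv_closed[OF ideal.axioms(1)[OF L_ideal]] in auto)
  then have "from_reps (\<lambda>n. \<ominus> a n) \<in> carrier G" by (intro from_reps_carrier N_neg a)
  moreover have "from_reps (\<lambda>n. \<ominus> a n) \<oplus>\<^bsub>G\<^esub> g = \<zero>\<^bsub>G\<^esub>"
    unfolding a(3) G_zero_reps
    by (subst add_reps[OF N_neg[OF a(1)] a(1)]) (simp add: l_neg[OF N_closed[OF a(1)]])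
  ultimately show ?thesis by blast
qed

lemma homog_elem_mult_reps:
  assumes a: "a \<in> N d" and b: "\<And>n. b n \<in> N n"
  shows "homog_elem d a \<otimes>\<^bsub>G\<^esub> from_reps b = from_reps (\<lambda>n. if d \<le> n then a \<otimes> b (n - d) else \<zero>)"
proof -
  have "(\<Oplus>i\<in>{..n}. single d a i \<otimes> b (n - i)) = (if d \<le> n then a \<otimes> b (n - d) else \<zero>)" for n
  proof -
    have "(\<Oplus>i\<in>{..n}. single d a i \<otimes> b (n - i)) = (\<Oplus>i\<in>{..n}. if d = i then a \<otimes> b (n - i) else \<zero>)"
      using N_closed[OF a] N_closed[OF b] by (intro finsum_cong') (auto simp: single_def)
    also have "\<dots> = (if d \<le> n then a \<otimes> b (n - d) else \<zero>)"
    proof (cases "d \<le> n")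
      case True
      then show ?thesis using N_closed[OF a] N_closed[OF b] by (subst finsum_singleton) auto
    next
      case False
      then have "(\<Oplus>i\<in>{..n}. if d = i then a \<otimes> b (n - i) else \<zero>) = (\<Oplus>i\<in>{..n}. \<zero>)"
        by (intro finsum_cong') auto
      then show ?thesis using False by simp
    qed
    finally show ?thesis .
  qed
  then show ?thesis unfolding homog_elem_def using mult_reps[OF single_in_N[OF a] b] by simp
qed

lemma homog_elem_mult:
  assumes a: "a \<in> N d" and b: "b \<in> N e"
  shows "homog_elem d a \<otimes>\<^bsub>G\<^esub> homog_elem e b = homog_elem (d + e) (a \<otimes> b)"
proof -
  have "homog_elem d a \<otimes>\<^bsub>G\<^esub> homog_elem e b = from_reps (\<lambda>n. if d \<le> n then a \<otimes> single e b (n - d) else \<zero>)"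
    unfolding homog_elem_def[of e] by (rule homog_elem_mult_reps[OF a single_in_N[OF b]])
  also have "(\<lambda>n. if d \<le> n then a \<otimes> single e b (n - d) else \<zero>) = single (d + e) (a \<otimes> b)"
    using a by (auto simp: single_def fun_eq_iff)
  finally show ?thesis by (simp add: homog_elem_def)
qed

lemma homog_elem_add:
  assumes a: "a \<in> N d" and b: "b \<in> N d"
  shows "homog_elem d a \<oplus>\<^bsub>G\<^esub> homog_elem d b = homog_elem d (a \<oplus> b)"
  unfolding homog_elem_def using add_reps[OF single_in_N[OF a] single_in_N[OF b]]
  by (auto simp: single_def intro!: arg_cong[where f=from_reps])

lemma homog_elem_pow:
  assumes a: "a \<in> N 1" shows "homog_elem 1 a [^]\<^bsub>G\<^esub> (k::nat) = homog_elem k (a [^] k) \<and> a [^] k \<in> N k"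
proof (induction k)
  case 0
  show ?case using one_in_N by (simp add: G_one_reps homog_elem_def)
next
  case (Suc k)
  then show ?case using homog_elem_mult[of "a [^] k" k a 1] N_mult[of "a [^] k" k a 1] a by simp
qed

lemma homog_elem_eq_iff:
  assumes a: "a \<in> N d" and b: "b \<in> N d"
  shows "homog_elem d a = homog_elem d b \<longleftrightarrow> a \<ominus> b \<in> L d"
  unfolding homog_elem_def from_reps_eq_iff[OF single_in_N[OF a] single_in_N[OF b]]
  by (auto simp: single_def a_minus_def r_neg)

lemma homog_elem_zero: "homog_elem d \<zero> = \<zero>\<^bsub>G\<^esub>"
  by (simp add: homog_elem_def G_zero_reps single_def)

lemma homog_elem_eq_zero_iff: "a \<in> N d \<Longrightarrow> homog_elem d a = \<zero>\<^bsub>G\<^esub> \<longleftrightarrow> a \<in> L d"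
  using homog_elem_eq_iff[of a d \<zero>] by (simp add: homog_elem_zero a_minus_def)

lemma graded_part_eq: "graded_part G d = homog_elem d ` N d"
proof
  show "graded_part G d \<subseteq> homog_elem d ` N d"
  proof
    fix g assume g: "g \<in> graded_part G d"
    then obtain a where a: "\<And>n. a n \<in> N n" "g = from_reps a" unfolding graded_part_def G_carrier by blast
    have "g = homog_elem d (a d)"
    proof
      fix n show "g n = homog_elem d (a d) n"
        using g a by (auto simp: graded_part_def G_zero homog_elem_def from_reps_def single_def coset_zero)
    qed
    then show "g \<in> homog_elem d ` N d" using a by blast
  qed
  show "homog_elem d ` N d \<subseteq> graded_part G d"
    using single_carrier by (auto simp: graded_part_def G_zero homog_elem_def from_reps_def single_def coset_zero)
qed

end

section \<open>Primes and depth\<close>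

lemma (in cring) genideal_empty: "Idl {} = {\<zero>}"
proof
  show "Idl {} \<subseteq> {\<zero>}" by (rule genideal_minimal[OF zeroideal]) simp
  show "{\<zero>} \<subseteq> Idl {}"
    using additive_subgroup.zero_closed[OF ideal.axioms(1)[OF genideal_ideal[of "{}"]]] by simp
qed

text \<open>A regular sequence begins with a regular element of \<open>R / 0\<close>.\<close>

lemma (in cring) regular_element_of_depth:
  assumes "1 \<le> depth R I" shows "\<exists>y\<in>I. y \<in> regular_elements R"
proof -
  have "\<exists>xs. set xs \<subseteq> I \<and> regular_sequence R xs \<and> xs \<noteq> []"
  proof (rule ccontr)
    assume "\<not> ?thesis"
    then have "depth R I \<le> 0" unfolding depth_def by (intro Sup_least) (auto simp: zero_enat_def)
    with assms show False by simp
  qed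
  then obtain y ys where y: "y \<in> I" and reg: "regular_sequence R (y # ys)"
    by (metis list.set_intros(1) neq_Nil_conv subsetD)
  have yc: "y \<in> carrier R" using reg by (simp add: regular_sequence_def)
  let ?Z = "{\<zero>}"
  have "(Idl (set (take 0 (y # ys)))) +> ((y # ys) ! 0) \<in> regular_elements (R Quot (Idl (set (take 0 (y # ys)))))"
    using reg unfolding regular_sequence_def by blast
  then have r: "?Z +> y \<in> regular_elements (R Quot ?Z)" by (simp add: genideal_empty)
  interpret Z: ideal ?Z R by (rule zeroideal)
  have "a = \<zero>" if a: "a \<in> carrier R" "y \<otimes> a = \<zero>" for a
  proof -
    have "(?Z +> y) \<otimes>\<^bsub>R Quot ?Z\<^esub> (?Z +> a) = ?Z +> \<zero>"
      using ring_hom_mult[OF Z.rcos_ring_hom yc a(1)] a(2) by simp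
    moreover have "?Z +> \<zero> = \<zero>\<^bsub>R Quot ?Z\<^esub>" by (simp add: FactRing_def a_r_coset_def')
    moreover have "?Z +> a \<in> carrier (R Quot ?Z)" using ring_hom_closed[OF Z.rcos_ring_hom a(1)] .
    ultimately have "?Z +> a = \<zero>\<^bsub>R Quot ?Z\<^esub>" using r unfolding regular_elements_def by simp
    then have "{a} = {\<zero>}" using a(1) by (simp add: FactRing_def a_r_coset_def')
    then show ?thesis by simp
  qed
  then have "y \<in> regular_elements R" using yc unfolding regular_elements_def by blast
  then show ?thesis using y by blast
qed

text \<open>An ideal maximal among those that contain no power of \<open>f\<close> is prime: if neither \<open>a\<close> nor \<open>b\<close> belongs to
it, adjoining either of them produces a power of \<open>f\<close>, and the product of the two powers shows that
\<open>a b\<close> does not belong to it.\<close>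

lemma (in cring) prime_avoiding_powers:
  assumes "noetherian_ring R" and f: "f \<in> carrier R"
    and nz: "\<And>n::nat. f [^] n \<noteq> \<zero>"
  shows "\<exists>P. primeideal P R \<and> f \<notin> P"
proof -
  interpret noetherian_ring R by fact
  let ?S = "{J. ideal J R \<and> (\<forall>n::nat. f [^] n \<notin> J)}"
  have "\<exists>P\<in>?S. \<forall>J\<in>?S. P \<subseteq> J \<longrightarrow> J = P"
  proof (rule exists_maximal_ideal_in)
    have "{\<zero>} \<in> ?S" using zeroideal nz by simp
    then show "?S \<noteq> {}" by blast
  qed auto
  then obtain P where P: "ideal P R" "\<And>n::nat. f [^] n \<notin> P"
    and max: "\<And>J. ideal J R \<Longrightarrow> (\<And>n::nat. f [^] n \<notin> J) \<Longrightarrow> P \<subseteq> J \<Longrightarrow> J = P"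
    by simp metis
  interpret P: ideal P R by (rule P(1))
  have meets: "\<exists>n::nat. \<exists>p\<in>P. \<exists>c\<in>carrier R. f [^] n = p \<oplus> c \<otimes> a" if a: "a \<in> carrier R" "a \<notin> P" for a
  proof -
    let ?J = "P <+>\<^bsub>R\<^esub> PIdl a"
    note I = cgenideal_ideal[OF a(1)]
    have "?J \<noteq> P" using ideal_add_upper2[OF P(1) I] cgenideal_self[OF a(1)] a(2) by blast
    then obtain n :: nat where "f [^] n \<in> ?J"
      using max[OF add_ideals[OF P(1) I]] ideal_add_upper1[OF P(1) I] by blast
    then show ?thesis unfolding mem_set_add_iff cgenideal_def by blast
  qed
  have "primeideal P R"
  proof (rule primeidealI[OF P(1)])
    show "cring R" by (rule is_cring)
    show "carrier R \<noteq> P" using P(2)[of 0] one_closed by auto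
    fix a b assume a: "a \<in> carrier R" and b: "b \<in> carrier R" and ab: "a \<otimes> b \<in> P"
    show "a \<in> P \<or> b \<in> P"
    proof (rule ccontr)
      assume "\<not> (a \<in> P \<or> b \<in> P)"
      then obtain n m :: nat and p c q d where
        p: "p \<in> P" "c \<in> carrier R" "f [^] n = p \<oplus> c \<otimes> a" and
        q: "q \<in> P" "d \<in> carrier R" "f [^] m = q \<oplus> d \<otimes> b" using meets[OF a] meets[OF b] by metis
      have pc: "p \<in> carrier R" "q \<in> carrier R" using p(1) q(1) P.Icarr by auto
      have "f [^] (n + m) = (p \<oplus> c \<otimes> a) \<otimes> (q \<oplus> d \<otimes> b)"
        using f p(3) q(3) by (simp add: nat_pow_mult[symmetric])
      also have "\<dots> = (q \<oplus> d \<otimes> b) \<otimes> p \<oplus> ((c \<otimes> a) \<otimes> q \<oplus> (c \<otimes> d) \<otimes> (a \<otimes> b))"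
        using pc p(2) q(2) a b by (simp add: l_distr r_distr m_ac a_ac)
      also have "\<dots> \<in> P"
      proof (intro P.a_closed)
        show "(q \<oplus> d \<otimes> b) \<otimes> p \<in> P" by (rule P.I_l_closed[OF p(1)]) (use q b pc in simp)
        show "(c \<otimes> a) \<otimes> q \<in> P" by (rule P.I_l_closed[OF q(1)]) (use p a in simp)
        show "(c \<otimes> d) \<otimes> (a \<otimes> b) \<in> P" by (rule P.I_l_closed[OF ab]) (use p q in simp)
      qed
      finally show False using P(2) by blast
    qed
  qed
  then show ?thesis using P(2)[of 1] f by (intro exI[of _ P]) simp
qed

section \<open>Powers of the maximal ideal and the reduction\<close>

locale local_ring_reduction = noetherian_local_ring A \<mm> for A (structure) and \<mm> +
  fixes x
  assumes x_in_max: "x \<in> \<mm>" and x_regular: "x \<in> regular_elements A"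
    and reduction: "minimal_reduction A \<mm> x"
begin

definition mpow :: "nat \<Rightarrow> 'a set" where "mpow n = ideal_pow A \<mm> n"
abbreviation red :: nat where "red \<equiv> reduction_number A \<mm> x"

lemma x_carrier [simp]: "x \<in> carrier A"
  using x_regular by (simp add: regular_elements_def)

lemma x_pow_regular: "x [^] (n::nat) \<in> regular_elements A"
  by (rule multiplicative_set.pow_mem[OF multiplicative_set_regular x_regular])

lemma x_pow_carrier [simp]: "x [^] (n::nat) \<in> carrier A"
  by simp

lemma mpow_ideal: "ideal (mpow n) A"
  unfolding mpow_def by (rule ideal_pow_ideal[OF ideal_max])

lemma mpow_closed: "a \<in> mpow n \<Longrightarrow> a \<in> carrier A"
  by (rule ideal.Icarr[OF mpow_ideal])

lemma mpow_add: "a \<in> mpow n \<Longrightarrow> b \<in> mpow n \<Longrightarrow> a \<oplus> b \<in> mpow n"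
  by (rule additive_subgroup.a_closed[OF ideal.axioms(1)[OF mpow_ideal]])

lemma mpow_mult: "a \<in> mpow i \<Longrightarrow> b \<in> mpow j \<Longrightarrow> a \<otimes> b \<in> mpow (i + j)"
  unfolding mpow_def by (rule ideal_pow_mult_closed[OF ideal_max])

lemma mpow_antimono: "i \<le> j \<Longrightarrow> mpow j \<subseteq> mpow i"
  unfolding mpow_def by (rule ideal_pow_antimono[OF ideal_max])

lemma mpow_one: "mpow (Suc 0) = \<mm>"
  unfolding mpow_def by (rule ideal_pow_1[OF ideal_max])

lemma mpow_zero: "mpow 0 = carrier A"
  unfolding mpow_def by (rule ideal_pow_0)

lemma max_mult_mpow: "c \<in> \<mm> \<Longrightarrow> b \<in> mpow n \<Longrightarrow> c \<otimes> b \<in> mpow (Suc n)"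
  using mpow_mult[of c "Suc 0" b n] by (simp add: mpow_one)

lemma mpow_Suc: "mpow (Suc n) = \<mm> \<cdot> mpow n"
  using ideal_prod_commute[OF mpow_ideal ideal_max] unfolding mpow_def ideal_pow_Suc .

lemma x_pow_in_mpow: "x [^] n \<in> mpow n"
  unfolding mpow_def by (rule ideal_pow_pow_closed[OF ideal_max x_in_max])

lemma x_pow_mult_mpow: "a \<in> mpow n \<Longrightarrow> x [^] k \<otimes> a \<in> mpow (k + n)"
  by (rule mpow_mult[OF x_pow_in_mpow])

lemma mpow_Suc_red: "mpow (Suc red) = x <# mpow red"
proof -
  obtain n where "ideal_pow A \<mm> (n + 1) = x <# ideal_pow A \<mm> n"
    using reduction unfolding minimal_reduction_def by blast
  then show ?thesis unfolding reduction_number_def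
    using LeastI[of "\<lambda>n. ideal_pow A \<mm> (n + 1) = x <# ideal_pow A \<mm> n" n] by (simp add: mpow_def)
qed

lemma red_le: "mpow (Suc n) = x <# mpow n \<Longrightarrow> red \<le> n"
  unfolding reduction_number_def by (rule Least_le) (simp add: mpow_def)

lemma mpow_Suc_ge: "red \<le> k \<Longrightarrow> mpow (Suc k) = x <# mpow k"
proof (induction k rule: nat_induct_at_least)
  case base
  show ?case by (rule mpow_Suc_red)
next
  case (Suc k)
  show ?case
  proof
    show "x <# mpow (Suc k) \<subseteq> mpow (Suc (Suc k))"
      using max_mult_mpow[OF x_in_max] by (auto simp: l_coset_def)
    show "mpow (Suc (Suc k)) \<subseteq> x <# mpow (Suc k)"
      unfolding mpow_Suc[of "Suc k"]
    proof (rule ideal_prod_subset[OF ideal_l_coset[OF x_carrier mpow_ideal]])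
      fix c b assume c: "c \<in> \<mm>" and "b \<in> mpow (Suc k)"
      then obtain b' where b': "b' \<in> mpow k" "b = x \<otimes> b'" unfolding Suc.IH l_coset_def by blast
      have "c \<otimes> b = x \<otimes> (c \<otimes> b')"
        using b' c mpow_closed[OF b'(1)] ideal.Icarr[OF ideal_max c] by (simp add: m_lcomm)
      moreover have "c \<otimes> b' \<in> mpow (Suc k)" by (rule max_mult_mpow[OF c b'(1)])
      ultimately show "c \<otimes> b \<in> x <# mpow (Suc k)" unfolding l_coset_def by blast
    qed
  qed
qed

lemma mpow_red_add: "b \<in> mpow (red + n) \<Longrightarrow> \<exists>c\<in>mpow red. b = x [^] n \<otimes> c"
proof (induction n arbitrary: b)
  case 0
  then show ?case by (intro bexI[of _ b]) (auto simp: mpow_closed)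
next
  case (Suc n)
  then have "b \<in> x <# mpow (red + n)" using mpow_Suc_ge[of "red + n"] by simp
  then obtain b' where b': "b' \<in> mpow (red + n)" "b = x \<otimes> b'" unfolding l_coset_def by blast
  then obtain c where c: "c \<in> mpow red" "b' = x [^] n \<otimes> c" using Suc.IH by blast
  have "b = x [^] Suc n \<otimes> c" using b' c mpow_closed[OF c(1)] by (simp add: m_ac)
  then show ?case using c(1) by blast
qed

text \<open>Otherwise \<open>\<mm>\<^sup>r\<^sup>+\<^sup>n = x\<^sup>n \<mm>\<^sup>r\<close> would be contained in \<open>\<mm>\<^sup>r\<^sup>+\<^sup>n\<^sup>+\<^sup>1\<close> and vanish by Nakayama's lemma, although it
contains a power of the regular element \<open>x\<close>. In the tangent cone this says that \<open>x*\<close> is not nilpotent.\<close>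

lemma x_pow_notin: "x [^] n \<notin> mpow (Suc n)"
proof
  assume x: "x [^] n \<in> mpow (Suc n)"
  let ?I = "mpow (red + n)"
  have "?I \<subseteq> mpow (Suc (red + n))"
  proof
    fix b assume "b \<in> ?I"
    then obtain c where "c \<in> mpow red" "b = x [^] n \<otimes> c" using mpow_red_add by blast
    then show "b \<in> mpow (Suc (red + n))" using mpow_mult[OF x, of c red] by (simp add: add.commute)
  qed
  then have le: "?I \<subseteq> {\<zero>} <+> \<mm> \<cdot> ?I"
    using ideal_add_upper2[OF zeroideal ideal_prod_is_ideal[OF ideal_max mpow_ideal[of "red + n"]]]
    unfolding mpow_Suc by blast
  have "{\<zero>} \<subseteq> ?I" using additive_subgroup.zero_closed[OF ideal.axioms(1)[OF mpow_ideal]] by blast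
  from nakayama[OF mpow_ideal zeroideal this le] have "{\<zero>} = ?I" .
  then have "x [^] (red + n) = \<zero>" using x_pow_in_mpow[of "red + n"] by blast
  then have "x [^] (red + n) \<otimes> \<one> = \<zero>" by simp
  then have "\<one> = \<zero>" using x_pow_regular[of "red + n"] unfolding regular_elements_def by blast
  then show False using one_notin_max by (simp add: additive_subgroup.zero_closed[OF ideal.axioms(1)[OF ideal_max]])
qed

section \<open>Regularity of the initial form\<close>

sublocale T: graded_quotient A mpow "\<lambda>n. mpow (Suc n)"
proof (rule graded_quotient.intro[OF is_cring], rule graded_quotient_axioms.intro, goal_cases)
  case (1 n) show ?case by (rule mpow_ideal)
next
  case (2 n) show ?case by (rule mpow_ideal)
next
  case (3 n) show ?case by (rule mpow_antimono) simp
next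
  case 4 show ?case unfolding mpow_zero by simp
next
  case (5 i j a b) then show ?case by (rule mpow_mult)
next
  case (6 i j a b) from mpow_mult[OF this] show ?case by simp
qed

lemma tangent_cone_eq: "tangent_cone A \<mm> = T.G"
proof -
  have "mpow = ideal_pow A \<mm>" by (rule ext) (rule mpow_def)
  then show ?thesis by (simp add: tangent_cone_def del: nat_pow_Suc)
qed

definition irrelevant :: "(nat \<Rightarrow> 'a set) set"
  where "irrelevant = {g \<in> carrier T.G. g 0 = mpow (Suc 0)}"

lemma from_reps_irrelevant_iff:
  "(\<And>n. a n \<in> mpow n) \<Longrightarrow> T.from_reps a \<in> carrier T.G \<Longrightarrow> T.from_reps a \<in> irrelevant \<longleftrightarrow> a 0 \<in> \<mm>"
  using T.coset_eq_L_iff[of "a 0" 0] mpow_closed[of "a 0" 0]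
  by (simp add: irrelevant_def T.from_reps_def mpow_one)

text \<open>In degree \<open>d\<close> the product is the class of \<open>a\<close> times the degree \<open>0\<close> component of \<open>t\<close>, which is a unit.
This gives the injectivity, on homogeneous elements, of localization at the irrelevant ideal.\<close>

lemma unit_degree_zero_cancel:
  assumes t: "t \<in> carrier T.G" "t \<notin> irrelevant" and a: "a \<in> mpow d"
    and zero: "T.homog_elem d a \<otimes>\<^bsub>T.G\<^esub> t = \<zero>\<^bsub>T.G\<^esub>"
  shows "a \<in> mpow (Suc d)"
proof -
  obtain b where b: "\<And>n. b n \<in> mpow n" "t = T.from_reps b" using t(1) T.G_carrier by blast
  have b0: "b 0 \<notin> \<mm>" using from_reps_irrelevant_iff[OF b(1)] t b(2) by simp
  have ab: "a \<otimes> b 0 \<in> carrier A" using mpow_closed[OF a] mpow_closed[OF b(1)] by simp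
  have "mpow (Suc d) +> (a \<otimes> b 0) = (T.homog_elem d a \<otimes>\<^bsub>T.G\<^esub> t) d"
    unfolding b(2) T.homog_elem_mult_reps[OF a b(1)] by (simp add: T.from_reps_def)
  also have "\<dots> = mpow (Suc d)" unfolding zero T.G_zero ..
  finally have "a \<otimes> b 0 \<in> mpow (Suc d)" using T.coset_eq_L_iff[OF ab, of d] by blast
  then show ?thesis
    using mult_unit_mem[OF mpow_ideal mpow_closed[OF b(1)] b0 mpow_closed[OF a]]
      m_comm[OF mpow_closed[OF a] mpow_closed[OF b(1)[of 0]]] by simp
qed

text \<open>An element outside the irrelevant ideal has a unit in degree \<open>0\<close>, so up to a multiple by that unit and
up to an element of the irrelevant ideal it is \<open>1\<close>.\<close>

lemma irrelevant_maximal: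
  assumes "cring T.G" shows "maximalideal irrelevant T.G"
proof -
  interpret G: cring T.G by fact
  have mult: "g \<otimes>\<^bsub>T.G\<^esub> h \<in> irrelevant" if g: "g \<in> carrier T.G" and h: "h \<in> irrelevant" for g h
  proof -
    obtain a where a: "\<And>n. a n \<in> mpow n" "g = T.from_reps a" using g T.G_carrier by blast
    have hc: "h \<in> carrier T.G" using h by (simp add: irrelevant_def)
    then obtain b where b: "\<And>n. b n \<in> mpow n" "h = T.from_reps b" using T.G_carrier by blast
    have b0: "b 0 \<in> \<mm>" using from_reps_irrelevant_iff[OF b(1)] h hc b(2) by simp
    have c: "a 0 \<in> carrier A" "b 0 \<in> carrier A" using mpow_closed[OF a(1)] mpow_closed[OF b(1)] by auto
    have gh: "g \<otimes>\<^bsub>T.G\<^esub> h = T.from_reps (\<lambda>n. \<Oplus>i\<in>{..n}. a i \<otimes> b (n - i))"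
      unfolding a(2) b(2) by (rule T.mult_reps[OF a(1) b(1)])
    show ?thesis unfolding gh
    proof (subst from_reps_irrelevant_iff)
      show "(\<Oplus>i\<in>{..n}. a i \<otimes> b (n - i)) \<in> mpow n" for n by (rule T.mult_reps_in_N[OF a(1) b(1)])
      show "T.from_reps (\<lambda>n. \<Oplus>i\<in>{..n}. a i \<otimes> b (n - i)) \<in> carrier T.G"
        unfolding gh[symmetric] by (rule T.G_mult_closed[OF g hc])
      have "(\<Oplus>i\<in>{..0::nat}. a i \<otimes> b (0 - i)) = a 0 \<otimes> b 0" using c by simp
      then show "(\<Oplus>i\<in>{..0::nat}. a i \<otimes> b (0 - i)) \<in> \<mm>" using ideal.I_l_closed[OF ideal_max b0 c(1)] by simp
    qed
  qed
  have add: "g \<oplus>\<^bsub>T.G\<^esub> h \<in> irrelevant" if g: "g \<in> irrelevant" and h: "h \<in> irrelevant" for g h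
  proof -
    have gc: "g \<in> carrier T.G" "h \<in> carrier T.G" using g h by (auto simp: irrelevant_def)
    obtain a where a: "\<And>n. a n \<in> mpow n" "g = T.from_reps a" using gc T.G_carrier by blast
    obtain b where b: "\<And>n. b n \<in> mpow n" "h = T.from_reps b" using gc T.G_carrier by blast
    have ab0: "a 0 \<in> \<mm>" "b 0 \<in> \<mm>"
      using from_reps_irrelevant_iff[OF a(1)] from_reps_irrelevant_iff[OF b(1)] g h gc a(2) b(2) by simp_all
    have gh: "g \<oplus>\<^bsub>T.G\<^esub> h = T.from_reps (\<lambda>n. a n \<oplus> b n)"
      unfolding a(2) b(2) by (rule T.add_reps[OF a(1) b(1)])
    show ?thesis unfolding gh
      using ab0 T.G_add_closed[OF gc] a(1) b(1) unfolding gh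
      by (subst from_reps_irrelevant_iff) (auto intro: mpow_add)
  qed
  have "\<zero>\<^bsub>T.G\<^esub> \<in> irrelevant" using T.G_zero_carrier by (simp add: irrelevant_def T.G_zero)
  then have ideal: "ideal irrelevant T.G"
    by (intro G.ideal_of_closed[OF _ _ add mult]) (auto simp: irrelevant_def)
  have one_reps: "T.from_reps (T.single 0 \<one>) = \<one>\<^bsub>T.G\<^esub>" by (simp only: T.G_one_reps)
  have one: "\<one>\<^bsub>T.G\<^esub> \<notin> irrelevant"
    using from_reps_irrelevant_iff[of "T.single 0 \<one>"] one_notin_max T.single_in_N[OF T.one_in_N] T.G_one_carrier
    unfolding one_reps by (simp add: T.single_def)
  show ?thesis
  proof (rule maximalidealI[OF ideal])
    show "carrier T.G \<noteq> irrelevant" using one T.G_one_carrier by blast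
    fix J assume J: "ideal J T.G" "irrelevant \<subseteq> J" "J \<subseteq> carrier T.G"
    show "J = irrelevant \<or> J = carrier T.G"
    proof (cases "J \<subseteq> irrelevant")
      case False
      then obtain g where g: "g \<in> J" "g \<notin> irrelevant" by blast
      have gc: "g \<in> carrier T.G" using g J(3) by blast
      then obtain a where a: "\<And>n. a n \<in> mpow n" "g = T.from_reps a" "finite {n. a n \<notin> mpow (Suc n)}"
        using T.G_carrier by blast
      have a0: "a 0 \<notin> \<mm>" using from_reps_irrelevant_iff[OF a(1)] g gc a(2) by simp
      obtain c where c: "c \<in> carrier A" "c \<otimes> a 0 = \<one>"
        using inverse_of_notin_max[OF mpow_closed[OF a(1)] a0] by blast
      have cN: "c \<in> mpow 0" using c(1) unfolding mpow_zero .
      let ?b = "\<lambda>n. c \<otimes> a n" let ?k = "\<lambda>n. if n = 0 then \<zero> else \<ominus> ?b n"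
      have b: "?b n \<in> mpow n" for n using ideal.I_l_closed[OF mpow_ideal a(1) c(1)] .
      have k: "?k n \<in> mpow n" for n using T.N_neg[OF b] by simp
      have h: "T.homog_elem 0 c \<otimes>\<^bsub>T.G\<^esub> g = T.from_reps ?b"
        unfolding a(2) T.homog_elem_mult_reps[OF cN a(1)] by simp
      have "{n. ?k n \<notin> mpow (Suc n)} \<subseteq> {n. a n \<notin> mpow (Suc n)}"
        using ideal.I_l_closed[OF mpow_ideal _ c(1)]
          additive_subgroup.a_inv_closed[OF ideal.axioms(1)[OF mpow_ideal]] T.L_zero by auto
      then have kc: "T.from_reps ?k \<in> carrier T.G"
        using k finite_subset[OF _ a(3)] by (intro T.from_reps_carrier) auto
      have "T.from_reps ?k \<in> irrelevant"
        using from_reps_irrelevant_iff[OF k kc] additive_subgroup.zero_closed[OF ideal.axioms(1)[OF ideal_max]] by simp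
      then have "T.from_reps ?b \<oplus>\<^bsub>T.G\<^esub> T.from_reps ?k \<in> J"
        using J(2) ideal.I_l_closed[OF J(1) g(1) T.single_carrier[OF cN]] h
          additive_subgroup.a_closed[OF ideal.axioms(1)[OF J(1)]] by auto
      moreover have "T.from_reps ?b \<oplus>\<^bsub>T.G\<^esub> T.from_reps ?k = T.from_reps (\<lambda>n. ?b n \<oplus> ?k n)"
        by (rule T.add_reps[OF b k])
      moreover have "(\<lambda>n. ?b n \<oplus> ?k n) = T.single 0 \<one>"
        using c mpow_closed[OF b] by (auto simp: T.single_def r_neg)
      ultimately have "\<one>\<^bsub>T.G\<^esub> \<in> J" by (simp add: one_reps)
      then show ?thesis using ideal.one_imp_carrier[OF J(1)] by blast
    qed (use J in blast)
  qed
qed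

text \<open>The representative in degree \<open>0\<close> is first replaced by \<open>0\<close>, so that the vanishing below degree \<open>k\<close>
holds for the representatives of the power and not only for their classes.\<close>

lemma irrelevant_pow_reps:
  assumes "cring T.G" "g \<in> irrelevant"
  shows "\<exists>b. (\<forall>n. b n \<in> mpow n) \<and> (\<forall>n<k. b n = \<zero>) \<and> g [^]\<^bsub>T.G\<^esub> (k::nat) = T.from_reps b"
proof -
  interpret G: cring T.G by fact
  have gc: "g \<in> carrier T.G" using assms(2) by (simp add: irrelevant_def)
  then obtain a where a: "\<And>n. a n \<in> mpow n" "g = T.from_reps a" using T.G_carrier by blast
  have a0: "a 0 \<in> \<mm>" using from_reps_irrelevant_iff[OF a(1)] assms(2) gc a(2) by simp
  define a' where "a' = a(0 := \<zero>)"
  have a': "a' n \<in> mpow n" for n using a(1)[of n] T.N_zero[of 0] by (simp add: a'_def)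
  have a'0: "a' 0 = \<zero>" by (simp add: a'_def)
  have "g = T.from_reps a'" unfolding a(2) T.from_reps_eq_iff[OF a(1) a']
    using a0 mpow_closed[OF a(1)] T.L_zero by (auto simp: a'_def a_minus_def r_neg mpow_one)
  note g = this
  show ?thesis
  proof (induction k)
    case 0
    show ?case using T.single_in_N[OF T.one_in_N] by (intro exI[of _ "T.single 0 \<one>"]) (simp add: T.G_one_reps)
  next
    case (Suc k)
    then obtain b where b: "\<And>n. b n \<in> mpow n" "\<And>n. n < k \<Longrightarrow> b n = \<zero>" "g [^]\<^bsub>T.G\<^esub> k = T.from_reps b" by blast
    have c: "b i \<in> carrier A" "a' i \<in> carrier A" for i using mpow_closed[OF b(1)] mpow_closed[OF a'] by auto
    let ?c = "\<lambda>n. \<Oplus>i\<in>{..n}. b i \<otimes> a' (n - i)"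
    have "g [^]\<^bsub>T.G\<^esub> Suc k = T.from_reps ?c"
      using T.mult_reps[OF b(1) a'] b(3) g by simp
    moreover have "?c n \<in> mpow n" for n by (rule T.mult_reps_in_N[OF b(1) a'])
    moreover have "?c n = \<zero>" if "n < Suc k" for n
    proof -
      have "?c n = (\<Oplus>i\<in>{..n}. \<zero>)"
      proof (intro finsum_cong')
        fix i assume "i \<in> {..n}"
        then have "i < k \<or> n - i = 0" using that by auto
        then show "b i \<otimes> a' (n - i) = \<zero>" using b(2)[of i] c a'0 by auto
      qed auto
      then show ?thesis by simp
    qed
    ultimately show ?case by (intro exI[of _ ?c] conjI allI impI)
  qed
qed

text \<open>If \<open>x*\<close> kills the class of \<open>a\<close>, so does a high power of any element of the irrelevant ideal: in degrees
above \<open>r\<close> every representative has the form \<open>x e\<close> with \<open>e \<in> \<mm>\<^sup>k\<close>, and \<open>a x e\<close> lies in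
\<open>\<mm>\<^sup>d\<^sup>+\<^sup>k\<^sup>+\<^sup>2\<close>, so that its class in degree \<open>d + k + 1\<close> is zero.\<close>

lemma irrelevant_pow_kills:
  assumes "cring T.G" "g \<in> irrelevant" and a: "a \<in> mpow d" "x \<otimes> a \<in> mpow (d + 2)"
  shows "T.homog_elem d a \<otimes>\<^bsub>T.G\<^esub> (g [^]\<^bsub>T.G\<^esub> (red + 1)) = \<zero>\<^bsub>T.G\<^esub>"
proof -
  obtain b where b: "\<And>n. b n \<in> mpow n" "\<And>n. n < red + 1 \<Longrightarrow> b n = \<zero>" "g [^]\<^bsub>T.G\<^esub> (red + 1) = T.from_reps b"
    using irrelevant_pow_reps[OF assms(1,2), of "red + 1"] by blast
  define c where "c = (\<lambda>n. if d \<le> n then a \<otimes> b (n - d) else \<zero>)"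
  have c: "c n \<in> mpow (Suc n)" for n
  proof (cases "d \<le> n \<and> red + 1 \<le> n - d")
    case True
    then obtain k where k: "n = d + Suc k" "red \<le> k" by (metis add.commute le_Suc_ex Suc_eq_plus1 le_add_diff_inverse Suc_le_D Suc_le_mono)
    have "b (Suc k) \<in> x <# mpow k" using b(1)[of "Suc k"] mpow_Suc_ge[OF k(2)] by simp
    then obtain e where e: "e \<in> mpow k" "b (Suc k) = x \<otimes> e" unfolding l_coset_def by blast
    have "a \<otimes> b (Suc k) = (x \<otimes> a) \<otimes> e" using e mpow_closed[OF e(1)] mpow_closed[OF a(1)] by (simp add: m_ac)
    moreover have "(x \<otimes> a) \<otimes> e \<in> mpow (d + 2 + k)" by (rule mpow_mult[OF a(2) e(1)])
    moreover have "d + 2 + k = n + 1" using k(1) by simp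
    ultimately show ?thesis using k(1) by (simp add: c_def)
  next
    case False
    then have "c n = \<zero>" using b(2)[of "n - d"] mpow_closed[OF a(1)] by (auto simp: c_def)
    then show ?thesis using T.L_zero by simp
  qed
  have "T.homog_elem d a \<otimes>\<^bsub>T.G\<^esub> (g [^]\<^bsub>T.G\<^esub> (red + 1)) = T.from_reps c"
    unfolding b(3) c_def by (rule T.homog_elem_mult_reps[OF a(1) b(1)])
  also have "\<dots> = \<zero>\<^bsub>T.G\<^esub>"
    unfolding T.from_reps_def T.G_zero
  proof
    show "mpow (Suc n) +> c n = mpow (Suc n)" for n
      using c[of n] T.coset_eq_L_iff[OF mpow_closed[OF c], of n n] by blast
  qed
  finally show ?thesis .
qed

lemma x_in_irrelevant: "T.homog_elem (Suc 0) x \<in> irrelevant"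
proof -
  have x: "x \<in> mpow (Suc 0)" using x_in_max by (simp add: mpow_one)
  show ?thesis using T.single_carrier[OF x] unfolding T.homog_elem_def
    by (subst from_reps_irrelevant_iff[OF T.single_in_N[OF x]])
      (auto simp: T.single_def additive_subgroup.zero_closed[OF ideal.axioms(1)[OF ideal_max]])
qed

text \<open>The localization \<open>L\<close> of the tangent cone at the irrelevant ideal is Cohen-Macaulay. A prime ideal that
avoids the powers of \<open>f = x*/1\<close> lies strictly below the maximal ideal \<open>\<nn>\<close> of \<open>L\<close>, so \<open>L\<close> has positive
dimension, hence positive depth, and \<open>\<nn>\<close> contains a regular element \<open>z = g/s\<close>. Its numerator \<open>g\<close>
is in the irrelevant ideal, so a power of \<open>z\<close> kills the image \<open>w\<close> of the class of \<open>a\<close>. Thus \<open>w = 0\<close>, and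
the class of \<open>a\<close> is zero.\<close>

lemma initial_form_regular:
  assumes CM: "cohen_macaulay_ring (tangent_cone A \<mm>)"
    and a: "a \<in> mpow d" "x \<otimes> a \<in> mpow (d + 2)"
  shows "a \<in> mpow (Suc d)"
proof -
  let ?S = "carrier T.G - irrelevant"
  let ?L = "localization T.G ?S"
  let ?frac = "frac_class T.G ?S"
  interpret G: cring T.G using CM by (simp add: cohen_macaulay_ring_def tangent_cone_eq)
  note max = irrelevant_maximal[OF G.is_cring]
  obtain \<nn> where "cohen_macaulay_local_ring ?L \<nn>"
    using CM max unfolding cohen_macaulay_ring_def tangent_cone_eq by blast
  then interpret L: cohen_macaulay_local_ring ?L \<nn> .
  interpret L: noetherian_local_ring ?L \<nn> ..
  interpret S: multiplicative_set T.G ?S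
    by (rule G.multiplicative_set_prime[OF G.maximalideal_prime[OF max]])
  interpret M: ideal irrelevant T.G using max by (rule maximalideal.axioms(1))
  define X where "X = T.homog_elem (Suc 0) x"
  have x1: "x \<in> mpow 1" using x_in_max by (simp add: mpow_one)
  have X: "X \<in> carrier T.G" "X \<in> irrelevant"
    using x_in_irrelevant M.Icarr unfolding X_def by auto
  have Xpow: "X [^]\<^bsub>T.G\<^esub> n = T.homog_elem n (x [^] n)" for n :: nat
    using T.homog_elem_pow[OF x1, of n] by (simp add: X_def)
  have cancel: "b \<in> mpow (Suc e)" if b: "b \<in> mpow e" and z: "?frac (T.homog_elem e b) \<one>\<^bsub>T.G\<^esub> = \<zero>\<^bsub>?L\<^esub>" for b e
  proof -
    have B: "T.homog_elem e b \<in> carrier T.G" by (rule T.single_carrier[OF b])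
    obtain t where t: "t \<in> carrier T.G" "t \<notin> irrelevant" "t \<otimes>\<^bsub>T.G\<^esub> T.homog_elem e b = \<zero>\<^bsub>T.G\<^esub>"
      using S.frac_class_eq_zero_iff[OF B S.S_one] z by blast
    then show ?thesis using unit_degree_zero_cancel[OF t(1,2) b] G.m_comm[OF t(1) B] by simp
  qed
  define f where "f = ?frac X \<one>\<^bsub>T.G\<^esub>"
  have f: "f \<in> carrier ?L" unfolding f_def using X(1) S.S_one by (rule S.frac_class_in_carrier)
  have f_pow: "f [^]\<^bsub>?L\<^esub> n \<noteq> \<zero>\<^bsub>?L\<^esub>" for n :: nat
  proof
    assume "f [^]\<^bsub>?L\<^esub> n = \<zero>\<^bsub>?L\<^esub>"
    then have "?frac (T.homog_elem n (x [^] n)) \<one>\<^bsub>T.G\<^esub> = \<zero>\<^bsub>?L\<^esub>"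
      using S.frac_class_pow[OF X(1) S.S_one, of n] by (simp add: f_def Xpow)
    then have "x [^] n \<in> mpow (Suc n)" by (rule cancel[OF x_pow_in_mpow])
    then show False using x_pow_notin by blast
  qed
  \<comment> \<open>Clearing denominators turns an inverse of \<open>c / s\<close> into an equation between an element outside the
    irrelevant ideal and a multiple of \<open>c\<close>.\<close>
  have unit: "c \<in> ?S" if c: "c \<in> carrier T.G" "s \<in> ?S" and u: "u \<in> carrier ?L" "u \<otimes>\<^bsub>?L\<^esub> ?frac c s = \<one>\<^bsub>?L\<^esub>" for c s u
  proof (rule ccontr)
    assume "c \<notin> ?S"
    then have cM: "c \<in> irrelevant" using c by blast
    obtain g w where gw: "g \<in> carrier T.G" "w \<in> ?S" "u = ?frac g w"
      using u(1) unfolding S.localization_carrier by blast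
    have "?frac (g \<otimes>\<^bsub>T.G\<^esub> c) (w \<otimes>\<^bsub>T.G\<^esub> s) = ?frac \<one>\<^bsub>T.G\<^esub> \<one>\<^bsub>T.G\<^esub>"
      using u(2) S.mult_frac_class[OF gw(1) c(1) gw(2) c(2)] by (simp add: gw(3) S.localization_one)
    then obtain t where t: "t \<in> ?S" "t \<otimes>\<^bsub>T.G\<^esub> (\<one>\<^bsub>T.G\<^esub> \<otimes>\<^bsub>T.G\<^esub> (g \<otimes>\<^bsub>T.G\<^esub> c)) = t \<otimes>\<^bsub>T.G\<^esub> ((w \<otimes>\<^bsub>T.G\<^esub> s) \<otimes>\<^bsub>T.G\<^esub> \<one>\<^bsub>T.G\<^esub>)"
      using S.frac_class_eq_iff[OF G.m_closed[OF gw(1) c(1)] G.one_closed S.S_mult[OF gw(2) c(2)] S.S_one] by blast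
    have "t \<otimes>\<^bsub>T.G\<^esub> ((w \<otimes>\<^bsub>T.G\<^esub> s) \<otimes>\<^bsub>T.G\<^esub> \<one>\<^bsub>T.G\<^esub>) \<in> ?S"
      by (intro S.S_mult t(1) gw(2) c(2) S.S_one)
    moreover have "t \<otimes>\<^bsub>T.G\<^esub> (\<one>\<^bsub>T.G\<^esub> \<otimes>\<^bsub>T.G\<^esub> (g \<otimes>\<^bsub>T.G\<^esub> c)) \<in> irrelevant"
      by (rule M.I_l_closed[OF M.I_l_closed[OF M.I_l_closed[OF cM gw(1)] G.one_closed]]) (use t(1) in blast)
    ultimately show False unfolding t(2) by blast
  qed
  have "f \<in> \<nn>"
  proof -
    have "PIdl\<^bsub>?L\<^esub> f \<noteq> carrier ?L"
    proof
      assume "PIdl\<^bsub>?L\<^esub> f = carrier ?L"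
      then have "\<one>\<^bsub>?L\<^esub> \<in> PIdl\<^bsub>?L\<^esub> f" using L.one_closed by simp
      then obtain u where u: "u \<in> carrier ?L" "u \<otimes>\<^bsub>?L\<^esub> f = \<one>\<^bsub>?L\<^esub>" unfolding cgenideal_def by auto
      then show False using unit[OF X(1) S.S_one u(1)] X(2) by (simp add: f_def)
    qed
    then show ?thesis
      using L.proper_ideal_subset_max[OF L.cgenideal_ideal[OF f]] L.cgenideal_self[OF f] by blast
  qed
  obtain P where P: "primeideal P ?L" "f \<notin> P"
    using L.prime_avoiding_powers[OF L.noetherian_ring_axioms f f_pow] by blast
  have "P \<subseteq> \<nn>"
    using L.proper_ideal_subset_max[OF primeideal.axioms(1)[OF P(1)]] primeideal.I_notcarr[OF P(1)] by blast
  then have "P \<subset> \<nn>" using P(2) \<open>f \<in> \<nn>\<close> by blast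
  moreover have "primeideal \<nn> ?L" by (rule L.maximalideal_prime[OF L.maximalideal_axioms])
  ultimately have "\<exists>Q :: nat \<Rightarrow> _. (\<forall>i\<le>1. primeideal (Q i) ?L) \<and> (\<forall>i<1. Q i \<subset> Q (Suc i))"
    using P(1) by (intro exI[of _ "\<lambda>i. if i = 0 then P else \<nn>"]) auto
  then have "enat 1 \<le> krull_dim ?L" unfolding krull_dim_def by (intro Sup_upper) blast
  then have "1 \<le> depth ?L \<nn>" by (simp add: L.depth_eq_dim one_enat_def)
  then obtain z where z: "z \<in> \<nn>" "z \<in> regular_elements ?L"
    using L.regular_element_of_depth by blast
  obtain g s where gs: "g \<in> carrier T.G" "s \<in> ?S" "z = ?frac g s"
    using ideal.Icarr[OF L.ideal_max z(1)] unfolding S.localization_carrier by blast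
  have gM: "g \<in> irrelevant"
  proof (rule ccontr)
    assume "g \<notin> irrelevant"
    then have gS: "g \<in> ?S" using gs(1) by blast
    have sc: "s \<in> carrier T.G" using gs(2) by blast
    have "?frac s g \<otimes>\<^bsub>?L\<^esub> z = ?frac (s \<otimes>\<^bsub>T.G\<^esub> g) (g \<otimes>\<^bsub>T.G\<^esub> s)"
      unfolding gs(3) by (rule S.mult_frac_class[OF sc gs(1) gS gs(2)])
    also have "\<dots> = \<one>\<^bsub>?L\<^esub>" unfolding S.localization_one
      using S.S_mult[OF gS gs(2)] S.S_one sc gs(1) by (intro S.frac_class_eq_cross) (auto simp: G.m_comm)
    finally have "\<one>\<^bsub>?L\<^esub> \<in> \<nn>"
      using ideal.I_l_closed[OF L.ideal_max z(1) S.frac_class_in_carrier[OF sc gS]] by simp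
    then show False using L.one_notin_max by simp
  qed
  define w where "w = ?frac (T.homog_elem d a) \<one>\<^bsub>T.G\<^esub>"
  have H: "T.homog_elem d a \<in> carrier T.G" by (rule T.single_carrier[OF a(1)])
  have w: "w \<in> carrier ?L" unfolding w_def using H S.S_one by (rule S.frac_class_in_carrier)
  let ?N = "red + 1"
  have gN: "g [^]\<^bsub>T.G\<^esub> ?N \<in> carrier T.G" by (rule G.nat_pow_closed[OF gs(1)])
  have zN: "z [^]\<^bsub>?L\<^esub> ?N = ?frac (g [^]\<^bsub>T.G\<^esub> ?N) (s [^]\<^bsub>T.G\<^esub> ?N)" and sN: "s [^]\<^bsub>T.G\<^esub> ?N \<in> ?S"
    using S.frac_class_pow[OF gs(1,2), of ?N] unfolding gs(3) by blast+
  have "z [^]\<^bsub>?L\<^esub> ?N \<otimes>\<^bsub>?L\<^esub> w = ?frac (g [^]\<^bsub>T.G\<^esub> ?N \<otimes>\<^bsub>T.G\<^esub> T.homog_elem d a) (s [^]\<^bsub>T.G\<^esub> ?N \<otimes>\<^bsub>T.G\<^esub> \<one>\<^bsub>T.G\<^esub>)"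
    unfolding zN w_def by (rule S.mult_frac_class[OF gN H sN S.S_one])
  also have "g [^]\<^bsub>T.G\<^esub> ?N \<otimes>\<^bsub>T.G\<^esub> T.homog_elem d a = \<zero>\<^bsub>T.G\<^esub>"
    using irrelevant_pow_kills[OF G.is_cring gM a] G.m_comm[OF H gN] by simp
  also have "?frac \<zero>\<^bsub>T.G\<^esub> (s [^]\<^bsub>T.G\<^esub> ?N \<otimes>\<^bsub>T.G\<^esub> \<one>\<^bsub>T.G\<^esub>) = \<zero>\<^bsub>?L\<^esub>"
    by (rule S.frac_class_zero[OF S.S_mult[OF sN S.S_one]])
  finally have "z [^]\<^bsub>?L\<^esub> ?N \<otimes>\<^bsub>?L\<^esub> w = \<zero>\<^bsub>?L\<^esub>" .
  moreover have "z [^]\<^bsub>?L\<^esub> ?N \<in> regular_elements ?L"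
    by (rule multiplicative_set.pow_mem[OF L.multiplicative_set_regular z(2)])
  ultimately have "w = \<zero>\<^bsub>?L\<^esub>" using w unfolding regular_elements_def by blast
  then show ?thesis using cancel[OF a(1)] by (simp add: w_def)
qed

end

section \<open>The lengths behind the Apery invariants\<close>

lemma enat_add_right_eq_0:
  fixes a b :: enat assumes "a + b = 0 + b" "b \<noteq> \<infinity>" shows "a = 0"
  using assms by (cases a; cases b) (auto simp: zero_enat_def)

text \<open>The local form of the regularity of \<open>x*\<close>. Apart from the ring axioms, this implication is all that the
remaining sections use of the Cohen-Macaulay property of the tangent cone.\<close>

locale regular_initial_form = local_ring_reduction +
  assumes initial_form_cancel: "a \<in> mpow d \<Longrightarrow> x \<otimes> a \<in> mpow (d + 2) \<Longrightarrow> a \<in> mpow (Suc d)"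
begin

text \<open>Descent on the order of \<open>a\<close>: as long as \<open>a \<in> \<mm>\<^sup>j\<close> with \<open>j < d\<close>, the element \<open>x a\<close> lies in \<open>\<mm>\<^sup>j\<^sup>+\<^sup>2\<close>, so that
\<open>a \<in> \<mm>\<^sup>j\<^sup>+\<^sup>1\<close>.\<close>

lemma colon:
  assumes a: "a \<in> carrier A" and xa: "x \<otimes> a \<in> mpow (Suc d)" shows "a \<in> mpow d"
proof -
  have "j \<le> d \<Longrightarrow> a \<in> mpow j" for j
  proof (induction j)
    case 0
    show ?case using a by (simp add: mpow_zero)
  next
    case (Suc j)
    then have "x \<otimes> a \<in> mpow (j + 2)" using xa mpow_antimono[of "j + 2" "Suc d"] by auto
    then show ?case using Suc by (intro initial_form_cancel) auto
  qed
  then show ?thesis by blast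
qed

lemma colon_pow: "a \<in> carrier A \<Longrightarrow> x [^] k \<otimes> a \<in> mpow (k + d) \<Longrightarrow> a \<in> mpow d"
proof (induction k)
  case (Suc k)
  have "x [^] Suc k \<otimes> a = x \<otimes> (x [^] k \<otimes> a)" using Suc.prems(1) by (simp add: m_ac)
  then have "x \<otimes> (x [^] k \<otimes> a) \<in> mpow (Suc (k + d))" using Suc.prems(2) by simp
  then have "x [^] k \<otimes> a \<in> mpow (k + d)" by (rule colon[rotated]) (use Suc.prems(1) in simp)
  then show ?case using Suc by blast
qed simp

text \<open>The Hilbert function of the tangent cone.\<close>

definition hilb :: "nat \<Rightarrow> enat" where "hilb n = ideal_length A (mpow (Suc n)) (mpow n)"

lemma hilb_eq_min_gens: "hilb n = min_gens A (mpow n)"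
  unfolding hilb_def mpow_Suc by (rule min_gens_eq_ideal_length[OF mpow_ideal, symmetric])

lemma hilb_finite: "hilb n \<noteq> \<infinity>"
  unfolding hilb_eq_min_gens by (rule min_gens_finite[OF mpow_ideal])

text \<open>From degree \<open>r\<close> on, multiplication by \<open>x\<close> carries \<open>\<mm>\<^sup>k\<^sup>+\<^sup>1 \<subseteq> \<mm>\<^sup>k\<close> onto \<open>\<mm>\<^sup>k\<^sup>+\<^sup>2 \<subseteq> \<mm>\<^sup>k\<^sup>+\<^sup>1\<close>.\<close>

lemma hilb_red_add: "hilb (red + n) = hilb red"
proof (induction n)
  case (Suc n)
  have "hilb (red + Suc n) = ideal_length A (x <# mpow (Suc (red + n))) (x <# mpow (red + n))"
    using mpow_Suc_ge[of "red + n"] mpow_Suc_ge[of "Suc (red + n)"] by (simp add: hilb_def)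
  also have "\<dots> = hilb (red + n)" unfolding hilb_def
    by (rule ideal_length_l_coset[OF x_regular mpow_ideal mpow_antimono]) simp
  finally show ?case using Suc by simp
qed simp

text \<open>For \<open>k = 1\<close> these ideals define the Apery invariants. For \<open>k = r\<close> they are the multiples by \<open>x\<^sup>r\<close> of the
submodules of the total ring of fractions that define the micro-invariants.\<close>

definition shifted :: "nat \<Rightarrow> nat \<Rightarrow> 'a set"
  where "shifted k j = PIdl (x [^] k) <+>\<^bsub>A\<^esub> mpow (k + j)"

lemma PIdl_x_pow_ideal: "ideal (PIdl (x [^] (k::nat))) A"
  by (rule cgenideal_ideal) simp

lemma shifted_ideal: "ideal (shifted k j) A"
  unfolding shifted_def by (rule add_ideals[OF PIdl_x_pow_ideal mpow_ideal])

lemma shifted_antimono: "shifted k (Suc j) \<subseteq> shifted k j"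
  using mpow_antimono[of "k + j" "k + Suc j"] unfolding shifted_def subset_iff mem_set_add_iff
  by (metis add_Suc_right le_SucI order_refl)

lemma mpow_Int_x_pow: "mpow (k + Suc j) \<inter> (x [^] k <# mpow j) = (x [^] k <# mpow (Suc j))"
proof
  show "mpow (k + Suc j) \<inter> (x [^] k <# mpow j) \<subseteq> (x [^] k <# mpow (Suc j))"
  proof
    fix b assume b: "b \<in> mpow (k + Suc j) \<inter> (x [^] k <# mpow j)"
    then obtain c where c: "c \<in> mpow j" "b = x [^] k \<otimes> c" unfolding l_coset_def by blast
    then have "c \<in> mpow (Suc j)" using colon_pow[OF mpow_closed[OF c(1)], of k "Suc j"] b by simp
    then show "b \<in> (x [^] k <# mpow (Suc j))" using c(2) unfolding l_coset_def by blast
  qed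
  show "(x [^] k <# mpow (Suc j)) \<subseteq> mpow (k + Suc j) \<inter> (x [^] k <# mpow j)"
    using x_pow_mult_mpow[of _ "Suc j" k] mpow_antimono[of j "Suc j"] unfolding l_coset_def by auto
qed

lemma mpow_Int_shifted:
  "mpow (k + j) \<inter> shifted k (Suc j) = (x [^] k <# mpow j) <+> mpow (k + Suc j)"
proof
  show "mpow (k + j) \<inter> shifted k (Suc j) \<subseteq> (x [^] k <# mpow j) <+> mpow (k + Suc j)"
  proof
    fix b assume b: "b \<in> mpow (k + j) \<inter> shifted k (Suc j)"
    then have "b \<in> shifted k (Suc j)" by blast
    then obtain p e where p: "p \<in> PIdl (x [^] k)" and e: "e \<in> mpow (k + Suc j)" "b = p \<oplus> e"
      unfolding shifted_def mem_set_add_iff by blast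
    obtain c where c: "c \<in> carrier A" "p = c \<otimes> x [^] k" using p unfolding cgenideal_def by blast
    then have p': "p = x [^] k \<otimes> c" by (simp add: m_comm)
    have e': "e \<in> mpow (k + j)" using e(1) mpow_antimono[of "k + j" "k + Suc j"] by auto
    have "p = b \<ominus> e" using e(2) mpow_closed[OF e(1)] c by (simp add: a_minus_def a_assoc r_neg)
    then have "p \<in> mpow (k + j)" unfolding a_minus_def using b mpow_add T.N_neg[OF e'] by simp
    then have "c \<in> mpow j" using colon_pow[OF c(1), of k j] p' by simp
    then show "b \<in> (x [^] k <# mpow j) <+> mpow (k + Suc j)"
      unfolding mem_set_add_iff l_coset_def using e p' by blast
  qed
  show "(x [^] k <# mpow j) <+> mpow (k + Suc j) \<subseteq> mpow (k + j) \<inter> shifted k (Suc j)"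
  proof (rule ideal_add_least[OF i_intersect[OF mpow_ideal shifted_ideal]])
    have "(x [^] k <# mpow j) \<subseteq> PIdl (x [^] k)"
      unfolding l_coset_def cgenideal_def using mpow_closed m_comm x_pow_carrier by blast
    then show "(x [^] k <# mpow j) \<subseteq> mpow (k + j) \<inter> shifted k (Suc j)"
      using x_pow_mult_mpow[of _ j k] ideal_add_upper1[OF PIdl_x_pow_ideal mpow_ideal]
      unfolding shifted_def l_coset_def by blast
    show "mpow (k + Suc j) \<subseteq> mpow (k + j) \<inter> shifted k (Suc j)"
      using mpow_antimono[of "k + j" "k + Suc j"] ideal_add_upper2[OF PIdl_x_pow_ideal mpow_ideal]
      unfolding shifted_def by auto
  qed
qed

text \<open>Apply the second isomorphism theorem twice. The sum of \<open>\<mm>\<^sup>k\<^sup>+\<^sup>j\<close> and \<open>shifted k (j + 1)\<close> is \<open>shifted k j\<close> and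
their intersection is \<open>Z = x\<^sup>k \<mm>\<^sup>j + \<mm>\<^sup>k\<^sup>+\<^sup>j\<^sup>+\<^sup>1\<close>, so the length on the left is that of \<open>\<mm>\<^sup>k\<^sup>+\<^sup>j / Z\<close>. The remaining
part \<open>Z / \<mm>\<^sup>k\<^sup>+\<^sup>j\<^sup>+\<^sup>1\<close> of \<open>\<mm>\<^sup>k\<^sup>+\<^sup>j / \<mm>\<^sup>k\<^sup>+\<^sup>j\<^sup>+\<^sup>1\<close> is isomorphic to \<open>x\<^sup>k \<mm>\<^sup>j / x\<^sup>k \<mm>\<^sup>j\<^sup>+\<^sup>1\<close>, hence to \<open>\<mm>\<^sup>j / \<mm>\<^sup>j\<^sup>+\<^sup>1\<close>.\<close>

lemma length_shifted:
  "ideal_length A (shifted k (Suc j)) (shifted k j) + hilb j = hilb (k + j)"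
proof -
  let ?l = "ideal_length A" and ?U = "x [^] k <# mpow j" and ?V = "mpow (k + Suc j)"
  let ?X = "mpow (k + j)" and ?Y = "shifted k (Suc j)"
  have U: "ideal ?U A" by (rule ideal_l_coset[OF x_pow_carrier mpow_ideal])
  have UV: "ideal (?U <+>\<^bsub>A\<^esub> ?V) A" by (rule add_ideals[OF U mpow_ideal])
  have "?X <+>\<^bsub>A\<^esub> ?Y = shifted k j"
  proof
    show "?X <+>\<^bsub>A\<^esub> ?Y \<subseteq> shifted k j"
      by (rule ideal_add_least[OF shifted_ideal _ shifted_antimono])
        (use ideal_add_upper2[OF PIdl_x_pow_ideal mpow_ideal] in \<open>auto simp: shifted_def\<close>)
    show "shifted k j \<subseteq> ?X <+>\<^bsub>A\<^esub> ?Y"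
      unfolding shifted_def[of k j]
    proof (rule ideal_add_least[OF add_ideals[OF mpow_ideal shifted_ideal]])
      have "PIdl (x [^] k) \<subseteq> ?Y"
        unfolding shifted_def by (rule ideal_add_upper1[OF PIdl_x_pow_ideal mpow_ideal])
      then show "PIdl (x [^] k) \<subseteq> ?X <+>\<^bsub>A\<^esub> ?Y"
        using ideal_add_upper2[OF mpow_ideal shifted_ideal] by blast
    qed (rule ideal_add_upper1[OF mpow_ideal shifted_ideal])
  qed
  then have 1: "?l (?U <+>\<^bsub>A\<^esub> ?V) ?X = ?l ?Y (shifted k j)"
    using ideal_length_diamond[OF mpow_ideal shifted_ideal, of "k + j" k "Suc j"] mpow_Int_shifted by simp
  have "?U \<inter> ?V = (x [^] k <# mpow (Suc j))" using mpow_Int_x_pow by blast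
  then have "?l ?V (?U <+>\<^bsub>A\<^esub> ?V) = ?l ((x [^] k <# mpow (Suc j))) ?U"
    using ideal_length_diamond[OF U mpow_ideal, of "k + Suc j"] by simp
  also have "\<dots> = hilb j" unfolding hilb_def
    by (rule ideal_length_l_coset[OF x_pow_regular mpow_ideal mpow_antimono]) simp
  finally have 2: "?l ?V (?U <+>\<^bsub>A\<^esub> ?V) = hilb j" .
  have "hilb (k + j) = ?l ?V (?U <+>\<^bsub>A\<^esub> ?V) + ?l (?U <+>\<^bsub>A\<^esub> ?V) ?X"
    unfolding hilb_def add_Suc_right[symmetric]
    by (rule ideal_length_add[OF mpow_ideal UV mpow_ideal ideal_add_upper2[OF U mpow_ideal]])
      (use mpow_Int_shifted in blast)
  then show ?thesis unfolding 1 2 by (simp add: add.commute)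
qed

lemma apery_invariant_add: "apery_invariant A \<mm> x (Suc j) + hilb j = hilb (Suc j)"
proof -
  have eq: "ideal_pow A \<mm> (Suc i) <+> PIdl x = shifted 1 i" for i
    unfolding shifted_def mpow_def[symmetric]
    using set_add_comm[of "mpow (Suc i)" "PIdl x"] mpow_closed ideal.Icarr[OF cgenideal_ideal[OF x_carrier]]
    by (simp add: subset_iff)
  have "apery_invariant A \<mm> x (Suc j) = ideal_length A (shifted 1 (Suc j)) (shifted 1 j)"
    unfolding apery_invariant_def Suc_eq_plus1[symmetric] eq
    by (rule quot_length_ideals[OF shifted_ideal shifted_ideal shifted_antimono])
  then show ?thesis using length_shifted[of 1 j] by simp
qed

lemma apery_invariant_pos:
  assumes "Suc j \<le> red" shows "apery_invariant A \<mm> x (Suc j) \<noteq> 0"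
proof
  assume 0: "apery_invariant A \<mm> x (Suc j) = 0"
  have "ideal_length A (shifted 1 (Suc j)) (shifted 1 j) + hilb j = 0 + hilb j"
    using length_shifted[of 1 j] apery_invariant_add[of j] unfolding 0 by (simp only: plus_1_eq_Suc)
  then have "ideal_length A (shifted 1 (Suc j)) (shifted 1 j) = 0"
    using hilb_finite[of j] by (rule enat_add_right_eq_0)
  then have eq: "shifted 1 (Suc j) = shifted 1 j"
    by (rule ideal_length_eq_0[OF shifted_ideal shifted_ideal shifted_antimono])
  have "mpow (Suc j) \<subseteq> shifted 1 j"
    unfolding shifted_def using ideal_add_upper2[OF PIdl_x_pow_ideal[of 1] mpow_ideal[of "Suc j"]] by simp
  then have "mpow (Suc j) \<subseteq> mpow (1 + j) \<inter> shifted 1 (Suc j)" unfolding eq by simp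
  then have "mpow (Suc j) \<subseteq> (x <# mpow j) <+> \<mm> \<cdot> mpow (Suc j)"
    unfolding mpow_Int_shifted by (simp add: mpow_Suc[of "Suc j"])
  moreover have "x <# mpow j \<subseteq> mpow (Suc j)"
    using max_mult_mpow[OF x_in_max] unfolding l_coset_def by blast
  ultimately have "x <# mpow j = mpow (Suc j)"
    using nakayama[OF mpow_ideal ideal_l_coset[OF x_carrier mpow_ideal]] by blast
  then have "red \<le> j" by (intro red_le) simp
  then show False using assms by simp
qed

section \<open>The first neighborhood ring\<close>

sublocale Q: multiplicative_set A "regular_elements A"
  by (rule multiplicative_set_regular)

abbreviation Quo where "Quo \<equiv> total_fractions A"

text \<open>The embedding \<open>a \<mapsto> a / x\<^sup>r\<close> of \<open>A\<close>-modules into the total ring of fractions. Its image contains \<open>A'\<close> and all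
the submodules \<open>A + \<mm>\<^sup>j A'\<close>, so that their lengths can be computed with ideals of \<open>A\<close>.\<close>

definition over_x_pow :: "'a \<Rightarrow> ('a \<times> 'a) set"
  where "over_x_pow a = fraction A a (x [^] red)"

lemma Quo_eq: "Quo = localization A (regular_elements A)"
  by (rule total_fractions_def)

lemma Quo_cring: "cring Quo"
  unfolding Quo_eq by (rule Q.localization_cring)

lemma fraction_closed: "a \<in> carrier A \<Longrightarrow> s \<in> regular_elements A \<Longrightarrow> fraction A a s \<in> carrier Quo"
  unfolding Quo_eq fraction_def by (rule Q.frac_class_in_carrier)

lemma fraction_mult:
  "a \<in> carrier A \<Longrightarrow> b \<in> carrier A \<Longrightarrow> s \<in> regular_elements A \<Longrightarrow> t \<in> regular_elements A \<Longrightarrow>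
    fraction A a s \<otimes>\<^bsub>Quo\<^esub> fraction A b t = fraction A (a \<otimes> b) (s \<otimes> t)"
  unfolding Quo_eq fraction_def by (rule Q.mult_frac_class)

lemma fraction_add:
  "a \<in> carrier A \<Longrightarrow> b \<in> carrier A \<Longrightarrow> s \<in> regular_elements A \<Longrightarrow>
    fraction A a s \<oplus>\<^bsub>Quo\<^esub> fraction A b s = fraction A (a \<oplus> b) s"
  unfolding Quo_eq fraction_def by (rule Q.add_frac_class_same_denominator)

lemma fraction_eqI:
  "a \<in> carrier A \<Longrightarrow> b \<in> carrier A \<Longrightarrow> s \<in> regular_elements A \<Longrightarrow> t \<in> regular_elements A \<Longrightarrow>
    t \<otimes> a = s \<otimes> b \<Longrightarrow> fraction A a s = fraction A b t"
  unfolding fraction_def by (rule Q.frac_class_eq_cross)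

lemma to_fractions_eq: "a \<in> carrier A \<Longrightarrow> to_fractions A a = over_x_pow (a \<otimes> x [^] red)"
  unfolding over_x_pow_def by (rule fraction_eqI) (simp_all add: Q.S_one x_pow_regular m_comm)

lemma over_x_pow_closed: "a \<in> carrier A \<Longrightarrow> over_x_pow a \<in> carrier Quo"
  unfolding over_x_pow_def by (rule fraction_closed[OF _ x_pow_regular])

lemma over_x_pow_add:
  "a \<in> carrier A \<Longrightarrow> b \<in> carrier A \<Longrightarrow> over_x_pow (a \<oplus> b) = over_x_pow a \<oplus>\<^bsub>Quo\<^esub> over_x_pow b"
  unfolding over_x_pow_def by (rule fraction_add[OF _ _ x_pow_regular, symmetric])

lemma over_x_pow_smult:
  "a \<in> carrier A \<Longrightarrow> b \<in> carrier A \<Longrightarrow> over_x_pow (a \<otimes> b) = to_fractions A a \<otimes>\<^bsub>Quo\<^esub> over_x_pow b"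
  unfolding over_x_pow_def by (subst fraction_mult) (simp_all add: Q.S_one x_pow_regular)

lemma over_x_pow_inj:
  assumes "a \<in> carrier A" "b \<in> carrier A" "over_x_pow a = over_x_pow b"
  shows "a = b"
proof -
  obtain u where u: "u \<in> regular_elements A" "u \<otimes> (x [^] red \<otimes> a) = u \<otimes> (x [^] red \<otimes> b)"
    using assms Q.frac_class_eq_iff[OF assms(1,2) x_pow_regular x_pow_regular]
    unfolding over_x_pow_def fraction_def by blast
  have reg: "u \<otimes> x [^] red \<in> regular_elements A" by (rule Q.S_mult[OF u(1) x_pow_regular])
  have "(u \<otimes> x [^] red) \<otimes> (a \<ominus> b) = \<zero>"
    using u assms(1,2) Q.S_closed[OF u(1)] by (simp add: a_minus_def r_distr r_minus m_assoc r_neg)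
  then have "a \<ominus> b = \<zero>" using reg assms(1,2) unfolding regular_elements_def by blast
  then show ?thesis using assms(1,2) by simp
qed

lemma Quo_module: "module A (module_via (to_fractions A) Quo)"
proof (rule module_via_hom[OF is_cring Quo_cring ring_hom_memI])
  show "to_fractions A \<one> = \<one>\<^bsub>Quo\<^esub>" unfolding Quo_eq fraction_def by (rule Q.localization_one[symmetric])
qed (simp_all add: fraction_closed fraction_mult fraction_add Q.S_one)

lemma fraction_in_neighborhood: "a \<in> mpow k \<Longrightarrow> fraction A a (x [^] k) \<in> neighborhood_ring A \<mm> x"
proof (induction k arbitrary: a)
  case 0
  then show ?case unfolding neighborhood_ring_def mpow_zero by (intro generate_ring.incl) simp
next
  case (Suc k)
  then have "a \<in> \<mm> \<cdot> mpow k" unfolding mpow_Suc by simp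
  then have "a \<in> carrier A \<and> fraction A a (x [^] Suc k) \<in> neighborhood_ring A \<mm> x"
  proof (induction rule: ideal_prod.induct)
    case (prod c b)
    have c: "c \<in> carrier A" "b \<in> carrier A" using ideal.Icarr[OF ideal_max prod(1)] mpow_closed[OF prod(2)] by auto
    have "fraction A c x \<in> neighborhood_ring A \<mm> x"
      unfolding neighborhood_ring_def using prod(1) by (intro generate_ring.incl) blast
    then have "fraction A c x \<otimes>\<^bsub>Quo\<^esub> fraction A b (x [^] k) \<in> neighborhood_ring A \<mm> x"
      using Suc.IH[OF prod(2)] unfolding neighborhood_ring_def by (rule generate_ring.eng_mult)
    moreover have "fraction A c x \<otimes>\<^bsub>Quo\<^esub> fraction A b (x [^] k) = fraction A (c \<otimes> b) (x [^] Suc k)"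
      unfolding fraction_mult[OF c x_regular x_pow_regular] by (simp add: m_comm)
    ultimately show ?case using c by simp
  next
    case (sum s1 s2)
    then have "fraction A s1 (x [^] Suc k) \<oplus>\<^bsub>Quo\<^esub> fraction A s2 (x [^] Suc k) \<in> neighborhood_ring A \<mm> x"
      unfolding neighborhood_ring_def by (intro generate_ring.eng_add) auto
    then show ?case using sum fraction_add[of s1 s2, OF _ _ x_pow_regular[of "Suc k"]] by simp
  qed
  then show ?case by blast
qed

text \<open>The fractions \<open>a / x\<^sup>r\<close> with \<open>a \<in> \<mm>\<^sup>r\<close> already form a ring, because \<open>\<mm>\<^sup>r \<mm>\<^sup>r = x\<^sup>r \<mm>\<^sup>r\<close>; and it contains \<open>b / x\<close> for \<open>b \<in> \<mm>\<close>,
because \<open>x\<^sup>r b \<in> \<mm>\<^sup>r\<^sup>+\<^sup>1 = x \<mm>\<^sup>r\<close>.\<close>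

lemma neighborhood_ring_eq: "neighborhood_ring A \<mm> x = over_x_pow ` mpow red"
proof
  show "over_x_pow ` mpow red \<subseteq> neighborhood_ring A \<mm> x"
    using fraction_in_neighborhood unfolding over_x_pow_def by blast
  interpret Quo: cring Quo by (rule Quo_cring)
  have scaled: "over_x_pow (x [^] red \<otimes> a) \<in> over_x_pow ` mpow red" if "a \<in> carrier A" for a
    using ideal.I_r_closed[OF mpow_ideal x_pow_in_mpow that] by blast
  have tf: "to_fractions A a \<in> over_x_pow ` mpow red" if "a \<in> carrier A" for a
    using scaled[OF that] that by (simp add: to_fractions_eq m_comm)
  show "neighborhood_ring A \<mm> x \<subseteq> over_x_pow ` mpow red"
  proof
    fix f assume "f \<in> neighborhood_ring A \<mm> x"
    then show "f \<in> over_x_pow ` mpow red" unfolding neighborhood_ring_def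
    proof (induction rule: generate_ring.induct)
      case one
      have "\<one>\<^bsub>Quo\<^esub> = to_fractions A \<one>" unfolding Quo_eq fraction_def by (rule Q.localization_one)
      then show ?case using tf by simp
    next
      case (incl f)
      then consider a where "a \<in> carrier A" "f = to_fractions A a" | b where "b \<in> \<mm>" "f = fraction A b x" by blast
      then show ?case
      proof cases
        case 1
        then show ?thesis using tf by simp
      next
        case 2
        have bc: "b \<in> carrier A" by (rule ideal.Icarr[OF ideal_max 2(1)])
        have "x [^] red \<otimes> b \<in> mpow (Suc red)"
          using max_mult_mpow[OF 2(1) x_pow_in_mpow[of red]] bc by (simp add: m_comm)
        then obtain c where c: "c \<in> mpow red" "x [^] red \<otimes> b = x \<otimes> c"
          unfolding mpow_Suc_red l_coset_def by blast
        have "f = over_x_pow c" unfolding 2(2) over_x_pow_def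
          by (rule fraction_eqI[OF bc mpow_closed[OF c(1)] x_regular x_pow_regular c(2)])
        then show ?thesis using c(1) by blast
      qed
    next
      case (a_inv f)
      then obtain a where a: "a \<in> mpow red" "f = over_x_pow a" by blast
      have ac: "a \<in> carrier A" by (rule mpow_closed[OF a(1)])
      have "\<zero>\<^bsub>Quo\<^esub> = over_x_pow \<zero>"
        unfolding Quo_eq over_x_pow_def fraction_def by (rule Q.frac_class_zero[OF x_pow_regular, symmetric])
      then have "over_x_pow (\<ominus> a) \<oplus>\<^bsub>Quo\<^esub> f = \<zero>\<^bsub>Quo\<^esub>"
        using over_x_pow_add[of "\<ominus> a" a] ac a(2) by (simp add: l_neg)
      then have "\<ominus>\<^bsub>Quo\<^esub> f = over_x_pow (\<ominus> a)"
        using ac a(2) over_x_pow_closed by (intro Quo.minus_equality) auto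
      then show ?case using T.N_neg[OF a(1)] by simp
    next
      case (eng_add f g)
      then obtain a b where ab: "a \<in> mpow red" "f = over_x_pow a" "b \<in> mpow red" "g = over_x_pow b" by blast
      then show ?case using over_x_pow_add[of a b] mpow_closed mpow_add[of a red b] by (metis imageI)
    next
      case (eng_mult f g)
      then obtain a b where ab: "a \<in> mpow red" "f = over_x_pow a" "b \<in> mpow red" "g = over_x_pow b" by blast
      have abc: "a \<in> carrier A" "b \<in> carrier A" using ab mpow_closed by auto
      obtain c where c: "c \<in> mpow red" "a \<otimes> b = x [^] red \<otimes> c"
        using mpow_red_add[OF mpow_mult[OF ab(1,3)]] by blast
      have "f \<otimes>\<^bsub>Quo\<^esub> g = fraction A (a \<otimes> b) (x [^] red \<otimes> x [^] red)"
        unfolding ab(2,4) over_x_pow_def by (rule fraction_mult[OF abc x_pow_regular x_pow_regular])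
      also have "\<dots> = over_x_pow c"
        unfolding over_x_pow_def
        by (rule fraction_eqI) (use c mpow_closed abc Q.S_mult[OF x_pow_regular x_pow_regular] x_pow_regular in \<open>simp_all add: m_assoc\<close>)
      finally show ?case using c(1) by simp
    qed
  qed
qed

lemma mpow_neighborhood_ring:
  "ideal_prod Quo (to_fractions A ` mpow j) (neighborhood_ring A \<mm> x) = over_x_pow ` mpow (red + j)"
proof
  show "ideal_prod Quo (to_fractions A ` mpow j) (neighborhood_ring A \<mm> x) \<subseteq> over_x_pow ` mpow (red + j)"
  proof
    fix f assume "f \<in> ideal_prod Quo (to_fractions A ` mpow j) (neighborhood_ring A \<mm> x)"
    then show "f \<in> over_x_pow ` mpow (red + j)"
    proof (induction rule: ideal_prod.induct)
      case (prod f g)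
      then obtain c a where ca: "c \<in> mpow j" "f = to_fractions A c" "a \<in> mpow red" "g = over_x_pow a"
        unfolding neighborhood_ring_eq by blast
      have "f \<otimes>\<^bsub>Quo\<^esub> g = over_x_pow (c \<otimes> a)"
        unfolding ca(2,4) using mpow_closed[OF ca(1)] mpow_closed[OF ca(3)] by (rule over_x_pow_smult[symmetric])
      then show ?case using mpow_mult[OF ca(1,3)] by (simp add: add.commute)
    next
      case (sum f g)
      then obtain a b where ab: "a \<in> mpow (red + j)" "f = over_x_pow a" "b \<in> mpow (red + j)" "g = over_x_pow b" by blast
      then show ?case using over_x_pow_add[of a b] mpow_closed mpow_add[of a "red + j" b] by (metis imageI)
    qed
  qed
  show "over_x_pow ` mpow (red + j) \<subseteq> ideal_prod Quo (to_fractions A ` mpow j) (neighborhood_ring A \<mm> x)"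
  proof
    fix f assume "f \<in> over_x_pow ` mpow (red + j)"
    then obtain b where b: "b \<in> mpow (j + red)" "f = over_x_pow b" by (auto simp: add.commute)
    have "b \<in> mpow j \<cdot> mpow red" using b(1) ideal_pow_add[OF ideal_max, of j red] unfolding mpow_def by simp
    then have "b \<in> carrier A \<and> over_x_pow b \<in> ideal_prod Quo (to_fractions A ` mpow j) (neighborhood_ring A \<mm> x)"
    proof (induction rule: ideal_prod.induct)
      case (prod c a)
      then have "to_fractions A c \<otimes>\<^bsub>Quo\<^esub> over_x_pow a \<in> ideal_prod Quo (to_fractions A ` mpow j) (neighborhood_ring A \<mm> x)"
        unfolding neighborhood_ring_eq by (intro ideal_prod.prod) auto
      then show ?case using over_x_pow_smult[of c a] mpow_closed[OF prod(1)] mpow_closed[OF prod(2)] by simp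
    next
      case (sum s1 s2)
      then show ?case using over_x_pow_add[of s1 s2] ideal_prod.sum[of _ Quo] by simp
    qed
    then show "f \<in> ideal_prod Quo (to_fractions A ` mpow j) (neighborhood_ring A \<mm> x)" using b(2) by simp
  qed
qed

lemma micro_submodule_eq: "micro_submodule A \<mm> x j = over_x_pow ` shifted red j"
proof -
  have tf: "to_fractions A ` carrier A = over_x_pow ` (PIdl (x [^] red))"
    unfolding cgenideal_def using to_fractions_eq by (auto simp: image_def)
  have P: "p \<in> carrier A" if "p \<in> PIdl (x [^] red)" for p using ideal.Icarr[OF PIdl_x_pow_ideal that] .
  have "over_x_pow ` (PIdl (x [^] red)) <+>\<^bsub>Quo\<^esub> over_x_pow ` mpow (red + j) = over_x_pow ` shifted red j"
  proof (intro equalityI subsetI)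
    fix f assume "f \<in> over_x_pow ` (PIdl (x [^] red)) <+>\<^bsub>Quo\<^esub> over_x_pow ` mpow (red + j)"
    then obtain p b where "p \<in> PIdl (x [^] red)" "b \<in> mpow (red + j)" "f = over_x_pow p \<oplus>\<^bsub>Quo\<^esub> over_x_pow b"
      unfolding set_add_def' by blast
    then show "f \<in> over_x_pow ` shifted red j"
      unfolding shifted_def set_add_def'[of A] using over_x_pow_add[of p b] P mpow_closed by blast
  next
    fix f assume "f \<in> over_x_pow ` shifted red j"
    then obtain p b where "p \<in> PIdl (x [^] red)" "b \<in> mpow (red + j)" "f = over_x_pow (p \<oplus> b)"
      unfolding shifted_def set_add_def' by blast
    then show "f \<in> over_x_pow ` (PIdl (x [^] red)) <+>\<^bsub>Quo\<^esub> over_x_pow ` mpow (red + j)"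
      unfolding set_add_def' using over_x_pow_add[of p b] P mpow_closed by blast
  qed
  then show ?thesis
    unfolding micro_submodule_def tf mpow_neighborhood_ring[unfolded mpow_def] mpow_def .
qed

text \<open>Here \<open>d (r + j) = d r\<close> does not depend on \<open>j\<close>, so consecutive lengths can be subtracted.\<close>

lemma micro_length:
  "quot_length A (module_via (to_fractions A) Quo) (micro_submodule A \<mm> x j) (micro_submodule A \<mm> x (Suc j)) + hilb j
    = hilb red"
proof -
  let ?M = "module_via (to_fractions A) Quo"
  have lin: "over_x_pow ` carrier (module_via id A) \<subseteq> carrier ?M"
    "\<And>u v. u \<in> carrier (module_via id A) \<Longrightarrow> v \<in> carrier (module_via id A) \<Longrightarrow>
      over_x_pow (u \<oplus>\<^bsub>module_via id A\<^esub> v) = over_x_pow u \<oplus>\<^bsub>?M\<^esub> over_x_pow v"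
    "\<And>a v. a \<in> carrier A \<Longrightarrow> v \<in> carrier (module_via id A) \<Longrightarrow>
      over_x_pow (a \<odot>\<^bsub>module_via id A\<^esub> v) = a \<odot>\<^bsub>?M\<^esub> over_x_pow v"
    unfolding module_via_simps id_apply
    by (simp_all add: image_subset_iff over_x_pow_closed over_x_pow_add over_x_pow_smult)
  have sub: "submodule (over_x_pow ` shifted red k) A ?M" for k
    by (rule submodule_image[OF module_via_id Quo_module lin]) (simp_all only: submodule_via_id_iff shifted_ideal)
  have "quot_length A ?M (micro_submodule A \<mm> x j) (micro_submodule A \<mm> x (Suc j))
      = interval_length A ?M (over_x_pow ` shifted red (Suc j)) (over_x_pow ` shifted red j)"
    unfolding micro_submodule_eq by (rule quot_length_eq[OF Quo_module sub sub image_mono[OF shifted_antimono]])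
  also have "\<dots> = ideal_length A (shifted red (Suc j)) (shifted red j)"
    unfolding ideal_length_def
  proof (rule interval_length_linear_image[OF module_via_id Quo_module lin])
    show "submodule (shifted red j) A (module_via id A)" by (simp only: submodule_via_id_iff shifted_ideal)
    show "shifted red (Suc j) \<subseteq> shifted red j" by (rule shifted_antimono)
    fix X u v assume "X \<subseteq> shifted red j" "u \<in> X" "v \<in> shifted red j" "over_x_pow u = over_x_pow v"
    then show "v \<in> X" using over_x_pow_inj[of u v] ideal.Icarr[OF shifted_ideal] by blast
  qed
  finally show ?thesis using length_shifted[of red j] hilb_red_add by simp
qed

theorem micro_invariant_eq:
  "micro_invariant A \<mm> x (Suc j) = ereal_of_enat (hilb (Suc j)) - ereal_of_enat (hilb j)"
proof -
  let ?q = "\<lambda>j. quot_length A (module_via (to_fractions A) Quo) (micro_submodule A \<mm> x j) (micro_submodule A \<mm> x (Suc j))"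
  have m: "micro_invariant A \<mm> x (Suc j) = ereal_of_enat (?q j) - ereal_of_enat (?q (Suc j))"
    by (simp add: micro_invariant_def Let_def)
  obtain e h h' where h: "hilb red = enat e" "hilb j = enat h" "hilb (Suc j) = enat h'"
    using hilb_finite by (metis not_enat_eq)
  obtain q where q: "?q j = enat q" "q + h = e" using micro_length[of j] h by (cases "?q j") auto
  obtain q' where q': "?q (Suc j) = enat q'" "q' + h' = e" using micro_length[of "Suc j"] h by (cases "?q (Suc j)") auto
  have "real q - real q' = real h' - real h" using q(2) q'(2) by linarith
  then show ?thesis unfolding m by (simp add: h q q')
qed

end

section \<open>The polynomial ring inside the tangent cone\<close>

lemma with_grading_simps:
  "carrier (with_grading M H) = carrier M" "\<zero>\<^bsub>with_grading M H\<^esub> = \<zero>\<^bsub>M\<^esub>"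
  "u \<oplus>\<^bsub>with_grading M H\<^esub> v = u \<oplus>\<^bsub>M\<^esub> v" "a \<odot>\<^bsub>with_grading M H\<^esub> v = a \<odot>\<^bsub>M\<^esub> v"
  "homog (with_grading M H) = H"
  by (simp_all add: with_grading_def module.defs)

lemma graded_shift_simps:
  "carrier (graded_shift i M) = carrier M" "\<zero>\<^bsub>graded_shift i M\<^esub> = \<zero>\<^bsub>M\<^esub>"
  "u \<oplus>\<^bsub>graded_shift i M\<^esub> v = u \<oplus>\<^bsub>M\<^esub> v" "a \<odot>\<^bsub>graded_shift i M\<^esub> v = a \<odot>\<^bsub>M\<^esub> v"
  "homog (graded_shift i M) n = (if i \<le> n then homog M (n - i) else {\<zero>\<^bsub>M\<^esub>})"
  by (simp_all add: graded_shift_def)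

context local_ring_reduction
begin

abbreviation xpowI :: "nat \<Rightarrow> 'a set" where "xpowI n \<equiv> PIdl (x [^] n)"

lemma xpowI_ideal: "ideal (xpowI n) A"
  by (rule cgenideal_ideal) simp

lemma xpowI_I: "c \<in> carrier A \<Longrightarrow> c \<otimes> x [^] n \<in> xpowI n"
  unfolding cgenideal_def by blast

lemma xpowI_E: "a \<in> xpowI n \<Longrightarrow> \<exists>c\<in>carrier A. a = c \<otimes> x [^] n"
  unfolding cgenideal_def by blast

lemma x_pow_in_xpowI: "x [^] n \<in> xpowI n"
  by (rule cgenideal_self) simp

lemma xpowI_subset_mpow: "xpowI n \<subseteq> mpow n"
  by (rule cgenideal_minimal[OF mpow_ideal x_pow_in_mpow])

lemma x_pow_max_subset: "x [^] n <# \<mm> \<subseteq> mpow (Suc n)"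
  using x_pow_mult_mpow[of _ "Suc 0" n] by (auto simp: l_coset_def mpow_one)

sublocale F: graded_quotient A xpowI "\<lambda>n. x [^] n <# \<mm>"
proof (rule graded_quotient.intro[OF is_cring], rule graded_quotient_axioms.intro, goal_cases)
  case (1 n) show ?case by (rule xpowI_ideal)
next
  case (2 n) show ?case by (rule ideal_l_coset[OF x_pow_carrier ideal_max])
next
  case (3 n)
  show ?case
  proof
    fix b assume "b \<in> x [^] n <# \<mm>"
    then obtain c where c: "c \<in> \<mm>" "b = x [^] n \<otimes> c" unfolding l_coset_def by blast
    have "c \<in> carrier A" by (rule ideal.Icarr[OF ideal_max c(1)])
    then show "b \<in> xpowI n" using xpowI_I[of c n] c(2) by (simp add: m_comm)
  qed
next
  case 4 show ?case using x_pow_in_xpowI[of 0] by simp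
next
  case (5 i j a b)
  then obtain c d where cd: "c \<in> carrier A" "a = c \<otimes> x [^] i" "d \<in> carrier A" "b = d \<otimes> x [^] j"
    using xpowI_E by meson
  have "a \<otimes> b = (c \<otimes> d) \<otimes> x [^] (i + j)" using cd by (simp add: nat_pow_mult[symmetric] m_ac)
  then show ?case using cd xpowI_I by simp
next
  case (6 i j a b)
  then obtain c d where cd: "c \<in> carrier A" "a = c \<otimes> x [^] i" "d \<in> \<mm>" "b = x [^] j \<otimes> d"
    using xpowI_E unfolding l_coset_def by blast
  have d: "d \<in> carrier A" by (rule ideal.Icarr[OF ideal_max cd(3)])
  have "a \<otimes> b = x [^] (i + j) \<otimes> (c \<otimes> d)" using cd d by (simp add: nat_pow_mult[symmetric] m_ac)
  moreover have "c \<otimes> d \<in> \<mm>" by (rule ideal.I_l_closed[OF ideal_max cd(3,1)])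
  ultimately show ?case unfolding l_coset_def by blast
qed

lemma F_ring_eq: "F_ring A \<mm> x = F.G"
  by (rule F_ring_def)

lemma initial_form_eq: "initial_form A \<mm> x = F.homog_elem 1 x"
  unfolding initial_form_def F_ring_eq F.G_zero
  by (auto simp: F.homog_elem_def F.from_reps_def F.single_def F.coset_zero fun_eq_iff)

lemma initial_form_pow: "initial_form A \<mm> x [^]\<^bsub>F.G\<^esub> j = F.homog_elem j (x [^] j)"
  unfolding initial_form_eq using F.homog_elem_pow[of x j] x_pow_in_xpowI[of 1] by simp

text \<open>The inclusion of \<open>F(x)\<close> into the tangent cone does not change representatives. All its algebraic
properties follow from this.\<close>

lemma F_incl_reps:
  assumes a: "\<And>n. a n \<in> xpowI n" shows "F_incl A \<mm> (F.from_reps a) = T.from_reps a"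
proof
  fix n
  have an: "a n \<in> carrier A" using a[of n] by simp
  have "mpow (Suc n) <+>\<^bsub>A\<^esub> ((x [^] n <#\<^bsub>A\<^esub> \<mm>) +> a n) = mpow (Suc n) +> a n"
  proof (intro equalityI subsetI)
    fix v assume "v \<in> mpow (Suc n) <+>\<^bsub>A\<^esub> ((x [^] n <#\<^bsub>A\<^esub> \<mm>) +> a n)"
    then obtain k l where kl: "k \<in> mpow (Suc n)" "l \<in> x [^] n <# \<mm>" "v = k \<oplus> (l \<oplus> a n)"
      unfolding mem_set_add_iff a_r_coset_def' by blast
    have l: "l \<in> mpow (Suc n)" using kl(2) x_pow_max_subset by blast
    have "v = (k \<oplus> l) \<oplus> a n" using kl mpow_closed[OF kl(1)] mpow_closed[OF l] an by (simp add: a_assoc)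
    then show "v \<in> mpow (Suc n) +> a n" using mpow_add[OF kl(1) l] unfolding a_r_coset_def' by blast
  next
    fix v assume "v \<in> mpow (Suc n) +> a n"
    then obtain k where k: "k \<in> mpow (Suc n)" "v = k \<oplus> (\<zero> \<oplus> a n)" using an unfolding a_r_coset_def' by auto
    then show "v \<in> mpow (Suc n) <+>\<^bsub>A\<^esub> ((x [^] n <#\<^bsub>A\<^esub> \<mm>) +> a n)"
      unfolding mem_set_add_iff a_r_coset_def' using F.L_zero[of n] by blast
  qed
  then show "F_incl A \<mm> (F.from_reps a) n = T.from_reps a n"
    unfolding F_incl_def mpow_def[symmetric] by (simp add: F.from_reps_def T.from_reps_def)
qed

lemma F_incl_homog: "a \<in> xpowI d \<Longrightarrow> F_incl A \<mm> (F.homog_elem d a) = T.homog_elem d a"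
  unfolding F.homog_elem_def using F_incl_reps[OF F.single_in_N]
  by (simp add: T.homog_elem_def F.single_def T.single_def)

lemma x_pow_mult_in_mpow_Suc:
  assumes "c \<in> carrier A" "c \<otimes> x [^] n \<in> mpow (Suc n)" shows "c \<in> \<mm>"
proof (rule ccontr)
  assume "c \<notin> \<mm>"
  then have "x [^] n \<in> mpow (Suc n)" by (rule mult_unit_mem[OF mpow_ideal assms(1) _ x_pow_carrier assms(2)])
  then show False using x_pow_notin by blast
qed

lemma F_cring:
  assumes "cring T.G" shows "cring F.G"
proof -
  interpret G: cring T.G by fact
  have rep: "\<exists>a. (\<forall>n. a n \<in> xpowI n) \<and> f = F.from_reps a \<and> (\<forall>n. a n \<in> mpow n) \<and> F_incl A \<mm> f = T.from_reps a
      \<and> finite {n. a n \<notin> mpow (Suc n)}" if f: "f \<in> carrier F.G" for f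
  proof -
    obtain a where a: "\<And>n. a n \<in> xpowI n" "finite {n. a n \<notin> x [^] n <# \<mm>}" "f = F.from_reps a"
      using f F.G_carrier by blast
    have "finite {n. a n \<notin> mpow (Suc n)}"
      by (rule finite_subset[OF _ a(2)]) (use x_pow_max_subset in blast)
    then show ?thesis using a F_incl_reps[OF a(1)] xpowI_subset_mpow by blast
  qed
  show ?thesis
  proof (rule G.cring_of_injective[of "F_incl A \<mm>"])
    show "inj_on (F_incl A \<mm>) (carrier F.G)"
    proof (rule inj_onI)
      fix f g assume f: "f \<in> carrier F.G" and g: "g \<in> carrier F.G" and eq: "F_incl A \<mm> f = F_incl A \<mm> g"
      obtain a where a: "\<And>n. a n \<in> xpowI n" "f = F.from_reps a" "\<And>n. a n \<in> mpow n" "F_incl A \<mm> f = T.from_reps a"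
        using rep[OF f] by blast
      obtain b where b: "\<And>n. b n \<in> xpowI n" "g = F.from_reps b" "\<And>n. b n \<in> mpow n" "F_incl A \<mm> g = T.from_reps b"
        using rep[OF g] by blast
      have "a n \<ominus> b n \<in> x [^] n <# \<mm>" for n
      proof -
        have m: "a n \<ominus> b n \<in> mpow (Suc n)" using eq T.from_reps_eq_iff[OF a(3) b(3)] a(4) b(4) by simp
        have "a n \<ominus> b n \<in> xpowI n" unfolding a_minus_def by (rule F.N_add[OF a(1) F.N_neg[OF b(1)]])
        then obtain c where c: "c \<in> carrier A" "a n \<ominus> b n = c \<otimes> x [^] n" using xpowI_E by blast
        then have "c \<in> \<mm>" using x_pow_mult_in_mpow_Suc m by simp
        then show ?thesis using c m_comm[OF c(1) x_pow_carrier] unfolding l_coset_def by auto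
      qed
      then show "f = g" unfolding a(2) b(2) F.from_reps_eq_iff[OF a(1) b(1)] by blast
    qed
    show "F_incl A \<mm> f \<in> carrier T.G" if f: "f \<in> carrier F.G" for f
    proof -
      obtain a where "\<And>n. a n \<in> mpow n" "F_incl A \<mm> f = T.from_reps a" "finite {n. a n \<notin> mpow (Suc n)}"
        using rep[OF f] by blast
      then show ?thesis using T.from_reps_carrier[of a] by simp
    qed
    show "\<zero>\<^bsub>F.G\<^esub> \<in> carrier F.G" by (rule F.G_zero_carrier)
    show "F_incl A \<mm> \<zero>\<^bsub>F.G\<^esub> = \<zero>\<^bsub>T.G\<^esub>"
      unfolding F.G_zero_reps T.G_zero_reps by (rule F_incl_reps) simp
    show "\<one>\<^bsub>F.G\<^esub> \<in> carrier F.G" by (rule F.G_one_carrier)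
    show "F_incl A \<mm> \<one>\<^bsub>F.G\<^esub> = \<one>\<^bsub>T.G\<^esub>"
      using F_incl_homog[OF F.one_in_N] unfolding F.G_one_reps T.G_one_reps F.homog_elem_def T.homog_elem_def .
    show "f \<oplus>\<^bsub>F.G\<^esub> g \<in> carrier F.G" "f \<otimes>\<^bsub>F.G\<^esub> g \<in> carrier F.G" if "f \<in> carrier F.G" "g \<in> carrier F.G" for f g
      using F.G_add_closed[OF that] F.G_mult_closed[OF that] by auto
    show "\<exists>g\<in>carrier F.G. g \<oplus>\<^bsub>F.G\<^esub> f = \<zero>\<^bsub>F.G\<^esub>" if "f \<in> carrier F.G" for f by (rule F.G_neg[OF that])
    fix f g assume f: "f \<in> carrier F.G" and g: "g \<in> carrier F.G"
    obtain a where a: "\<And>n. a n \<in> xpowI n" "f = F.from_reps a" "\<And>n. a n \<in> mpow n" "F_incl A \<mm> f = T.from_reps a"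
      using rep[OF f] by blast
    obtain b where b: "\<And>n. b n \<in> xpowI n" "g = F.from_reps b" "\<And>n. b n \<in> mpow n" "F_incl A \<mm> g = T.from_reps b"
      using rep[OF g] by blast
    show "F_incl A \<mm> (f \<oplus>\<^bsub>F.G\<^esub> g) = F_incl A \<mm> f \<oplus>\<^bsub>T.G\<^esub> F_incl A \<mm> g"
      unfolding a(4) b(4) T.add_reps[OF a(3) b(3)] unfolding a(2) b(2) F.add_reps[OF a(1) b(1)]
      by (rule F_incl_reps) (rule F.N_add[OF a(1) b(1)])
    show "F_incl A \<mm> (f \<otimes>\<^bsub>F.G\<^esub> g) = F_incl A \<mm> f \<otimes>\<^bsub>T.G\<^esub> F_incl A \<mm> g"
      unfolding a(4) b(4) T.mult_reps[OF a(3) b(3)] unfolding a(2) b(2) F.mult_reps[OF a(1) b(1)]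
      by (rule F_incl_reps) (rule F.mult_reps_in_N[OF a(1) b(1)])
  qed
qed

end

section \<open>The splitting of the tangent cone\<close>

locale tangent_cone_splitting = regular_initial_form +
  fixes \<alpha> :: "nat \<Rightarrow> nat" and \<alpha>t :: "nat \<Rightarrow> nat \<Rightarrow> nat" and h
  assumes tangent_cone_cring: "cring T.G"
    and h_iso: "h \<in> graded_module_iso F.G (tangent_cone_module A \<mm>)
      (graded_dsum2
        (graded_dsum {(i, k). i \<le> red \<and> k < \<alpha> i} (\<lambda>(i, k). graded_shift i (F_module A \<mm> x)))
        (graded_dsum {(i, j, k). i \<in> {1..red - 1} \<and> j \<in> {1..red - i} \<and> k < \<alpha>t i j}
          (\<lambda>(i, j, k). graded_shift i
            (graded_quot (F_module A \<mm> x) (PIdl\<^bsub>F.G\<^esub> (initial_form A \<mm> x [^]\<^bsub>F.G\<^esub> j))))))"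
begin

abbreviation I0 where "I0 \<equiv> {(i, k). i \<le> red \<and> k < \<alpha> i}"
abbreviation IT where "IT \<equiv> {(i, j, k). i \<in> {1..red - 1} \<and> j \<in> {1..red - i} \<and> k < \<alpha>t i j}"
text \<open>The relations of the torsion summand with index \<open>q = (i, j, k)\<close> are the multiples of the \<open>j\<close>-th power
of \<open>x*\<close>.\<close>

abbreviation J :: "nat \<times> nat \<times> nat \<Rightarrow> (nat \<Rightarrow> 'a set) set"
  where "J q \<equiv> PIdl\<^bsub>F.G\<^esub> (F.homog_elem (fst (snd q)) (x [^] fst (snd q)))"
abbreviation Free where "Free \<equiv> graded_dsum I0 (\<lambda>p. graded_shift (fst p) (F_module A \<mm> x))"
abbreviation Tors where "Tors \<equiv> graded_dsum IT (\<lambda>q. graded_shift (fst q) (graded_quot (F_module A \<mm> x) (J q)))"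

interpretation Fc: cring F.G by (rule F_cring[OF tangent_cone_cring])
interpretation Gc: cring T.G by (rule tangent_cone_cring)

lemma iso: "h \<in> graded_module_iso F.G (tangent_cone_module A \<mm>) (graded_dsum2 Free Tors)"
  using h_iso by (simp only: initial_form_pow case_prod_unfold)

lemma tangent_cone_module_simps:
  "carrier (tangent_cone_module A \<mm>) = carrier T.G" "u \<oplus>\<^bsub>tangent_cone_module A \<mm>\<^esub> v = u \<oplus>\<^bsub>T.G\<^esub> v"
  "f \<odot>\<^bsub>tangent_cone_module A \<mm>\<^esub> v = F_incl A \<mm> f \<otimes>\<^bsub>T.G\<^esub> v"
  "homog (tangent_cone_module A \<mm>) = graded_part T.G"
  by (simp_all add: tangent_cone_module_def with_grading_simps module_via_simps tangent_cone_eq)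

lemma F_module_simps:
  "carrier (F_module A \<mm> x) = carrier F.G" "u \<oplus>\<^bsub>F_module A \<mm> x\<^esub> v = u \<oplus>\<^bsub>F.G\<^esub> v"
  "\<zero>\<^bsub>F_module A \<mm> x\<^esub> = \<zero>\<^bsub>F.G\<^esub>"
  "f \<odot>\<^bsub>F_module A \<mm> x\<^esub> v = f \<otimes>\<^bsub>F.G\<^esub> v"
  "homog (F_module A \<mm> x) = graded_part F.G"
  by (simp_all add: F_module_def with_grading_simps module_via_simps F_ring_eq)

lemma F_module_coset: "L +>\<^bsub>F_module A \<mm> x\<^esub> v = L +>\<^bsub>F.G\<^esub> v"
  by (simp add: a_r_coset_def' F_module_simps)

lemma quot_simps:
  "carrier (graded_quot (F_module A \<mm> x) L) = (\<lambda>v. L +>\<^bsub>F.G\<^esub> v) ` carrier F.G"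
  "f \<odot>\<^bsub>graded_quot (F_module A \<mm> x) L\<^esub> C = (\<Union>v\<in>C. L +>\<^bsub>F.G\<^esub> (f \<otimes>\<^bsub>F.G\<^esub> v))"
  by (auto simp: graded_quot_def with_grading_simps quot_module_def F_module_coset F_module_simps
      A_RCOSETS_def' a_r_coset_def')

lemma h_bij: "bij_betw h (carrier T.G) (carrier Free \<times> carrier Tors)"
  using iso by (simp add: graded_module_iso_def tangent_cone_module_simps graded_dsum2_def)

lemma h_add: "u \<in> carrier T.G \<Longrightarrow> v \<in> carrier T.G \<Longrightarrow>
    fst (h (u \<oplus>\<^bsub>T.G\<^esub> v)) = fst (h u) \<oplus>\<^bsub>Free\<^esub> fst (h v)"
  using iso by (simp add: graded_module_iso_def tangent_cone_module_simps graded_dsum2_def case_prod_unfold)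

lemma h_smult: "f \<in> carrier F.G \<Longrightarrow> v \<in> carrier T.G \<Longrightarrow>
    h (F_incl A \<mm> f \<otimes>\<^bsub>T.G\<^esub> v) = (f \<odot>\<^bsub>Free\<^esub> fst (h v), f \<odot>\<^bsub>Tors\<^esub> snd (h v))"
  using iso by (simp add: graded_module_iso_def tangent_cone_module_simps graded_dsum2_def case_prod_unfold)

lemma h_homog: "h ` graded_part T.G n = homog Free n \<times> homog Tors n"
  using iso by (simp add: graded_module_iso_def tangent_cone_module_simps graded_dsum2_def)

lemma Free_simps:
  "carrier Free = (\<Pi>\<^sub>E p\<in>I0. carrier F.G)"
  "p \<in> I0 \<Longrightarrow> (u \<oplus>\<^bsub>Free\<^esub> v) p = u p \<oplus>\<^bsub>F.G\<^esub> v p"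
  "f \<odot>\<^bsub>Free\<^esub> v = (\<lambda>p\<in>I0. f \<otimes>\<^bsub>F.G\<^esub> v p)"
  "homog Free n = (\<Pi>\<^sub>E p\<in>I0. if fst p \<le> n then graded_part F.G (n - fst p) else {\<zero>\<^bsub>F.G\<^esub>})"
  by (simp_all add: graded_dsum_def graded_shift_simps F_module_simps cong: if_cong)

lemma Tors_simps:
  "carrier Tors = (\<Pi>\<^sub>E q\<in>IT. (\<lambda>v. J q +>\<^bsub>F.G\<^esub> v) ` carrier F.G)"
  "f \<odot>\<^bsub>Tors\<^esub> v = (\<lambda>q\<in>IT. \<Union>w\<in>v q. J q +>\<^bsub>F.G\<^esub> (f \<otimes>\<^bsub>F.G\<^esub> w))"
  by (simp_all add: graded_dsum_def graded_shift_simps quot_simps)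

lemma F_homog_x_pow: "F.homog_elem j (x [^] j) \<in> carrier F.G"
  by (rule F.single_carrier[OF x_pow_in_xpowI])

lemma J_ideal: "ideal (J q) F.G"
  by (rule Fc.cgenideal_ideal[OF F_homog_x_pow])

text \<open>The zero element is obtained from itself by the scalar \<open>0\<close>, and this scalar sends every coset of
\<open>J q\<close> to \<open>J q\<close>.\<close>

lemma h_zero: "h \<zero>\<^bsub>T.G\<^esub> = ((\<lambda>p\<in>I0. \<zero>\<^bsub>F.G\<^esub>), (\<lambda>q\<in>IT. J q))"
proof -
  have c: "h \<zero>\<^bsub>T.G\<^esub> \<in> carrier Free \<times> carrier Tors" using h_bij T.G_zero_carrier by (auto simp: bij_betw_def)
  have "F_incl A \<mm> \<zero>\<^bsub>F.G\<^esub> = \<zero>\<^bsub>T.G\<^esub>"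
    unfolding F.G_zero_reps T.G_zero_reps by (rule F_incl_reps) simp
  then have "h \<zero>\<^bsub>T.G\<^esub> = h (F_incl A \<mm> \<zero>\<^bsub>F.G\<^esub> \<otimes>\<^bsub>T.G\<^esub> \<zero>\<^bsub>T.G\<^esub>)" using T.G_zero_carrier by simp
  also have "\<dots> = (\<zero>\<^bsub>F.G\<^esub> \<odot>\<^bsub>Free\<^esub> fst (h \<zero>\<^bsub>T.G\<^esub>), \<zero>\<^bsub>F.G\<^esub> \<odot>\<^bsub>Tors\<^esub> snd (h \<zero>\<^bsub>T.G\<^esub>))"
    by (rule h_smult[OF F.G_zero_carrier T.G_zero_carrier])
  also have "\<zero>\<^bsub>F.G\<^esub> \<odot>\<^bsub>Free\<^esub> fst (h \<zero>\<^bsub>T.G\<^esub>) = (\<lambda>p\<in>I0. \<zero>\<^bsub>F.G\<^esub>)"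
    unfolding Free_simps
  proof (rule restrict_ext)
    fix p assume "p \<in> I0"
    then have "fst (h \<zero>\<^bsub>T.G\<^esub>) p \<in> carrier F.G" using c unfolding Free_simps by (auto simp: mem_Times_iff dest: PiE_mem)
    then show "\<zero>\<^bsub>F.G\<^esub> \<otimes>\<^bsub>F.G\<^esub> fst (h \<zero>\<^bsub>T.G\<^esub>) p = \<zero>\<^bsub>F.G\<^esub>" by (rule Fc.l_null)
  qed
  also have "\<zero>\<^bsub>F.G\<^esub> \<odot>\<^bsub>Tors\<^esub> snd (h \<zero>\<^bsub>T.G\<^esub>) = (\<lambda>q\<in>IT. J q)"
    unfolding Tors_simps
  proof (rule restrict_ext)
    fix q assume "q \<in> IT"
    moreover have "snd (h \<zero>\<^bsub>T.G\<^esub>) \<in> (\<Pi>\<^sub>E q\<in>IT. (\<lambda>v. J q +>\<^bsub>F.G\<^esub> v) ` carrier F.G)"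
      using c unfolding Tors_simps(1)[symmetric] mem_Times_iff by (rule conjunct2)
    ultimately have "snd (h \<zero>\<^bsub>T.G\<^esub>) q \<in> (\<lambda>v. J q +>\<^bsub>F.G\<^esub> v) ` carrier F.G"
      by (rule PiE_mem[rotated])
    then obtain v where v: "v \<in> carrier F.G" "snd (h \<zero>\<^bsub>T.G\<^esub>) q = J q +>\<^bsub>F.G\<^esub> v" by blast
    interpret Jq: ideal "J q" F.G by (rule J_ideal)
    have "w \<in> carrier F.G" if "w \<in> J q +>\<^bsub>F.G\<^esub> v" for w using that v(1) Jq.a_elemrcos_carrier by blast
    moreover have "v \<in> J q +>\<^bsub>F.G\<^esub> v" by (rule Jq.a_rcos_self[OF v(1)])
    moreover have "J q +>\<^bsub>F.G\<^esub> \<zero>\<^bsub>F.G\<^esub> = J q" by (rule Fc.a_coset_add_zero[OF Jq.a_subset])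
    ultimately show "(\<Union>w\<in>snd (h \<zero>\<^bsub>T.G\<^esub>) q. J q +>\<^bsub>F.G\<^esub> (\<zero>\<^bsub>F.G\<^esub> \<otimes>\<^bsub>F.G\<^esub> w)) = J q" unfolding v(2) by auto
  qed
  finally show ?thesis .
qed

lemma x_star_cancel:
  assumes g: "g \<in> carrier T.G" and z: "T.homog_elem j (x [^] j) \<otimes>\<^bsub>T.G\<^esub> g = \<zero>\<^bsub>T.G\<^esub>"
  shows "g = \<zero>\<^bsub>T.G\<^esub>"
proof -
  obtain a where a: "\<And>n. a n \<in> mpow n" "g = T.from_reps a" using g T.G_carrier by blast
  have c: "(if j \<le> n then x [^] j \<otimes> a (n - j) else \<zero>) \<in> mpow n" for n
    using x_pow_mult_mpow[OF a(1)[of "n - j"], of j] by auto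
  have "T.from_reps (\<lambda>n. if j \<le> n then x [^] j \<otimes> a (n - j) else \<zero>) = T.from_reps (\<lambda>n. \<zero>)"
    using z unfolding a(2) T.homog_elem_mult_reps[OF x_pow_in_mpow a(1)] T.G_zero_reps .
  then have *: "(if j \<le> n then x [^] j \<otimes> a (n - j) else \<zero>) \<ominus> \<zero> \<in> mpow (Suc n)" for n
    using T.from_reps_eq_iff[OF c, of "\<lambda>n. \<zero>"] by simp
  have "a n \<ominus> \<zero> \<in> mpow (Suc n)" for n
  proof -
    have "x [^] j \<otimes> a n \<in> mpow (j + Suc n)" using *[of "j + n"] mpow_closed[OF a(1)] by (simp add: a_minus_def)
    then show ?thesis using colon_pow[OF mpow_closed[OF a(1)]] mpow_closed[OF a(1)] by (simp add: a_minus_def)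
  qed
  then show ?thesis unfolding a(2) T.G_zero_reps using T.from_reps_eq_iff[OF a(1), of "\<lambda>n. \<zero>"] by simp
qed

lemma one_notin_J: "0 < fst (snd q) \<Longrightarrow> \<one>\<^bsub>F.G\<^esub> \<notin> J q"
proof
  let ?j = "fst (snd q)"
  assume j: "0 < ?j" and "\<one>\<^bsub>F.G\<^esub> \<in> J q"
  then obtain f where f: "f \<in> carrier F.G" "\<one>\<^bsub>F.G\<^esub> = f \<otimes>\<^bsub>F.G\<^esub> F.homog_elem ?j (x [^] ?j)"
    unfolding cgenideal_def by blast
  obtain a where a: "\<And>n. a n \<in> xpowI n" "f = F.from_reps a" using f(1) F.G_carrier by blast
  have "\<one>\<^bsub>F.G\<^esub> = F.homog_elem ?j (x [^] ?j) \<otimes>\<^bsub>F.G\<^esub> F.from_reps a"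
    using f Fc.m_comm[OF f(1) F_homog_x_pow] a(2) by simp
  also have "\<dots> = F.from_reps (\<lambda>n. if ?j \<le> n then x [^] ?j \<otimes> a (n - ?j) else \<zero>)"
    by (rule F.homog_elem_mult_reps[OF x_pow_in_xpowI a(1)])
  finally have "F.from_reps (F.single 0 \<one>) 0 = F.from_reps (\<lambda>n. if ?j \<le> n then x [^] ?j \<otimes> a (n - ?j) else \<zero>) 0"
    unfolding F.G_one_reps by (rule arg_cong)
  then have "x [^] (0::nat) <# \<mm> +> \<one> = x [^] (0::nat) <# \<mm> +> \<zero>" using j by (simp add: F.from_reps_def F.single_def)
  then have "\<one> \<in> x [^] (0::nat) <# \<mm>" using F.coset_zero[of 0] F.coset_eq_L_iff[of \<one> 0] by simp
  then have "\<one> \<in> \<mm>" using ideal.Icarr[OF ideal_max] by (auto simp: l_coset_def)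
  then show False using one_notin_max by blast
qed

text \<open>The generator of a torsion summand is killed by a power of \<open>x*\<close>, which is impossible for the
corresponding element of the tangent cone unless it is zero.\<close>

lemma no_torsion: "IT = {}"
proof (rule ccontr)
  assume "IT \<noteq> {}"
  then obtain q where q: "q \<in> IT" by blast
  let ?j = "fst (snd q)" and ?f = "F.homog_elem (fst (snd q)) (x [^] fst (snd q))"
  have j: "0 < ?j" using q by auto
  define v where "v = (\<lambda>q'\<in>IT. if q' = q then J q +>\<^bsub>F.G\<^esub> \<one>\<^bsub>F.G\<^esub> else J q')"
  have J0: "J q' = J q' +>\<^bsub>F.G\<^esub> \<zero>\<^bsub>F.G\<^esub>" for q'
    using Fc.a_coset_add_zero[of "J q'"] ideal.Icarr[OF J_ideal[of q']] by blast
  have "v \<in> carrier Tors" unfolding Tors_simps v_def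
  proof (rule restrict_PiE_iff[THEN iffD2], rule ballI)
    fix q' assume "q' \<in> IT"
    show "(if q' = q then J q +>\<^bsub>F.G\<^esub> \<one>\<^bsub>F.G\<^esub> else J q') \<in> (\<lambda>v. J q' +>\<^bsub>F.G\<^esub> v) ` carrier F.G"
      using J0[of q'] by (metis (no_types, lifting) Fc.one_closed Fc.zero_closed imageI)
  qed
  moreover have "(\<lambda>p\<in>I0. \<zero>\<^bsub>F.G\<^esub>) \<in> carrier Free" unfolding Free_simps by simp
  ultimately have "((\<lambda>p\<in>I0. \<zero>\<^bsub>F.G\<^esub>), v) \<in> h ` carrier T.G"
    unfolding bij_betw_imp_surj_on[OF h_bij] by (simp only: mem_Sigma_iff)
  then obtain g where g: "g \<in> carrier T.G" "h g = ((\<lambda>p\<in>I0. \<zero>\<^bsub>F.G\<^esub>), v)" by force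
  have "h (F_incl A \<mm> ?f \<otimes>\<^bsub>T.G\<^esub> g) = (?f \<odot>\<^bsub>Free\<^esub> (\<lambda>p\<in>I0. \<zero>\<^bsub>F.G\<^esub>), ?f \<odot>\<^bsub>Tors\<^esub> v)"
    using h_smult[OF F_homog_x_pow g(1)] g(2) by simp
  also have "?f \<odot>\<^bsub>Free\<^esub> (\<lambda>p\<in>I0. \<zero>\<^bsub>F.G\<^esub>) = (\<lambda>p\<in>I0. \<zero>\<^bsub>F.G\<^esub>)"
    unfolding Free_simps by (rule restrict_ext) (use F_homog_x_pow in simp)
  also have "?f \<odot>\<^bsub>Tors\<^esub> v = (\<lambda>q\<in>IT. J q)"
    unfolding Tors_simps
  proof (rule restrict_ext)
    fix q' assume q': "q' \<in> IT"
    interpret Jq: ideal "J q'" F.G by (rule J_ideal)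
    have "J q' +>\<^bsub>F.G\<^esub> (?f \<otimes>\<^bsub>F.G\<^esub> w) = J q'" if w: "w \<in> v q'" for w
    proof -
      have "?f \<otimes>\<^bsub>F.G\<^esub> w \<in> J q'"
      proof (cases "q' = q")
        case True
        then have "w \<in> J q +>\<^bsub>F.G\<^esub> \<one>\<^bsub>F.G\<^esub>" using w q' by (simp add: v_def)
        then have "w \<in> carrier F.G" using Jq.a_elemrcos_carrier True by blast
        then show ?thesis using True Fc.cgenideal_self[OF F_homog_x_pow[of ?j]] Jq.I_r_closed by simp
      next
        case False
        then have "w \<in> J q'" using w q' by (simp add: v_def)
        then show ?thesis by (rule Jq.I_l_closed[OF _ F_homog_x_pow])
      qed
      then show ?thesis by (rule Jq.a_rcos_const)
    qed
    moreover have "v q' \<noteq> {}"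
    proof (cases "q' = q")
      case True
      then show ?thesis using q' Jq.a_rcos_self[OF Fc.one_closed] by (auto simp: v_def)
    next
      case False
      then show ?thesis using q' Jq.zero_closed unfolding v_def by (simp only: restrict_apply if_True if_False) blast
    qed
    ultimately show "(\<Union>w\<in>v q'. J q' +>\<^bsub>F.G\<^esub> (?f \<otimes>\<^bsub>F.G\<^esub> w)) = J q'" by auto
  qed
  finally have "h (F_incl A \<mm> ?f \<otimes>\<^bsub>T.G\<^esub> g) = h \<zero>\<^bsub>T.G\<^esub>" unfolding h_zero .
  moreover have incl: "F_incl A \<mm> ?f = T.homog_elem ?j (x [^] ?j)" by (rule F_incl_homog[OF x_pow_in_xpowI])
  moreover have "T.homog_elem ?j (x [^] ?j) \<otimes>\<^bsub>T.G\<^esub> g \<in> carrier T.G"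
    by (rule T.G_mult_closed[OF T.single_carrier[OF x_pow_in_mpow] g(1)])
  ultimately have "T.homog_elem ?j (x [^] ?j) \<otimes>\<^bsub>T.G\<^esub> g = \<zero>\<^bsub>T.G\<^esub>"
    using h_bij T.G_zero_carrier by (auto simp: bij_betw_def dest: inj_onD)
  then have "g = \<zero>\<^bsub>T.G\<^esub>" by (rule x_star_cancel[OF g(1)])
  then have "v = (\<lambda>q\<in>IT. J q)" using g(2) h_zero by simp
  then have "v q = J q" using q by (simp only: restrict_apply if_True)
  then have "J q +>\<^bsub>F.G\<^esub> \<one>\<^bsub>F.G\<^esub> = J q" using q by (simp add: v_def)
  then have "\<one>\<^bsub>F.G\<^esub> \<in> J q"
    using abelian_subgroup.a_rcos_self[OF ideal.axioms(1)[OF J_ideal, THEN abelian_subgroupI3, OF Fc.abelian_group_axioms] Fc.one_closed]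
    by blast
  then show False using one_notin_J j by blast
qed

end

context tangent_cone_splitting
begin

interpretation Fc: cring F.G by (rule F_cring[OF tangent_cone_cring])

text \<open>Coordinates of the class of \<open>a\<close> in degree \<open>n\<close> with respect to the free summands. Only those of index
\<open>(i, k)\<close> with \<open>i \<le> n\<close> can be nonzero, and their values are then multiples of the generator of a
one-dimensional space over the residue field.\<close>

definition coord :: "nat \<Rightarrow> nat \<times> nat \<Rightarrow> 'a \<Rightarrow> nat \<Rightarrow> 'a set"
  where "coord n p a = fst (h (T.homog_elem n a)) p"

text \<open>Adding one index at a time to \<open>K\<close> gives a filtration between \<open>\<mm>\<^sup>n\<^sup>+\<^sup>1\<close> and \<open>\<mm>\<^sup>n\<close> by ideals of \<open>A\<close>. Its
steps measure the contributions of the free summands.\<close>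

definition supported :: "nat \<Rightarrow> (nat \<times> nat) set \<Rightarrow> 'a set"
  where "supported n K = {a \<in> mpow n. \<forall>p\<in>I0 - K. coord n p a = \<zero>\<^bsub>F.G\<^esub>}"

lemma h_homog_elem: "a \<in> mpow n \<Longrightarrow> h (T.homog_elem n a) \<in> homog Free n \<times> homog Tors n"
  using h_homog[of n] unfolding T.graded_part_eq by blast

lemma coord_homog:
  assumes "a \<in> mpow n" "p \<in> I0"
  shows "coord n p a \<in> (if fst p \<le> n then graded_part F.G (n - fst p) else {\<zero>\<^bsub>F.G\<^esub>})"
proof -
  have "fst (h (T.homog_elem n a)) \<in> homog Free n" using h_homog_elem[OF assms(1)] by (simp only: mem_Times_iff)
  then show ?thesis unfolding Free_simps(4) coord_def by (rule PiE_mem) (rule assms(2))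
qed

lemma coord_closed:
  assumes "a \<in> mpow n" "p \<in> I0" shows "coord n p a \<in> carrier F.G"
proof (cases "fst p \<le> n")
  case True
  then have "coord n p a \<in> graded_part F.G (n - fst p)" using coord_homog[OF assms] by simp
  then show ?thesis by (simp add: graded_part_def)
next
  case False
  then show ?thesis using coord_homog[OF assms] F.G_zero_carrier by simp
qed

lemma coord_add:
  assumes "a \<in> mpow n" "b \<in> mpow n" "p \<in> I0"
  shows "coord n p (a \<oplus> b) = coord n p a \<oplus>\<^bsub>F.G\<^esub> coord n p b"
  unfolding coord_def T.homog_elem_add[OF assms(1,2), symmetric]
  using h_add[OF T.single_carrier[OF assms(1)] T.single_carrier[OF assms(2)]]
  by (simp only: Free_simps(2)[OF assms(3)])

lemma coord_smult:
  assumes "c \<in> carrier A" "a \<in> mpow n" "p \<in> I0"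
  shows "coord n p (c \<otimes> a) = F.homog_elem 0 c \<otimes>\<^bsub>F.G\<^esub> coord n p a"
proof -
  have c: "c \<in> xpowI 0" using xpowI_I[OF assms(1), of 0] assms(1) by simp
  have c': "c \<in> mpow 0" using assms(1) by (simp only: mpow_zero)
  have "T.homog_elem n (c \<otimes> a) = F_incl A \<mm> (F.homog_elem 0 c) \<otimes>\<^bsub>T.G\<^esub> T.homog_elem n a"
    unfolding F_incl_homog[OF c] using T.homog_elem_mult[OF c' assms(2)] by simp
  then have "h (T.homog_elem n (c \<otimes> a)) = (F.homog_elem 0 c \<odot>\<^bsub>Free\<^esub> fst (h (T.homog_elem n a)),
      F.homog_elem 0 c \<odot>\<^bsub>Tors\<^esub> snd (h (T.homog_elem n a)))"
    using h_smult[OF F.single_carrier[OF c] T.single_carrier[OF assms(2)]] by simp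
  then have "fst (h (T.homog_elem n (c \<otimes> a))) = F.homog_elem 0 c \<odot>\<^bsub>Free\<^esub> fst (h (T.homog_elem n a))" by simp
  then show ?thesis unfolding coord_def Free_simps(3) using assms(3) by (simp only: restrict_apply if_True)
qed

lemma coord_of_mpow_Suc:
  assumes "a \<in> mpow (Suc n)" "p \<in> I0" shows "coord n p a = \<zero>\<^bsub>F.G\<^esub>"
proof -
  have "a \<in> mpow n" using assms(1) mpow_antimono[of n "Suc n"] by auto
  then have "T.homog_elem n a = \<zero>\<^bsub>T.G\<^esub>" using T.homog_elem_eq_zero_iff assms(1) by blast
  then have "fst (h (T.homog_elem n a)) = (\<lambda>p\<in>I0. \<zero>\<^bsub>F.G\<^esub>)" by (simp only: h_zero fst_conv)
  then show ?thesis unfolding coord_def using assms(2) by (simp only: restrict_apply if_True)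
qed

lemma coord_basis:
  assumes p: "p \<in> I0" "fst p \<le> n"
  shows "\<exists>a\<in>mpow n. coord n p a = F.homog_elem (n - fst p) (x [^] (n - fst p)) \<and>
    (\<forall>q\<in>I0 - {p}. coord n q a = \<zero>\<^bsub>F.G\<^esub>)"
proof -
  let ?e = "F.homog_elem (n - fst p) (x [^] (n - fst p))"
  define u where "u = (\<lambda>q\<in>I0. if q = p then ?e else \<zero>\<^bsub>F.G\<^esub>)"
  have e: "?e \<in> graded_part F.G (n - fst p)" unfolding F.graded_part_eq using x_pow_in_xpowI by blast
  have z: "\<zero>\<^bsub>F.G\<^esub> \<in> graded_part F.G m" for m
    using F.G_zero_carrier by (simp add: graded_part_def)
  have "u \<in> homog Free n" unfolding Free_simps(4) u_def
    by (rule restrict_PiE_iff[THEN iffD2], rule ballI) (use e z p(2) in auto)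
  moreover have "(\<lambda>_. undefined) \<in> homog Tors n" unfolding no_torsion by (simp add: graded_dsum_def)
  ultimately have "(u, \<lambda>_. undefined) \<in> h ` graded_part T.G n" unfolding h_homog by (simp only: mem_Sigma_iff)
  then obtain a where a: "a \<in> mpow n" "h (T.homog_elem n a) = (u, \<lambda>_. undefined)"
    unfolding T.graded_part_eq by force
  have "coord n q a = u q" for q by (simp add: coord_def a(2))
  then show ?thesis using a(1) p(1) by (intro bexI[of _ a]) (auto simp: u_def)
qed

lemma supported_ideal: "ideal (supported n K) A"
proof (rule ideal_of_closed)
  show "supported n K \<subseteq> carrier A" unfolding supported_def using mpow_closed by blast
  have "\<zero> \<in> supported n K" unfolding supported_def
    using coord_of_mpow_Suc[of \<zero>] T.N_zero T.L_zero by simp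
  then show "supported n K \<noteq> {}" by blast
  show "a \<oplus> b \<in> supported n K" if "a \<in> supported n K" "b \<in> supported n K" for a b
  proof -
    have ab: "a \<in> mpow n" "b \<in> mpow n" using that by (simp_all add: supported_def)
    have "coord n p (a \<oplus> b) = \<zero>\<^bsub>F.G\<^esub>" if p: "p \<in> I0 - K" for p
    proof -
      have "coord n p a = \<zero>\<^bsub>F.G\<^esub>" "coord n p b = \<zero>\<^bsub>F.G\<^esub>" "p \<in> I0"
        using p \<open>a \<in> supported n K\<close> \<open>b \<in> supported n K\<close> unfolding supported_def by blast+
      then show ?thesis using coord_add[OF ab] by simp
    qed
    then show ?thesis unfolding supported_def using mpow_add[OF ab] by blast
  qed
  show "c \<otimes> a \<in> supported n K" if c: "c \<in> carrier A" and a: "a \<in> supported n K" for c a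
  proof -
    have a': "a \<in> mpow n" using a by (simp add: supported_def)
    have c0: "c \<in> xpowI 0" using xpowI_I[OF c, of 0] c by simp
    have "coord n p (c \<otimes> a) = \<zero>\<^bsub>F.G\<^esub>" if p: "p \<in> I0 - K" for p
    proof -
      have "coord n p a = \<zero>\<^bsub>F.G\<^esub>" "p \<in> I0" using p a unfolding supported_def by blast+
      then show ?thesis using coord_smult[OF c a'] Fc.r_null[OF F.single_carrier[OF c0]] by simp
    qed
    then show ?thesis unfolding supported_def using ideal.I_l_closed[OF mpow_ideal a' c] by blast
  qed
qed

lemma supported_empty: "supported n {} = mpow (Suc n)"
proof
  show "mpow (Suc n) \<subseteq> supported n {}"
    unfolding supported_def using coord_of_mpow_Suc mpow_antimono[of n "Suc n"] by auto
  show "supported n {} \<subseteq> mpow (Suc n)"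
  proof
    fix a assume "a \<in> supported n {}"
    then have a: "a \<in> mpow n" "\<And>p. p \<in> I0 \<Longrightarrow> coord n p a = \<zero>\<^bsub>F.G\<^esub>" unfolding supported_def by blast+
    have hc: "h (T.homog_elem n a) \<in> carrier Free \<times> carrier Tors"
      using h_bij T.single_carrier[OF a(1)] by (auto simp: bij_betw_def)
    have "fst (h (T.homog_elem n a)) = (\<lambda>p\<in>I0. \<zero>\<^bsub>F.G\<^esub>)"
    proof (rule extensionalityI)
      have "fst (h (T.homog_elem n a)) \<in> (\<Pi>\<^sub>E p\<in>I0. carrier F.G)"
        using hc by (simp only: mem_Times_iff Free_simps(1))
      then show "fst (h (T.homog_elem n a)) \<in> extensional I0" by (simp only: PiE_def Int_iff)
      show "fst (h (T.homog_elem n a)) p = (\<lambda>p\<in>I0. \<zero>\<^bsub>F.G\<^esub>) p" if "p \<in> I0" for p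
        using a(2)[OF that] that unfolding coord_def by (simp only: restrict_apply if_True)
    qed simp
    moreover have "snd (h (T.homog_elem n a)) = (\<lambda>q\<in>IT. J q)"
    proof -
      have "snd (h (T.homog_elem n a)) \<in> (\<Pi>\<^sub>E q\<in>IT. (\<lambda>v. J q +>\<^bsub>F.G\<^esub> v) ` carrier F.G)"
        using hc by (simp only: mem_Times_iff Tors_simps(1))
      then show ?thesis unfolding no_torsion by (simp add: restrict_def)
    qed
    ultimately have "h (T.homog_elem n a) = h \<zero>\<^bsub>T.G\<^esub>" unfolding h_zero by (rule prod_eqI[where q = "(_, _)", unfolded fst_conv snd_conv])
    then have "T.homog_elem n a = \<zero>\<^bsub>T.G\<^esub>"
      using inj_onD[OF bij_betw_imp_inj_on[OF h_bij]] T.single_carrier[OF a(1)] T.G_zero_carrier by blast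
    then show "a \<in> mpow (Suc n)" using T.homog_elem_eq_zero_iff[OF a(1)] by blast
  qed
qed

lemma supported_I0: "supported n I0 = mpow n"
  by (auto simp: supported_def)

lemma supported_mono: "K \<subseteq> K' \<Longrightarrow> supported n K \<subseteq> supported n K'"
  unfolding supported_def by blast

lemma F_homog_x_pow_nonzero: "F.homog_elem k (x [^] k) \<noteq> \<zero>\<^bsub>F.G\<^esub>"
proof
  assume "F.homog_elem k (x [^] k) = \<zero>\<^bsub>F.G\<^esub>"
  then have "x [^] k \<in> x [^] k <# \<mm>" using F.homog_elem_eq_zero_iff[OF x_pow_in_xpowI] by blast
  then show False using x_pow_max_subset x_pow_notin by blast
qed

text \<open>For \<open>i \<le> n\<close> the step is generated by an element \<open>a\<close> whose only nonzero coordinate is a power of \<open>x*\<close> at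
the new index: every other element \<open>b\<close> has the same coordinate there as some multiple \<open>c a\<close>, and
\<open>b - c a\<close> lies in the smaller ideal. For \<open>i > n\<close> the summand has no part of degree \<open>n\<close>.\<close>

lemma supported_insert_length:
  assumes p: "p \<in> I0" "p \<notin> K"
  shows "ideal_length A (supported n K) (supported n (insert p K)) = (if fst p \<le> n then 1 else 0)"
proof (cases "fst p \<le> n")
  case False
  have "supported n (insert p K) \<subseteq> supported n K"
  proof
    fix a assume a: "a \<in> supported n (insert p K)"
    then have an: "a \<in> mpow n" by (simp add: supported_def)
    have "coord n p a = \<zero>\<^bsub>F.G\<^esub>" using coord_homog[OF an p(1)] False by simp
    then show "a \<in> supported n K" using a unfolding supported_def by blast
  qed
  then have "supported n (insert p K) = supported n K" using supported_mono[of K "insert p K" n] by blast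
  then show ?thesis using False by (simp add: ideal_length_self)
next
  case True
  let ?k = "n - fst p"
  obtain a where a: "a \<in> mpow n" "coord n p a = F.homog_elem ?k (x [^] ?k)"
    "\<And>q. q \<in> I0 - {p} \<Longrightarrow> coord n q a = \<zero>\<^bsub>F.G\<^esub>" using coord_basis[OF p(1) True] by blast
  have aK: "a \<in> supported n (insert p K)" using a unfolding supported_def by blast
  have "ideal_length A (supported n K) (supported n (insert p K)) = 1"
  proof (rule ideal_length_adjoin[OF supported_ideal supported_ideal supported_mono aK])
    show "a \<notin> supported n K"
    proof
      assume "a \<in> supported n K"
      then have "coord n p a = \<zero>\<^bsub>F.G\<^esub>" using p unfolding supported_def by blast
      then show False using a(2) F_homog_x_pow_nonzero by simp
    qed
    show "m \<otimes> a \<in> supported n K" if "m \<in> \<mm>" for m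
      using max_mult_mpow[OF that a(1)] supported_empty supported_mono[of "{}" K n] by blast
  next
    fix b assume b: "b \<in> supported n (insert p K)"
    then have bn: "b \<in> mpow n" by (simp add: supported_def)
    have "coord n p b \<in> graded_part F.G ?k" using coord_homog[OF bn p(1)] True by simp
    then obtain e where e: "e \<in> xpowI ?k" "coord n p b = F.homog_elem ?k e" unfolding F.graded_part_eq by blast
    obtain c where c: "c \<in> carrier A" "e = c \<otimes> x [^] ?k" using xpowI_E[OF e(1)] by blast
    have c0: "c \<in> xpowI 0" using xpowI_I[OF c(1), of 0] c(1) by simp
    have "coord n p b = F.homog_elem 0 c \<otimes>\<^bsub>F.G\<^esub> F.homog_elem ?k (x [^] ?k)"
      unfolding e(2) c(2) using F.homog_elem_mult[OF c0 x_pow_in_xpowI[of ?k]] by simp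
    then have bp: "coord n p b = coord n p (c \<otimes> a)" using coord_smult[OF c(1) a(1) p(1)] a(2) by simp
    have ca: "c \<otimes> a \<in> mpow n" by (rule ideal.I_l_closed[OF mpow_ideal a(1) c(1)])
    define l where "l = b \<ominus> c \<otimes> a"
    have l: "l \<in> mpow n" unfolding l_def a_minus_def by (rule mpow_add[OF bn T.N_neg[OF ca]])
    have bl: "b = l \<oplus> c \<otimes> a"
      unfolding l_def using mpow_closed[OF bn] mpow_closed[OF ca] by (simp add: a_minus_def a_assoc l_neg)
    have sum: "coord n q b = coord n q l \<oplus>\<^bsub>F.G\<^esub> coord n q (c \<otimes> a)" if "q \<in> I0" for q
      using coord_add[OF l ca that] bl by simp
    have "coord n q l = \<zero>\<^bsub>F.G\<^esub>" if q: "q \<in> I0 - K" for q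
    proof -
      have qI: "q \<in> I0" using q by blast
      have "coord n q b = coord n q (c \<otimes> a)"
      proof (cases "q = p")
        case True
        then show ?thesis using bp by simp
      next
        case False
        then have "coord n q a = \<zero>\<^bsub>F.G\<^esub>" using a(3) q by blast
        then have "coord n q (c \<otimes> a) = \<zero>\<^bsub>F.G\<^esub>"
          using coord_smult[OF c(1) a(1) qI] Fc.r_null[OF F.single_carrier[OF c0]] by simp
        moreover have "q \<in> I0 - insert p K" using q False by blast
        then have "coord n q b = \<zero>\<^bsub>F.G\<^esub>" using b unfolding supported_def by blast
        ultimately show ?thesis by simp
      qed
      then have "coord n q l \<oplus>\<^bsub>F.G\<^esub> coord n q (c \<otimes> a) = coord n q (c \<otimes> a)" using sum[OF qI] by simp
      then show ?thesis
        using Fc.add.r_cancel_one[OF coord_closed[OF ca qI] coord_closed[OF l qI]] by simp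
    qed
    then have "l \<in> supported n K" unfolding supported_def using l by blast
    then show "\<exists>l\<in>supported n K. \<exists>c\<in>carrier A. b = l \<oplus> c \<otimes> a" using bl c(1) by blast
  qed blast
  then show ?thesis using True by simp
qed

lemma I0_finite: "finite I0"
  by (rule finite_subset[of _ "Sigma {..red} (\<lambda>i. {..<\<alpha> i})"]) auto

lemma hilb_eq_card: "hilb n = enat (card {p \<in> I0. fst p \<le> n})"
proof -
  have "finite K \<Longrightarrow> K \<subseteq> I0 \<Longrightarrow> ideal_length A (mpow (Suc n)) (supported n K) = enat (card {p \<in> K. fst p \<le> n})" for K
  proof (induction K rule: finite_induct)
    case empty
    show ?case by (simp add: supported_empty ideal_length_self zero_enat_def)
  next
    case (insert p K)
    then have pI: "p \<in> I0" and IH: "ideal_length A (mpow (Suc n)) (supported n K) = enat (card {p \<in> K. fst p \<le> n})" by blast+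
    have sub: "mpow (Suc n) \<subseteq> supported n K" using supported_mono[of "{}" K n] supported_empty by blast
    have "ideal_length A (mpow (Suc n)) (supported n (insert p K))
        = ideal_length A (mpow (Suc n)) (supported n K) + ideal_length A (supported n K) (supported n (insert p K))"
      by (rule ideal_length_add[OF mpow_ideal supported_ideal supported_ideal sub supported_mono]) blast
    also have "\<dots> = enat (card {p \<in> K. fst p \<le> n}) + (if fst p \<le> n then 1 else 0)"
      by (simp only: IH supported_insert_length[OF pI insert.hyps(2)])
    also have "\<dots> = enat (card {q \<in> insert p K. fst q \<le> n})"
    proof (cases "fst p \<le> n")
      case True
      then have "{q \<in> insert p K. fst q \<le> n} = insert p {q \<in> K. fst q \<le> n}" by auto
      then show ?thesis using True insert.hyps by (simp add: one_enat_def)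
    next
      case False
      then have "{q \<in> insert p K. fst q \<le> n} = {q \<in> K. fst q \<le> n}" by auto
      then show ?thesis using False by simp
    qed
    finally show ?case .
  qed
  from this[OF I0_finite order_refl] show ?thesis unfolding supported_I0 hilb_def .
qed

lemma alpha_add_hilb:
  assumes "Suc j \<le> red" shows "hilb (Suc j) = hilb j + enat (\<alpha> (Suc j))"
proof -
  have "{p \<in> I0. fst p \<le> Suc j} = {p \<in> I0. fst p \<le> j} \<union> Pair (Suc j) ` {..<\<alpha> (Suc j)}"
    using assms by (auto simp: le_Suc_eq)
  moreover have "card ({p \<in> I0. fst p \<le> j} \<union> Pair (Suc j) ` {..<\<alpha> (Suc j)})
      = card {p \<in> I0. fst p \<le> j} + card (Pair (Suc j) ` {..<\<alpha> (Suc j)})"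
    by (rule card_Un_disjoint) (use finite_subset[OF _ I0_finite] in auto)
  moreover have "card (Pair (Suc j) ` {..<\<alpha> (Suc j)}) = \<alpha> (Suc j)"
    by (subst card_image) (auto simp: inj_on_def)
  ultimately show ?thesis unfolding hilb_eq_card by simp
qed

end

section \<open>Equality of the invariants\<close>

text \<open>Positive depth provides a regular element \<open>y \<in> \<mm>\<close>, and \<open>y\<^sup>n\<^sup>+\<^sup>1 \<in> \<mm>\<^sup>n\<^sup>+\<^sup>1 = x \<mm>\<^sup>n\<close> is a multiple of \<open>x\<close>, so \<open>x\<close> is
regular as well.\<close>

lemma (in noetherian_local_ring) local_ring_reduction_of_depth:
  assumes "1 \<le> depth R \<mm>" and "minimal_reduction R \<mm> x"
  shows "local_ring_reduction R \<mm> x"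
proof
  show "x \<in> \<mm>" using assms(2) by (simp add: minimal_reduction_def)
  then have x: "x \<in> carrier R" by (rule ideal.Icarr[OF ideal_max])
  show "minimal_reduction R \<mm> x" by fact
  obtain y where y: "y \<in> \<mm>" "y \<in> regular_elements R" using regular_element_of_depth[OF assms(1)] by blast
  obtain n where n: "ideal_pow R \<mm> (Suc n) = x <# ideal_pow R \<mm> n"
    using assms(2) unfolding minimal_reduction_def by auto
  have "y [^] Suc n \<in> ideal_pow R \<mm> (Suc n)" by (rule ideal_pow_pow_closed[OF ideal_max y(1)])
  then obtain c where c: "c \<in> ideal_pow R \<mm> n" "y [^] Suc n = x \<otimes> c" unfolding n l_coset_def by blast
  have cc: "c \<in> carrier R" by (rule ideal.Icarr[OF ideal_pow_ideal[OF ideal_max] c(1)])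
  have yr: "y [^] Suc n \<in> regular_elements R"
    by (rule multiplicative_set.pow_mem[OF multiplicative_set_regular y(2)])
  have "a = \<zero>" if a: "a \<in> carrier R" "x \<otimes> a = \<zero>" for a
  proof -
    have "y [^] Suc n \<otimes> a = c \<otimes> (x \<otimes> a)" unfolding c(2) using x cc a(1) by (simp add: m_ac)
    also have "\<dots> = \<zero>" unfolding a(2) using cc by simp
    finally show ?thesis using yr a(1) unfolding regular_elements_def by blast
  qed
  then show "x \<in> regular_elements R" using x unfolding regular_elements_def by blast
qed

theorem theorem4p1:
  fixes A :: "('a, 'm) ring_scheme" and \<mm> :: "'a set" and x :: 'a and r i :: nat
    and \<alpha> :: "nat \<Rightarrow> nat" and \<alpha>t :: "nat \<Rightarrow> nat \<Rightarrow> nat"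
  assumes "cohen_macaulay_local_ring A \<mm>"
    and "krull_dim A = 1"
    and "infinite (carrier (A Quot \<mm>))"
    and "minimal_reduction A \<mm> x"
    and "r = reduction_number A \<mm> x"
    and "tangent_cone_invariants A \<mm> x \<alpha> \<alpha>t"
    and "cohen_macaulay_ring (tangent_cone A \<mm>)"
    and "1 \<le> i" and "i \<le> r"
  shows "0 < \<alpha> i
    \<and> ereal (real (\<alpha> i)) = micro_invariant A \<mm> x i
    \<and> micro_invariant A \<mm> x i = ereal_of_enat (apery_invariant A \<mm> x i)
    \<and> ereal_of_enat (apery_invariant A \<mm> x i)
        = ereal_of_enat (min_gens A (ideal_pow A \<mm> i))
          - ereal_of_enat (min_gens A (ideal_pow A \<mm> (i - 1)))"
proof -
  interpret CM: cohen_macaulay_local_ring A \<mm> by fact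
  interpret noetherian_local_ring A \<mm> ..
  have "1 \<le> depth A \<mm>" using CM.depth_eq_dim assms(2) by simp
  then interpret R: local_ring_reduction A \<mm> x using assms(4) by (rule local_ring_reduction_of_depth)
  interpret R: regular_initial_form A \<mm> x
    by unfold_locales (rule R.initial_form_regular[OF assms(7)])
  obtain j where i: "i = Suc j" using assms(8) by (cases i) auto
  have ij: "Suc j \<le> R.red" using assms(5,9) i by simp
  have cring: "cring R.T.G" using assms(7) by (simp add: cohen_macaulay_ring_def R.tangent_cone_eq)
  obtain h where h: "h \<in> graded_module_iso (F_ring A \<mm> x) (tangent_cone_module A \<mm>)
      (graded_dsum2
        (graded_dsum {(i, k). i \<le> R.red \<and> k < \<alpha> i} (\<lambda>(i, k). graded_shift i (F_module A \<mm> x)))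
        (graded_dsum {(i, j, k). i \<in> {1..R.red - 1} \<and> j \<in> {1..R.red - i} \<and> k < \<alpha>t i j}
          (\<lambda>(i, j, k). graded_shift i
            (graded_quot (F_module A \<mm> x) (PIdl\<^bsub>F_ring A \<mm> x\<^esub> (initial_form A \<mm> x [^]\<^bsub>F_ring A \<mm> x\<^esub> j))))))"
    using assms(6) unfolding tangent_cone_invariants_def Let_def by blast
  interpret S: tangent_cone_splitting A \<mm> x \<alpha> \<alpha>t h
    by (rule tangent_cone_splitting.intro[OF R.regular_initial_form_axioms
        tangent_cone_splitting_axioms.intro[OF cring h[unfolded R.F_ring_eq]]])
  obtain a b where ab: "R.hilb (Suc j) = enat a" "R.hilb j = enat b" using S.hilb_eq_card by blast
  have \<alpha>: "a = b + \<alpha> i" using S.alpha_add_hilb[OF ij] ab i by simp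
  have \<gamma>: "apery_invariant A \<mm> x i = enat (\<alpha> i)"
    using R.apery_invariant_add[of j] ab \<alpha> i by (cases "apery_invariant A \<mm> x i") auto
  have \<beta>: "micro_invariant A \<mm> x i = ereal (real (\<alpha> i))"
    using R.micro_invariant_eq[of j] ab \<alpha> i by simp
  have \<mu>: "min_gens A (ideal_pow A \<mm> i) = enat a" "min_gens A (ideal_pow A \<mm> (i - 1)) = enat b"
    using R.hilb_eq_min_gens[of "Suc j"] R.hilb_eq_min_gens[of j] ab i unfolding R.mpow_def by simp_all
  have "0 < \<alpha> i" using R.apery_invariant_pos[OF ij] \<gamma> i by (simp add: zero_enat_def)
  then show ?thesis unfolding \<beta> \<gamma> \<mu> using \<alpha> by simp
qed

end
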